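(* For all real-valued $h\in C^{1}(\mathbf{T})$ and all real-valued $\zeta\in H^1(\mathbf{T})$, the Dirichlet-to-Neumann operator $G(h)$ of the domain $\{(x,y)\in\mathbf{T}\times\mathbf{R}: y<h(x)\}$ satisfies $$\int_{\mathbf{T}}\frac{(G(h)\zeta)^2}{1+h_x^2}\,dx\le 4\int_{\mathbf{T}}\zeta_x^2\,dx,$$ and $$\int_{\mathbf{T}}\frac{\zeta_x^2}{1+h_x^2}\,dx\le 4\int_{\mathbf{T}}(G(h)\zeta)^2\,dx.$$
   Context: $\mathbf{T}$ is the one-dimensional torus (e.g. $\mathbf{R}/2\pi\mathbf{Z}$) and $f_x=\partial_xf$. For $h\in W^{1,\infty}(\mathbf{T})$ and $\zeta\in H^{1/2}(\mathbf{T})$, let $\phi$ be the unique variational solution (with $\nabla_{x,y}\phi\in L^2(\Omega)$) of $$\Delta_{x,y}\phi=0\ \text{ in }\Omega=\{(x,y)\in\mathbf{T}\times\mathbf{R}:\ y<h(x)\},\qquad \phi(x,h(x))=\zeta(x),\qquad \lim_{y\to-\infty}\sup_{x\in\mathbf{T}}|\nabla_{x,y}\phi(x,y)|=0 .$$ The Dirichlet-to-Neumann operator is $G(h)\zeta=(\partial_y\phi-h_x\partial_x\phi)|_{y=h}$, where $f|_{y=h}$ denotes $x\mapsto f(x,h(x))$. A priori $G(h)\zeta$ is the element of $H^{-1/2}(\mathbf{T})$ defined by the weak formula $\langle G(h)\zeta,\Phi|_{y=h}\rangle=\iint_\Omega\nabla_{x,y}\phi\cdot\nabla_{x,y}\Phi\,dy\,dx$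 for all $\Phi\in C_c^\infty(\mathbf{T}\times\mathbf{R})$; for $h\in C^1(\mathbf{T})$ and $\zeta\in H^1(\mathbf{T})$ it belongs to $L^2(\mathbf{T})$. *)

theory Defs
  imports "HOL-Analysis.Analysis"
begin

text \<open>
  The torus is \<open>\<real>/2\<pi>\<int>\<close>. A function on it is a \<open>2\<pi>\<close>-periodic function on \<open>\<real>\<close>, a function on
  (a subset of) \<open>T \<times> \<real>\<close> is a function on the plane that is \<open>2\<pi>\<close>-periodic in its first variable,
  and integrals are taken over one period. Elements of Lebesgue and Sobolev spaces are given by
  representatives; apart from periodicity, every condition below on such a function is insensitive
  to changing it on a null set.
\<close>

definition periodic_fun :: "(real \<Rightarrow> real) \<Rightarrow> bool" where
  "periodic_fun f \<longleftrightarrow> (\<forall>x. f (x + 2 * pi) = f x)"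

definition x_periodic :: "(real \<times> real \<Rightarrow> real) \<Rightarrow> bool" where
  "x_periodic f \<longleftrightarrow> (\<forall>x y. f (x + 2 * pi, y) = f (x, y))"

definition L2_on :: "'a::euclidean_space set \<Rightarrow> ('a \<Rightarrow> real) \<Rightarrow> bool" where
  "L2_on S f \<longleftrightarrow> set_borel_measurable lborel S f \<and> set_integrable lborel S (\<lambda>p. (f p)\<^sup>2)"


subsection \<open>Test functions\<close>

primrec Ck :: "nat \<Rightarrow> ('a::euclidean_space \<Rightarrow> real) \<Rightarrow> bool" where
  "Ck 0 f \<longleftrightarrow> continuous_on UNIV f"
| "Ck (Suc k) f \<longleftrightarrow> f differentiable_on UNIV \<and>
     (\<forall>b\<in>Basis. Ck k (\<lambda>p. frechet_derivative f (at p) b))"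

definition smooth :: "('a::euclidean_space \<Rightarrow> real) \<Rightarrow> bool" where
  "smooth f \<longleftrightarrow> (\<forall>k. Ck k f)"

definition Dx :: "(real \<times> real \<Rightarrow> real) \<Rightarrow> real \<times> real \<Rightarrow> real" where
  "Dx f p = frechet_derivative f (at p) (1, 0)"

definition Dy :: "(real \<times> real \<Rightarrow> real) \<Rightarrow> real \<times> real \<Rightarrow> real" where
  "Dy f p = frechet_derivative f (at p) (0, 1)"

text \<open>
  \<open>C\<^sub>c\<^sup>\<infinity>(T \<times> \<real>)\<close>: since \<open>T\<close> is compact, compact support means that the support is bounded in \<open>y\<close>.
\<close>

definition test_fun :: "(real \<times> real \<Rightarrow> real) \<Rightarrow> bool" where
  "test_fun F \<longleftrightarrow> smooth F \<and> x_periodic F \<and> (\<exists>R. \<forall>x y. F (x, y) \<noteq> 0 \<longrightarrow> \<bar>y\<bar> \<le> R)"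

definition fluid :: "(real \<Rightarrow> real) \<Rightarrow> (real \<times> real) set" where
  "fluid h = {(x, y). y < h x}"

definition fluid_cell :: "(real \<Rightarrow> real) \<Rightarrow> (real \<times> real) set" where
  "fluid_cell h = {(x, y). 0 \<le> x \<and> x \<le> 2 * pi \<and> y < h x}"

definition inner_test_fun :: "(real \<Rightarrow> real) \<Rightarrow> (real \<times> real \<Rightarrow> real) \<Rightarrow> bool" where
  "inner_test_fun h F \<longleftrightarrow> test_fun F \<and> closure {p. F p \<noteq> 0} \<subseteq> fluid h"


subsection \<open>Function spaces on the torus\<close>

definition C1_torus :: "(real \<Rightarrow> real) \<Rightarrow> bool" where
  "C1_torus h \<longleftrightarrow> periodic_fun h \<and> h C1_differentiable_on UNIV"

definition L2_torus :: "(real \<Rightarrow> real) \<Rightarrow> bool" where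
  "L2_torus f \<longleftrightarrow> periodic_fun f \<and> L2_on {0..2 * pi} f"

text \<open>\<open>f \<in> H\<^sup>1(T)\<close> with weak derivative \<open>f'\<close>, which is unique almost everywhere.\<close>

definition H1_torus :: "(real \<Rightarrow> real) \<Rightarrow> (real \<Rightarrow> real) \<Rightarrow> bool" where
  "H1_torus f f' \<longleftrightarrow> L2_torus f \<and> L2_torus f' \<and>
     (\<forall>\<theta>. smooth \<theta> \<and> periodic_fun \<theta> \<longrightarrow>
        (LINT x:{0..2 * pi}|lborel. f x * deriv \<theta> x) =
        - (LINT x:{0..2 * pi}|lborel. f' x * \<theta> x))"


subsection \<open>The variational solution and the Dirichlet-to-Neumann operator\<close>

text \<open>
  Functions on the fluid domain with square integrable weak gradient \<open>(u, v)\<close>. The function itself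
  is only required to be square integrable above every depth (constants have finite energy).
\<close>

definition finite_energy ::
  "(real \<Rightarrow> real) \<Rightarrow> (real \<times> real \<Rightarrow> real) \<Rightarrow> (real \<times> real \<Rightarrow> real) \<Rightarrow> (real \<times> real \<Rightarrow> real) \<Rightarrow> bool" where
  "finite_energy h \<phi> u v \<longleftrightarrow>
     x_periodic \<phi> \<and> x_periodic u \<and> x_periodic v \<and>
     (\<forall>R. L2_on (fluid_cell h \<inter> {p. - R < snd p}) \<phi>) \<and>
     L2_on (fluid_cell h) u \<and> L2_on (fluid_cell h) v \<and>
     (\<forall>F. inner_test_fun h F \<longrightarrow>
        (LINT p:fluid_cell h|lborel. \<phi> p * Dx F p) = - (LINT p:fluid_cell h|lborel. u p * F p) \<and>
        (LINT p:fluid_cell h|lborel. \<phi> p * Dy F p) = - (LINT p:fluid_cell h|lborel. v p * F p))"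

text \<open>
  \<open>\<phi>(x, h(x)) = \<zeta>(x)\<close> in the sense of traces. The trace is the continuous extension of the
  restriction \<open>F \<mapsto> F(\<cdot>, h(\<cdot>))\<close> from smooth functions, so \<open>\<phi>\<close> has to be a limit of smooth
  functions, in \<open>H\<^sup>1\<close> above every depth, whose restrictions converge to \<open>\<zeta>\<close> in \<open>L\<^sup>2(T)\<close>.
  Nonnegative integrals are used because they do not silently vanish when the integral diverges.
\<close>

definition has_trace ::
  "(real \<Rightarrow> real) \<Rightarrow> (real \<times> real \<Rightarrow> real) \<Rightarrow> (real \<times> real \<Rightarrow> real) \<Rightarrow> (real \<times> real \<Rightarrow> real)
    \<Rightarrow> (real \<Rightarrow> real) \<Rightarrow> bool" where
  "has_trace h \<phi> u v \<zeta> \<longleftrightarrow>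
     (\<exists>F :: nat \<Rightarrow> real \<times> real \<Rightarrow> real.
        (\<forall>n. test_fun (F n)) \<and>
        (\<forall>R. (\<lambda>n. \<integral>\<^sup>+p\<in>fluid_cell h \<inter> {p. - R < snd p}.
                   ennreal ((F n p - \<phi> p)\<^sup>2 + (Dx (F n) p - u p)\<^sup>2 + (Dy (F n) p - v p)\<^sup>2) \<partial>lborel)
             \<longlonglongrightarrow> 0) \<and>
        (\<lambda>n. \<integral>\<^sup>+x\<in>{0..2 * pi}. ennreal ((F n (x, h x) - \<zeta> x)\<^sup>2) \<partial>lborel) \<longlonglongrightarrow> 0)"

text \<open>
  \<open>\<phi>\<close>, with weak gradient \<open>(u, v)\<close>, is the variational solution with Dirichlet data \<open>\<zeta>\<close>. The third
  conjunct is the weak form of \<open>\<Delta>\<phi> = 0\<close>; the last one is the decay of the gradient, with the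
  supremum over \<open>x\<close> and \<open>y < Y\<close> read as an essential supremum (\<open>u\<close> and \<open>v\<close> are representatives).
\<close>

definition variational_solution ::
  "(real \<Rightarrow> real) \<Rightarrow> (real \<Rightarrow> real) \<Rightarrow> (real \<times> real \<Rightarrow> real) \<Rightarrow> (real \<times> real \<Rightarrow> real)
    \<Rightarrow> (real \<times> real \<Rightarrow> real) \<Rightarrow> bool" where
  "variational_solution h \<zeta> \<phi> u v \<longleftrightarrow>
     finite_energy h \<phi> u v \<and>
     has_trace h \<phi> u v \<zeta> \<and>
     (\<forall>F. inner_test_fun h F \<longrightarrow>
        (LINT p:fluid_cell h|lborel. u p * Dx F p + v p * Dy F p) = 0) \<and>
     (\<forall>\<epsilon>>0. \<exists>Y. AE p in lborel. snd p < Y \<longrightarrow> norm (u p, v p) \<le> \<epsilon>)"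

text \<open>
  \<open>G(h)\<zeta> = g\<close> as an element of \<open>L\<^sup>2(T)\<close>: the functional of the weak formula is represented by
  \<open>g\<close>, which determines \<open>g\<close> almost everywhere.
\<close>

definition dirichlet_to_neumann :: "(real \<Rightarrow> real) \<Rightarrow> (real \<Rightarrow> real) \<Rightarrow> (real \<Rightarrow> real) \<Rightarrow> bool" where
  "dirichlet_to_neumann h \<zeta> g \<longleftrightarrow>
     L2_torus g \<and>
     (\<exists>\<phi> u v. variational_solution h \<zeta> \<phi> u v \<and>
        (\<forall>F. test_fun F \<longrightarrow>
           (LINT x:{0..2 * pi}|lborel. g x * F (x, h x)) =
           (LINT p:fluid_cell h|lborel. u p * Dx F p + v p * Dy F p)))"

end

theory Submission
  imports Defs
begin

text \<open>
  The function \<open>\<phi>\<^sub>x - \<i> \<phi>\<^sub>y\<close> is holomorphic and decays, so the integral of its square over the boundary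
  curve \<open>z(x) = x + \<i> h(x)\<close> vanishes. Since \<open>(\<phi>\<^sub>x - \<i> \<phi>\<^sub>y) dz = (\<zeta>\<^sub>x - \<i> G\<zeta>) dx\<close> on the boundary, with
  \<open>F = \<zeta>\<^sub>x - \<i> G\<zeta>\<close> this says \<open>\<integral> F\<^sup>2 / z' dx = 0\<close>. The real part is the Rellich identity
  \<open>\<integral> (\<zeta>\<^sub>x\<^sup>2 - (G\<zeta>)\<^sup>2 - 2 \<zeta>\<^sub>x G\<zeta> h\<^sub>x) / (1 + h\<^sub>x\<^sup>2) = 0\<close>, from which both inequalities follow by completing squares.

  No regularity of the solution up to the boundary is needed. Testing the weak formulas with
  \<open>exp (- \<i> k z)\<close>, cut off at depth, gives \<open>\<integral> F w\<^sup>k dx = 0\<close> for \<open>k \<ge> 0\<close>, where \<open>w = exp (- \<i> z)\<close> parametrises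
  a star-shaped curve. By uniform approximation \<open>F\<close> annihilates the Cauchy kernels with poles at \<open>r w(s)\<close>,
  \<open>r > 1\<close>, and therefore \<open>\<integral>\<integral> F(x) F(s) P\<^sub>r(x, s) dx ds = 0\<close> for the symmetric Poisson-like kernel \<open>P\<^sub>r\<close>
  built from \<open>w(x) / w(s)\<close>. As \<open>\<integral> P\<^sub>r(x, s) z'(s) ds = - 4 \<pi>\<close> for every \<open>x\<close> and \<open>P\<^sub>r\<close> concentrates on the diagonal as
  \<open>r \<rightarrow> 1\<close>, the double integral tends to \<open>- 4 \<pi> \<integral> F\<^sup>2 / z' dx\<close>.
\<close>

subsection \<open>Smooth functions and test functions\<close>

text \<open>The obstacle is the boundary behaviour: a priori the gradient is only square integrable
  inside the domain, so the square of the holomorphic function cannot be integrated along the curve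
  directly. The identity is therefore derived from the moments of the boundary function F alone. The
  Cauchy kernel with pole at \<open>r w(s)\<close> has size 1 / ((r - 1) + |x - s|), whose integral
  grows logarithmically as r tends to 1; handled by itself it would call for singular integral
  estimates on a C1 curve. Adding the same kernel with x and s exchanged cancels its singular part.
  What remains is bounded by a multiple of (r - 1) / ((r - 1)^2 + (x - s)^2), an absolutely
  convergent approximate identity, and each half still gives 0 against F(x) F(s), one by integrating
  in x and the other by integrating in s. The passage r \<rightarrow> 1 then rests on the continuity
  of translations in L2.\<close>

lemma Ck_Suc_D: "Ck (Suc k) f \<Longrightarrow> Ck k f"
proof (induction k arbitrary: f)
  case 0
  then show ?case by (simp add: differentiable_imp_continuous_on)
next
  case (Suc k)
  have "f differentiable_on UNIV" "\<forall>b\<in>Basis. Ck (Suc k) (\<lambda>p. frechet_derivative f (at p) b)"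
    using Suc.prems unfolding Ck.simps(2)[of "Suc k"] by blast+
  with Suc.IH show ?case unfolding Ck.simps(2)[of k] by blast
qed

lemma Ck_SucI:
  assumes "\<And>p. (f has_derivative f' p) (at p)"
    and "\<And>b. b \<in> Basis \<Longrightarrow> Ck k (\<lambda>p. f' p b)"
  shows "Ck (Suc k) f"
proof -
  have "frechet_derivative f (at p) = f' p" for p
    using frechet_derivative_at[OF assms(1)] by (rule sym)
  moreover have "f differentiable_on UNIV"
    using assms(1) by (meson differentiable_def differentiable_at_imp_differentiable_on)
  ultimately show ?thesis
    using assms(2) by simp
qed

lemma Ck_Suc_has_derivative:
  assumes "Ck (Suc k) f"
  shows "(f has_derivative frechet_derivative f (at p)) (at p)"
  using assms by (simp add: differentiable_on_def frechet_derivative_works)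

lemma Ck_add: "Ck k f \<Longrightarrow> Ck k g \<Longrightarrow> Ck k (\<lambda>p. f p + g p)"
proof (induction k arbitrary: f g)
  case 0
  then show ?case by (simp add: continuous_on_add)
next
  case (Suc k)
  show ?case
  proof (rule Ck_SucI)
    show "((\<lambda>p. f p + g p) has_derivative
      (\<lambda>v. frechet_derivative f (at p) v + frechet_derivative g (at p) v)) (at p)" for p
      by (intro has_derivative_add Ck_Suc_has_derivative[OF Suc.prems(1)] Ck_Suc_has_derivative[OF Suc.prems(2)])
  qed (use Suc in auto)
qed

lemma Ck_mult: "Ck k f \<Longrightarrow> Ck k g \<Longrightarrow> Ck k (\<lambda>p. f p * g p)"
proof (induction k arbitrary: f g)
  case 0
  then show ?case by (simp add: continuous_on_mult)
next
  case (Suc k)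
  show ?case
  proof (rule Ck_SucI)
    show "((\<lambda>p. f p * g p) has_derivative
      (\<lambda>v. f p * frechet_derivative g (at p) v + frechet_derivative f (at p) v * g p)) (at p)" for p
      by (intro has_derivative_mult Ck_Suc_has_derivative[OF Suc.prems(1)] Ck_Suc_has_derivative[OF Suc.prems(2)])
    show "Ck k (\<lambda>p. f p * frechet_derivative g (at p) b + frechet_derivative f (at p) b * g p)"
      if "b \<in> Basis" for b
      using that Suc Ck_Suc_D by (intro Ck_add Suc.IH) auto
  qed
qed

lemma smooth_add: "smooth f \<Longrightarrow> smooth g \<Longrightarrow> smooth (\<lambda>p. f p + g p)"
  by (simp add: smooth_def Ck_add)

lemma smooth_mult: "smooth f \<Longrightarrow> smooth g \<Longrightarrow> smooth (\<lambda>p. f p * g p)"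
  by (simp add: smooth_def Ck_mult)

lemma Ck_Suc_realI:
  fixes f :: "real \<Rightarrow> real"
  assumes "\<And>x. (f has_real_derivative f' x) (at x)" and "Ck k f'"
  shows "Ck (Suc k) f"
proof (rule Ck_SucI)
  show "(f has_derivative (\<lambda>v. f' x * v)) (at x)" for x
    using assms(1) unfolding has_field_derivative_def .
  show "Ck k (\<lambda>x. f' x * b)" if "b \<in> Basis" for b
    using assms(2) that by simp
qed

text \<open>A set of functions closed under differentiation certifies all orders at once. The
  concrete instances (\<open>flat\<close>, affine substitutions, sines, exponentials) supply such a
  set in place of formulas for higher derivatives.\<close>

lemma smooth_realI:
  fixes f :: "real \<Rightarrow> real"
  assumes "f \<in> A"
    and A: "\<And>f. f \<in> A \<Longrightarrow> \<exists>f'\<in>A. \<forall>x. (f has_real_derivative f' x) (at x)"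
  shows "smooth f"
proof -
  have "\<forall>f\<in>A. Ck k f" for k
  proof (induction k)
    case 0
    have "continuous_on UNIV f" if "f \<in> A" for f
      using A[OF that] by (meson DERIV_isCont continuous_at_imp_continuous_on)
    then show ?case by simp
  next
    case (Suc k)
    then show ?case using A Ck_Suc_realI by meson
  qed
  then show ?thesis using assms(1) by (simp add: smooth_def)
qed

lemma smooth_real_derivative:
  fixes f :: "real \<Rightarrow> real"
  assumes "smooth f"
  shows "\<exists>f'. smooth f' \<and> (\<forall>x. (f has_real_derivative f' x) (at x))"
proof -
  have ck: "Ck (Suc k) f" for k using assms by (simp add: smooth_def)
  have d: "(f has_real_derivative frechet_derivative f (at x) 1) (at x)" for x
  proof -
    have f': "(f has_derivative frechet_derivative f (at x)) (at x)"
      by (rule Ck_Suc_has_derivative[OF ck])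
    have "frechet_derivative f (at x) v = frechet_derivative f (at x) 1 * v" for v
      using linear_scale[OF has_derivative_linear[OF f'], of v 1] by simp
    then have "frechet_derivative f (at x) = (*) (frechet_derivative f (at x) 1)" by blast
    with f' show ?thesis unfolding has_field_derivative_def by metis
  qed
  have "smooth (\<lambda>x. frechet_derivative f (at x) 1)"
    using ck by (auto simp: smooth_def)
  with d show ?thesis by blast
qed

lemma smooth_real_primitive:
  fixes f :: "real \<Rightarrow> real"
  assumes "\<And>x. (f has_real_derivative f' x) (at x)" and "smooth f'"
  shows "smooth f"
proof -
  have "Ck k f" for k
    by (rule Ck_Suc_D, rule Ck_Suc_realI[OF assms(1)]) (use assms(2) in \<open>simp add: smooth_def\<close>)
  then show ?thesis by (simp add: smooth_def)
qed

lemma smooth_derivative: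
  fixes f :: "real \<Rightarrow> real"
  assumes "smooth f" "\<And>x. (f has_real_derivative f' x) (at x)"
  shows "smooth f'"
proof -
  obtain g where g: "smooth g" "\<And>x. (f has_real_derivative g x) (at x)"
    using smooth_real_derivative[OF assms(1)] by auto
  have "g = f'" using g(2) assms(2) DERIV_unique by blast
  with g(1) show ?thesis by simp
qed

lemma smooth_continuous: "smooth f \<Longrightarrow> continuous_on UNIV f"
  using Ck.simps(1)[of f] unfolding smooth_def by blast

lemma derivative_eq_0_below:
  fixes f :: "real \<Rightarrow> real"
  assumes "(f has_real_derivative d) (at y)" "\<And>x. x < c \<Longrightarrow> f x = 0" "y < c"
  shows "d = 0"
proof -
  have "((\<lambda>_. 0) has_real_derivative 0) (at y)" by simp
  then have "(f has_real_derivative 0) (at y)"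
    by (rule has_field_derivative_transform_within_open[where S = "{..<c}"]) (use assms in auto)
  with assms(1) show ?thesis using DERIV_unique by blast
qed

lemma Ck_fst:
  fixes a :: "real \<Rightarrow> real"
  shows "Ck k a \<Longrightarrow> Ck k (\<lambda>p::real \<times> real. a (fst p))"
proof (induction k arbitrary: a)
  case 0
  then show ?case by (auto intro!: continuous_on_compose2[of UNIV a] continuous_intros)
next
  case (Suc k)
  let ?D = "\<lambda>x. frechet_derivative a (at x)"
  have lin: "?D x 0 = 0" for x
    using has_derivative_linear[OF Ck_Suc_has_derivative[OF Suc.prems]] linear_0 by blast
  have "Ck k (\<lambda>p::real \<times> real. ?D (fst p) 1)"
    using Suc.prems by (intro Suc.IH) simp
  moreover have "Ck k (\<lambda>p::real \<times> real. 0)"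
    by (induction k) simp_all
  moreover have "((\<lambda>p::real \<times> real. a (fst p)) has_derivative (\<lambda>v. ?D (fst p) (fst v))) (at p)" for p
    by (rule has_derivative_compose[OF has_derivative_fst[OF has_derivative_ident] Ck_Suc_has_derivative[OF Suc.prems]])
  ultimately show ?case
    by (elim Ck_SucI) (auto simp: Basis_prod_def lin)
qed

lemma Ck_snd:
  fixes a :: "real \<Rightarrow> real"
  shows "Ck k a \<Longrightarrow> Ck k (\<lambda>p::real \<times> real. a (snd p))"
proof (induction k arbitrary: a)
  case 0
  then show ?case by (auto intro!: continuous_on_compose2[of UNIV a] continuous_intros)
next
  case (Suc k)
  let ?D = "\<lambda>x. frechet_derivative a (at x)"
  have lin: "?D x 0 = 0" for x
    using has_derivative_linear[OF Ck_Suc_has_derivative[OF Suc.prems]] linear_0 by blast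
  have "Ck k (\<lambda>p::real \<times> real. ?D (snd p) 1)"
    using Suc.prems by (intro Suc.IH) simp
  moreover have "Ck k (\<lambda>p::real \<times> real. 0)"
    by (induction k) simp_all
  moreover have "((\<lambda>p::real \<times> real. a (snd p)) has_derivative (\<lambda>v. ?D (snd p) (snd v))) (at p)" for p
    by (rule has_derivative_compose[OF has_derivative_snd[OF has_derivative_ident] Ck_Suc_has_derivative[OF Suc.prems]])
  ultimately show ?case
    by (elim Ck_SucI) (auto simp: Basis_prod_def lin)
qed

lemma smooth_tensor:
  fixes a b :: "real \<Rightarrow> real"
  assumes "smooth a" "smooth b"
  shows "smooth (\<lambda>p::real \<times> real. a (fst p) * b (snd p))"
  using assms by (simp add: smooth_def Ck_mult Ck_fst Ck_snd)

lemma tensor_partials: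
  assumes "\<And>x. (a has_real_derivative a' x) (at x)" "\<And>y. (b has_real_derivative b' y) (at y)"
  shows "Dx (\<lambda>p. a (fst p) * b (snd p)) p = a' (fst p) * b (snd p)"
    and "Dy (\<lambda>p. a (fst p) * b (snd p)) p = a (fst p) * b' (snd p)"
proof -
  have "((\<lambda>p. a (fst p) * b (snd p)) has_derivative
      (\<lambda>v. a (fst p) * (b' (snd p) * snd v) + (a' (fst p) * fst v) * b (snd p))) (at p)"
    by (rule has_derivative_mult[OF
        has_derivative_compose[OF has_derivative_fst[OF has_derivative_ident] assms(1)[unfolded has_field_derivative_def]]
        has_derivative_compose[OF has_derivative_snd[OF has_derivative_ident] assms(2)[unfolded has_field_derivative_def]]])
  from frechet_derivative_at[OF this, symmetric]
  show "Dx (\<lambda>p. a (fst p) * b (snd p)) p = a' (fst p) * b (snd p)"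
    "Dy (\<lambda>p. a (fst p) * b (snd p)) p = a (fst p) * b' (snd p)"
    by (simp_all add: Dx_def Dy_def)
qed

text \<open>The real and imaginary parts of exp (- i k z), cut off in y, are products of a periodic
  function of x and a function of y. All test functions constructed in the proof have this
  shape.\<close>

lemma test_fun_tensor:
  assumes "smooth a" "smooth b" "periodic_fun a" and "\<And>y. \<bar>y\<bar> > R \<Longrightarrow> b y = 0"
  shows "test_fun (\<lambda>p. a (fst p) * b (snd p))"
  using assms unfolding test_fun_def x_periodic_def periodic_fun_def
  by (auto simp: smooth_tensor intro!: exI[of _ R]) (meson not_le)

section \<open>Flat functions and a smooth step\<close>

definition flat :: "real poly \<Rightarrow> real \<Rightarrow> real" where
  "flat p x = (if x > 0 then poly p (1 / x) * exp (- (1 / x)) else 0)"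

lemma tendsto_poly_exp_minus: "((\<lambda>t. poly p t * exp (- t)) \<longlongrightarrow> (0::real)) at_top"
proof -
  have "((\<lambda>t. coeff p i * (t ^ i / exp t)) \<longlongrightarrow> (0::real)) at_top" for i
    by (intro tendsto_mult_right_zero tendsto_power_div_exp_0)
  then have "((\<lambda>t. \<Sum>i\<le>degree p. coeff p i * (t ^ i / exp t)) \<longlongrightarrow> (\<Sum>i\<le>degree p. (0::real))) at_top"
    by (rule tendsto_sum)
  then show ?thesis
    by (simp add: poly_altdef sum_distrib_right exp_minus field_simps sum_divide_distrib)
qed

text \<open>This is the difference quotient of \<open>flat p\<close> at 0. Division by x raises the
  degree in 1 / x by one (\<open>pCons 0 p\<close>), and the exponential still wins.\<close>

lemma tendsto_flat_quotient: "((\<lambda>x. flat p x / x) \<longlongrightarrow> 0) (at 0)"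
proof -
  have "((\<lambda>x. poly (pCons 0 p) (inverse x) * exp (- inverse x)) \<longlongrightarrow> 0) (at_right (0::real))"
    by (rule filterlim_compose[OF tendsto_poly_exp_minus filterlim_inverse_at_top_right])
  moreover have "\<forall>\<^sub>F x in at_right 0. poly (pCons 0 p) (inverse x) * exp (- inverse x) = flat p x / x"
    by (auto simp: eventually_at_right_field flat_def field_simps intro!: exI[of _ 1])
  ultimately have "((\<lambda>x. flat p x / x) \<longlongrightarrow> 0) (at_right 0)"
    by (rule Lim_transform_eventually)
  moreover have "((\<lambda>x. flat p x / x) \<longlongrightarrow> 0) (at_left 0)"
    by (rule Lim_transform_eventually[OF tendsto_const])
      (auto simp: eventually_at_left_field flat_def intro!: exI[of _ "-1"])
  ultimately show ?thesis by (simp add: filterlim_split_at)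
qed

text \<open>With t = 1 / x, the derivative of p(t) exp (- t) is t^2 (p(t) - p'(t)) exp (- t); the
  two \<open>pCons 0\<close> are the factor t^2. The family is indexed by arbitrary polynomials in
  order to be closed under differentiation.\<close>

lemma DERIV_flat:
  "(flat p has_real_derivative flat (pCons 0 (pCons 0 (p - pderiv p))) x) (at x)"
proof -
  consider "x > 0" | "x < 0" | "x = 0" by linarith
  then show ?thesis
  proof cases
    case 1
    have "((\<lambda>x. poly p (1 / x) * exp (- (1 / x))) has_real_derivative
        flat (pCons 0 (pCons 0 (p - pderiv p))) x) (at x)"
      using 1 by (auto intro!: derivative_eq_intros simp: flat_def power2_eq_square field_simps)
    then show ?thesis
      by (rule has_field_derivative_transform_within_open[where S = "{0<..}"])
        (use 1 in \<open>auto simp: flat_def\<close>)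
  next
    case 2
    have "((\<lambda>x. 0) has_real_derivative 0) (at x)" by simp
    then have "(flat p has_real_derivative 0) (at x)"
      by (rule has_field_derivative_transform_within_open[where S = "{..<0}"])
        (use 2 in \<open>auto simp: flat_def\<close>)
    with 2 show ?thesis by (simp add: flat_def)
  next
    case 3
    then show ?thesis
      using tendsto_flat_quotient[of p] by (simp add: has_field_derivative_iff flat_def)
  qed
qed

lemma smooth_flat: "smooth (flat p)"
  by (rule smooth_realI[of _ "range flat"]) (use DERIV_flat in blast)+

lemma smooth_const [simp]: "smooth (\<lambda>_::real. c::real)"
proof (rule smooth_realI[of _ "range (\<lambda>c _. c)"])
  show "\<exists>f'\<in>range (\<lambda>c _. c). \<forall>x. (f has_real_derivative f' x) (at x)"
    if "f \<in> range (\<lambda>c _. c)" for f :: "real \<Rightarrow> real"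
    using that by (intro bexI[of _ "\<lambda>_. 0"]) auto
qed auto

lemma smooth_affine: 
  fixes f :: "real \<Rightarrow> real"
  assumes "smooth f"
  shows "smooth (\<lambda>x. f (c * x + d))"
proof (rule smooth_realI[of _ "{g. \<exists>f k. smooth f \<and> g = (\<lambda>x. k * f (c * x + d))}"])
  show "(\<lambda>x. f (c * x + d)) \<in> {g. \<exists>f k. smooth f \<and> g = (\<lambda>x. k * f (c * x + d))}"
    using assms by (intro CollectI exI[of _ f] exI[of _ 1]) simp
  fix g assume "g \<in> {g. \<exists>f k. smooth f \<and> g = (\<lambda>x. k * f (c * x + d))}"
  then obtain f k where f: "smooth f" "g = (\<lambda>x. k * f (c * x + d))" by auto
  from smooth_real_derivative[OF f(1)] obtain f' where
    f': "smooth f'" "\<And>x. (f has_real_derivative f' x) (at x)" by auto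
  have "(g has_real_derivative (k * c) * f' (c * x + d)) (at x)" for x
    unfolding f(2) by (auto intro!: derivative_eq_intros DERIV_chain2[OF f'(2)])
  with f'(1) show "\<exists>g'\<in>{g. \<exists>f k. smooth f \<and> g = (\<lambda>x. k * f (c * x + d))}.
      \<forall>x. (g has_real_derivative g' x) (at x)"
    by (intro bexI[of _ "\<lambda>x. (k * c) * f' (c * x + d)"]) auto
qed

text \<open>The step is the normalised primitive of \<open>flat 1 x * flat 1 (1 - x)\<close>, a bump
  that is positive exactly on (0, 1).\<close>

lemma smooth_step_exists:
  obtains \<beta> \<beta>' :: "real \<Rightarrow> real"
  where "smooth \<beta>" "smooth \<beta>'" "\<And>x. (\<beta> has_real_derivative \<beta>' x) (at x)"
    "\<And>x. x \<le> 0 \<Longrightarrow> \<beta> x = 0" "\<And>x. x \<ge> 1 \<Longrightarrow> \<beta> x = 1" 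
    "\<And>x. x \<le> 0 \<or> x \<ge> 1 \<Longrightarrow> \<beta>' x = 0"
proof -
  define b where "b = (\<lambda>x. flat 1 x * flat 1 (- 1 * x + 1))"
  have b: "smooth b" unfolding b_def by (intro smooth_mult smooth_flat smooth_affine)
  have b0: "b x = 0" if "x \<le> 0 \<or> x \<ge> 1" for x using that by (auto simp: b_def flat_def)
  have bpos: "b x > 0" if "0 < x" "x < 1" for x using that by (auto simp: b_def flat_def)
  have bnn: "b x \<ge> 0" for x using b0[of x] bpos[of x] by fastforce
  have cb: "continuous_on S b" for S
    using smooth_continuous[OF b] continuous_on_subset by blast
  \<comment> \<open>The lower limit - 1 lies strictly left of the support of b, so the fundamental
    theorem gives two-sided derivatives around [0, 1]; further left B is 0.\<close>
  define B where "B = (\<lambda>x. integral {- 1..x} b)"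
  have B: "(B has_real_derivative b x) (at x)" if "x > -1" for x
  proof -
    have "(B has_real_derivative b x) (at x within {-1..x+1})"
      unfolding B_def using that by (intro integral_has_real_derivative cb) auto
    then show ?thesis using that by (simp add: at_within_Icc_at)
  qed
  have B0: "B x = 0" if "x \<le> 0" for x
  proof -
    have "B x = integral {-1..x} (\<lambda>x. 0)"
      unfolding B_def using that by (intro integral_cong) (auto intro: b0)
    then show ?thesis by simp
  qed
  have B': "(B has_real_derivative b x) (at x)" for x
  proof (cases "x > -1")
    case False
    have "((\<lambda>_. 0) has_real_derivative 0) (at x)" by simp
    then have "(B has_real_derivative 0) (at x)"
      by (rule has_field_derivative_transform_within_open[where S = "{..<0}"])
        (use False B0 in auto)
    then show ?thesis using False b0[of x] by simp
  qed (rule B)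
  have B1: "B x = B 1" if "x \<ge> 1" for x
  proof (cases "x = 1")
    case False
    then have "1 < x" using that by simp
    then obtain z where "z > 1" "B x - B 1 = (x - 1) * b z"
      using MVT2[of 1 x B b] B' by auto
    then show ?thesis using b0[of z] by simp
  qed simp
  have "B 1 > B 0"
  proof -
    obtain z where "0 < z" "z < 1" "B 1 - B 0 = (1 - 0) * b z"
      using MVT2[of 0 1 B b] B' by auto
    then show ?thesis using bpos[of z] by simp
  qed
  then have pos: "B 1 > 0" using B0[of 0] by simp
  show ?thesis
  proof (rule that[of "\<lambda>x. B x * (1 / B 1)" "\<lambda>x. b x * (1 / B 1)"])
    show "smooth (\<lambda>x. b x * (1 / B 1))" by (intro smooth_mult b smooth_const)
    show "((\<lambda>x. B x * (1 / B 1)) has_real_derivative b x * (1 / B 1)) (at x)" for x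
      by (rule DERIV_cmult_right[OF B'])
    show "smooth (\<lambda>x. B x * (1 / B 1))"
      by (intro smooth_mult smooth_const smooth_real_primitive[OF B' b])
    show "B x * (1 / B 1) = 1" if "x \<ge> 1" for x
      using B1[OF that] pos by simp
  qed (use B0 b0 in auto)
qed

subsection \<open>The boundary curve and its Poisson kernel\<close>

text \<open>By the half-angle formula 1 - cos t = 2 sin^2 (t / 2); with sin y \<ge> y / 2 on
  [0, pi / 2] this is at least 2 (t / 4)^2.\<close>

lemma one_minus_cos_ge:
  fixes t :: real
  assumes "\<bar>t\<bar> \<le> pi"
  shows "t\<^sup>2 / 8 \<le> 1 - cos t"
proof -
  have *: "y / 2 \<le> sin y" if "0 \<le> y" "y \<le> pi / 2" for y :: real
  proof -
    have "\<bar>sin y - y\<bar> \<le> y ^ 3 / 6"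
      using Maclaurin_sin_bound[of y 3] that by (simp add: eval_nat_numeral sin_coeff_def fact_numeral)
    moreover have "y ^ 3 \<le> 3 * y"
    proof -
      \<comment> \<open>1.6 exceeds pi / 2 and 1.6^2 = 2.56 is below 3, which makes the Maclaurin
        error y^3 / 6 at most y / 2.\<close>
      have "y \<le> 1.6" using that pi_less_4 pi_approx by (simp add: field_simps)
      then have "y * y \<le> 1.6 * 1.6" using that by (intro mult_mono) auto
      then have "(y * y) * y \<le> 3 * y" using that by (intro mult_right_mono) auto
      then show ?thesis by (simp add: power3_eq_cube)
    qed
    ultimately show ?thesis by linarith
  qed
  have "\<bar>t\<bar> / 4 \<le> sin (\<bar>t\<bar> / 2)" using *[of "\<bar>t\<bar> / 2"] assms by simp
  then have "(\<bar>t\<bar> / 4)\<^sup>2 \<le> (sin (\<bar>t\<bar> / 2))\<^sup>2" by (intro power_mono) auto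
  moreover have "cos t = 1 - 2 * (sin (\<bar>t\<bar> / 2))\<^sup>2"
    using cos_double_sin[of "\<bar>t\<bar> / 2"] by simp
  ultimately show ?thesis by (simp add: power_divide)
qed

lemma abs_exp_minus_one_le:
  fixes a :: real
  shows "\<bar>exp a - 1\<bar> \<le> \<bar>a\<bar> * exp \<bar>a\<bar>"
proof (cases "a \<ge> 0")
  case True
  have "1 - a \<le> exp (- a)" using exp_ge_add_one_self[of "-a"] by simp
  then have "(1 - a) * exp a \<le> 1" by (simp add: exp_minus field_simps)
  then show ?thesis using True by (simp add: algebra_simps)
next
  case False
  have "1 + a \<le> exp a" using exp_ge_add_one_self[of "a"] by simp
  moreover have "exp a < 1" using False by simp
  moreover have "\<bar>a\<bar> * 1 \<le> \<bar>a\<bar> * exp \<bar>a\<bar>" by (intro mult_left_mono) auto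
  ultimately show ?thesis using False by linarith
qed

lemma derivative_periodic:
  fixes f f' :: "real \<Rightarrow> real"
  assumes per: "\<And>x. f (x + p) = f x" and der: "\<And>x. (f has_real_derivative f' x) (at x)"
  shows "f' (x + p) = f' x"
proof -
  have "((\<lambda>x. f (x + p)) has_real_derivative f' (x + p)) (at x)"
    using DERIV_shift[of f "f' (x + p)" x p] der by simp
  then have "(f has_real_derivative f' (x + p)) (at x)" by (simp add: per)
  with der show ?thesis using DERIV_unique by blast
qed

locale C1_graph =
  fixes h h' :: "real \<Rightarrow> real"
  assumes periodic: "h (x + 2 * pi) = h x"
    and deriv: "(h has_real_derivative h' x) (at x)"
    and cont: "continuous_on UNIV h'"
begin

text \<open>The conformal map \<open>z \<mapsto> exp (- \<i> z)\<close> takes the fluid domain to a star-shaped domain; \<open>w\<close>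
  parametrises its boundary.\<close>

definition w :: "real \<Rightarrow> complex" where
  "w x = exp (Complex (h x) (- x))"

definition z' :: "real \<Rightarrow> complex" where
  "z' x = Complex 1 (h' x)"

text \<open>Dividing by \<open>w s\<close> moves the pole \<open>r w(s)\<close> to the real number r
  for every s; exchanging the arguments inverts \<open>q\<close>.\<close>

definition q :: "real \<Rightarrow> real \<Rightarrow> complex" where
  "q x s = w x / w s"

lemma w_nonzero [simp]: "w x \<noteq> 0"
  by (simp add: w_def)

lemma q_eq: "q x s = exp (Complex (h x - h s) (s - x))"
  by (simp add: q_def w_def flip: exp_diff) (simp add: complex_diff)

lemma q_nonzero [simp]: "q x s \<noteq> 0"
  by (simp add: q_def)

lemma q_swap: "q s x = 1 / q x s"
  by (simp add: q_def)

lemma w_periodic: "w (x + 2 * pi) = w x"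
  by (simp add: w_def periodic exp_eq_polar cis.ctr cos_diff sin_diff)

lemma q_periodic: "q (x + 2 * pi) s = q x s" "q x (s + 2 * pi) = q x s"
  by (simp_all add: q_def w_periodic)

lemma continuous_h: "continuous_on S h"
  using deriv by (meson DERIV_isCont continuous_at_imp_continuous_on)

lemma h'_periodic: "h' (x + 2 * pi) = h' x"
  by (rule derivative_periodic[OF periodic deriv])

end

lemma periodic_int_shift:
  fixes f :: "real \<Rightarrow> 'a"
  assumes "\<And>x. f (x + 2 * pi) = f x"
  shows "f (x + 2 * pi * of_int n) = f x"
proof (induction n rule: int_induct[where k = 0])
  case (step1 i)
  have "f (x + 2 * pi * of_int i + 2 * pi) = f (x + 2 * pi * of_int i)" by (rule assms)
  then show ?case using step1 by (simp add: algebra_simps)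
next
  case (step2 i)
  have "f (x + 2 * pi * of_int (i - 1) + 2 * pi) = f (x + 2 * pi * of_int (i - 1))" by (rule assms)
  then show ?case using step2 by (simp add: algebra_simps)
qed simp

lemma shift_into_period:
  obtains n :: int where "a \<le> x + 2 * pi * of_int n" "x + 2 * pi * of_int n < a + 2 * pi"
proof -
  let ?t = "(x - a) / (2 * pi)"
  have "of_int \<lfloor>?t\<rfloor> * (2 * pi) \<le> ?t * (2 * pi)" "?t * (2 * pi) < (of_int \<lfloor>?t\<rfloor> + 1) * (2 * pi)"
    by (intro mult_right_mono mult_strict_right_mono; simp)+
  then have "of_int \<lfloor>?t\<rfloor> * (2 * pi) \<le> x - a" "x - a < (of_int \<lfloor>?t\<rfloor> + 1) * (2 * pi)"
    by simp_all
  then show ?thesis by (intro that[of "- \<lfloor>?t\<rfloor>"]) (auto simp: algebra_simps)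
qed

lemma periodic_bounded:
  fixes f :: "real \<Rightarrow> 'a::real_normed_vector"
  assumes "\<And>x. f (x + 2 * pi) = f x" "continuous_on UNIV f"
  obtains B where "B > 0" "\<And>x. norm (f x) \<le> B"
proof -
  have "bounded (f ` {0..2 * pi})"
    using assms(2) by (intro compact_imp_bounded compact_continuous_image)
      (auto intro: continuous_on_subset)
  then obtain B where B: "B > 0" "\<And>x. x \<in> {0..2 * pi} \<Longrightarrow> norm (f x) \<le> B"
    by (auto simp: bounded_pos)
  have "norm (f x) \<le> B" for x
  proof -
    obtain n :: int where n: "0 \<le> x + 2 * pi * of_int n" "x + 2 * pi * of_int n < 0 + 2 * pi"
      by (rule shift_into_period)
    then have "norm (f (x + 2 * pi * of_int n)) \<le> B" by (intro B(2)) auto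
    then show ?thesis by (simp add: periodic_int_shift[of f, OF assms(1)])
  qed
  with B(1) show ?thesis by (rule that)
qed

context C1_graph
begin

text \<open>Write q = \<rho> exp (i \<theta>). Then |q - r|^2 = (\<rho> - r)^2 + 2 \<rho> r (1 - cos
  \<theta>). The angular term controls |x - s|; then |\<rho> - r| controls r - 1, since the
  Lipschitz bound on h keeps |\<rho> - 1| below a multiple of |x - s|. This is star-shapedness made
  quantitative: the outward ray through \<open>w s\<close> leaves the curve at a linear
  rate.\<close>

lemma q_lower_bound:
  obtains c where "0 < c" "c \<le> 1"
    "\<And>r x s. r > 1 \<Longrightarrow> \<bar>x - s\<bar> \<le> pi \<Longrightarrow> c * ((r - 1) + \<bar>x - s\<bar>) \<le> norm (q x s - of_real r)"
proof -
  obtain L where L: "L > 0" "\<And>x. norm (h' x) \<le> L"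
    using periodic_bounded[of h'] h'_periodic cont by blast
  have Lip: "\<bar>h x - h s\<bar> \<le> L * \<bar>x - s\<bar>" for x s
  proof -
    have "norm (h x - h s) \<le> L * norm (x - s)"
      by (rule field_differentiable_bound[of UNIV h h'])
        (use L deriv in \<open>auto intro: has_field_derivative_at_within\<close>)
    then show ?thesis by simp
  qed
  define M where "M = exp (L * pi)"
  have M: "M \<ge> 1" unfolding M_def using L by simp
  \<comment> \<open>Since \<rho> \<ge> 1 / M and r > 1, the angular term is at least 2 / M times
    \<theta>^2 / 8, that is \<theta>^2 / (4 M).\<close>
  define k where "k = sqrt (1 / (4 * M))"
  have k: "k > 0" using M by (simp add: k_def)
  have k2: "k\<^sup>2 = 1 / (4 * M)" using M by (simp add: k_def)
  \<comment> \<open>Combines r - 1 \<le> |q - r| + L M |x - s| with |x - s| \<le> |q - r| /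
    k.\<close>
  define c where "c = 1 / (1 + (L * M + 1) / k)"
  have den: "1 + (L * M + 1) / k \<ge> 1" using L M k by simp
  have bound: "(r - 1) + \<bar>x - s\<bar> \<le> (1 + (L * M + 1) / k) * norm (q x s - of_real r)"
    if r: "r > 1" and xs: "\<bar>x - s\<bar> \<le> pi" for r x s
  proof -
    define \<rho> where "\<rho> = exp (h x - h s)"
    define \<theta> where "\<theta> = s - x"
    have ab: "\<bar>h x - h s\<bar> \<le> L * pi"
      using Lip[of x s] xs L(1) by (meson mult_left_mono order.trans less_imp_le)
    have rho: "\<rho> > 0" "1 / M \<le> \<rho>" "norm (q x s) = \<rho>"
      using ab by (auto simp: \<rho>_def M_def q_eq abs_le_iff simp flip: exp_minus inverse_eq_divide)
    have "\<bar>\<rho> - 1\<bar> \<le> \<bar>h x - h s\<bar> * exp \<bar>h x - h s\<bar>"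
      unfolding \<rho>_def by (rule abs_exp_minus_one_le)
    also have "\<dots> \<le> (L * \<bar>x - s\<bar>) * M"
      unfolding M_def using ab Lip[of x s] by (intro mult_mono) auto
    finally have r1: "\<bar>\<rho> - 1\<bar> \<le> L * M * \<bar>x - s\<bar>" by (simp add: mult_ac)
    have "(norm (q x s - of_real r))\<^sup>2 = (\<rho> * cos \<theta> - r)\<^sup>2 + (\<rho> * sin \<theta>)\<^sup>2"
      by (simp add: cmod_power2 q_eq Re_exp Im_exp \<rho>_def \<theta>_def)
    also have "\<dots> = (\<rho> - r)\<^sup>2 + 2 * \<rho> * r * (1 - cos \<theta>)"
    proof -
      have "(sin \<theta>)\<^sup>2 = 1 - (cos \<theta>)\<^sup>2" by (simp add: sin_squared_eq)
      then show ?thesis by (simp add: power2_eq_square algebra_simps) (simp add: power2_eq_square[symmetric] algebra_simps flip: distrib_left)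
    qed
    also have "\<dots> \<ge> 2 * (1 / M) * 1 * (\<theta>\<^sup>2 / 8)"
    proof -
      have "2 * (1 / M) * 1 * (\<theta>\<^sup>2 / 8) \<le> 2 * \<rho> * r * (1 - cos \<theta>)"
        using rho r M one_minus_cos_ge[of \<theta>] xs unfolding \<theta>_def
        by (intro mult_mono) (auto simp: abs_minus_commute)
      then show ?thesis by (smt (verit) zero_le_power2)
    qed
    finally have "(k * \<bar>\<theta>\<bar>)\<^sup>2 \<le> (norm (q x s - of_real r))\<^sup>2"
      by (simp add: power_mult_distrib k2)
    then have n1: "k * \<bar>x - s\<bar> \<le> norm (q x s - of_real r)"
      unfolding \<theta>_def by (simp add: abs_minus_commute power2_le_iff_abs_le abs_of_nonneg)
    have "r - \<rho> \<le> norm (q x s - of_real r)"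
      using norm_triangle_ineq3[of "q x s" "of_real r"] rho(3) r by simp
    then have "(r - 1) + \<bar>x - s\<bar> \<le> norm (q x s - of_real r) + (L * M + 1) * \<bar>x - s\<bar>"
      using r1 by (simp add: algebra_simps)
    also have "(L * M + 1) * \<bar>x - s\<bar> \<le> (L * M + 1) / k * norm (q x s - of_real r)"
    proof -
      have "\<bar>x - s\<bar> \<le> norm (q x s - of_real r) / k" using n1 k by (simp add: field_simps)
      then have "(L * M + 1) * \<bar>x - s\<bar> \<le> (L * M + 1) * (norm (q x s - of_real r) / k)"
        using L M by (intro mult_left_mono) auto
      then show ?thesis by simp
    qed
    finally show ?thesis by (simp add: algebra_simps)
  qed
  show ?thesis
  proof (rule that[of c])
    show "0 < c" "c \<le> 1" using den by (simp_all add: c_def)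
    show "c * ((r - 1) + \<bar>x - s\<bar>) \<le> norm (q x s - of_real r)" if "r > 1" "\<bar>x - s\<bar> \<le> pi" for r x s
      using bound[OF that] den unfolding c_def by (simp add: field_simps)
  qed
qed

end

section \<open>The symmetric kernel\<close>

context C1_graph
begin

text \<open>The second summand is the first with x and s exchanged. When |q| = 1, as for constant h,
  \<open>P\<close> is - 2 times the Poisson kernel (r^2 - 1) / |q - r|^2, which explains the total
  mass - 4 pi.\<close>

definition P :: "real \<Rightarrow> real \<Rightarrow> real \<Rightarrow> complex" where
  "P r x s = (q x s + of_real r) / (q x s - of_real r) + (1 + of_real r * q x s) / (1 - of_real r * q x s)"

lemma shift_near:
  obtains x' where "\<bar>x' - s\<bar> \<le> pi" "q x' s = q x s" "q s x' = q s x"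
proof -
  obtain n where n: "s - pi \<le> x + 2 * pi * of_int n" "x + 2 * pi * of_int n < (s - pi) + 2 * pi"
    by (rule shift_into_period)
  have "w (x + 2 * pi * of_int n) = w x"
    by (rule periodic_int_shift[of w, OF w_periodic])
  with n show ?thesis
    by (intro that[of "x + 2 * pi * of_int n"]) (auto simp: q_def abs_le_iff)
qed

lemma q_lower_bound_global:
  obtains c where "0 < c" "c \<le> 1" "\<And>r x s. r > 1 \<Longrightarrow> c * (r - 1) \<le> norm (q x s - of_real r)"
proof -
  obtain c where c: "0 < c" "c \<le> 1"
    "\<And>r x s. r > 1 \<Longrightarrow> \<bar>x - s\<bar> \<le> pi \<Longrightarrow> c * ((r - 1) + \<bar>x - s\<bar>) \<le> norm (q x s - of_real r)"
    using q_lower_bound by metis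
  have "c * (r - 1) \<le> norm (q x s - of_real r)" if "r > 1" for r x s
  proof -
    obtain x' where x': "\<bar>x' - s\<bar> \<le> pi" "q x' s = q x s" by (rule shift_near)
    have "c * (r - 1) \<le> c * ((r - 1) + \<bar>x' - s\<bar>)" using c(1) by (intro mult_left_mono) auto
    also have "\<dots> \<le> norm (q x' s - of_real r)" by (intro c(3) that x')
    finally show ?thesis by (simp add: x'(2))
  qed
  with c show ?thesis using that by blast
qed

lemma q_ne:
  assumes "r > 1"
  shows "q x s \<noteq> of_real r" "of_real r * q x s \<noteq> 1"
proof -
  obtain c where c: "0 < c" "\<And>r x s. r > 1 \<Longrightarrow> c * (r - 1) \<le> norm (q x s - of_real r)"
    using q_lower_bound_global by metis
  have *: "q x s \<noteq> of_real r" for x s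
  proof -
    have "0 < c * (r - 1)" using c(1) assms by simp
    also have "\<dots> \<le> norm (q x s - of_real r)" by (intro c(2) assms)
    finally show ?thesis by auto
  qed
  show "q x s \<noteq> of_real r" by (rule *)
  show "of_real r * q x s \<noteq> 1" using *[of s x] by (auto simp: q_swap[of s x] field_simps)
qed

text \<open>Over the common denominator the numerators add up to 2 (1 - r^2): the exchange of x and
  s has cancelled everything that does not vanish as r tends to 1.\<close>

lemma P_eq:
  assumes "r > 1"
  shows "P r x s = 2 * (1 - of_real (r\<^sup>2)) / ((q x s - of_real r) * (q s x - of_real r))"
  using q_ne[OF assms, of x s]
  unfolding P_def q_swap[of s x] by (simp add: divide_simps) (simp add: power2_eq_square algebra_simps)

lemma P_symmetric: "r > 1 \<Longrightarrow> P r x s = P r s x"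
  by (simp add: P_eq mult.commute)

lemma P_periodic: "P r (x + 2 * pi) s = P r x s" "P r x (s + 2 * pi) = P r x s"
  by (simp_all add: P_def q_periodic)

lemma P_bounds:
  obtains C where "C > 0"
    "\<And>r x s. 1 < r \<Longrightarrow> r \<le> 2 \<Longrightarrow> \<bar>x - s\<bar> \<le> pi \<Longrightarrow> norm (P r x s) \<le> C * ((r - 1) / ((r - 1)\<^sup>2 + (x - s)\<^sup>2))"
proof -
  obtain c where c: "0 < c" 
    "\<And>r x s. r > 1 \<Longrightarrow> \<bar>x - s\<bar> \<le> pi \<Longrightarrow> c * ((r - 1) + \<bar>x - s\<bar>) \<le> norm (q x s - of_real r)"
    using q_lower_bound by metis
  \<comment> \<open>For r \<le> 2 the numerator satisfies 2 (r + 1) (r - 1) \<le> 6 (r - 1), and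
    each of the two denominators contributes one factor c.\<close>
  have "norm (P r x s) \<le> 6 / c\<^sup>2 * ((r - 1) / ((r - 1)\<^sup>2 + (x - s)\<^sup>2))"
    if r: "1 < r" "r \<le> 2" and xs: "\<bar>x - s\<bar> \<le> pi" for r x s
  proof -
    let ?d = "(r - 1) + \<bar>x - s\<bar>"
    have d: "0 < ?d" using r by simp
    have "(c * ?d) * (c * ?d) \<le> norm (q x s - of_real r) * norm (q s x - of_real r)"
      using c(1) d c(2)[OF r(1) xs] c(2)[OF r(1), of s x] xs
      by (intro mult_mono) (auto simp: abs_minus_commute)
    then have den: "c\<^sup>2 * ?d\<^sup>2 \<le> norm ((q x s - of_real r) * (q s x - of_real r))"
      by (simp add: norm_mult power2_eq_square mult_ac)
    have "norm (2 * (1 - complex_of_real (r\<^sup>2))) = 2 * (r\<^sup>2 - 1)"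
    proof -
      have "2 * (1 - complex_of_real (r\<^sup>2)) = of_real (2 * (1 - r\<^sup>2))" by simp
      then have "norm (2 * (1 - complex_of_real (r\<^sup>2))) = \<bar>2 * (1 - r\<^sup>2)\<bar>" by (simp only: norm_of_real)
      also have "1 \<le> r\<^sup>2" using r by simp
      then have "\<bar>2 * (1 - r\<^sup>2)\<bar> = 2 * (r\<^sup>2 - 1)" by simp
      finally show ?thesis .
    qed
    also have "2 * (r\<^sup>2 - 1) = 2 * (r + 1) * (r - 1)" by (simp add: power2_eq_square algebra_simps)
    also have "\<dots> \<le> 6 * (r - 1)" using r by (intro mult_right_mono) auto
    finally have num: "norm (2 * (1 - complex_of_real (r\<^sup>2))) \<le> 6 * (r - 1)" .
    have "norm (P r x s) \<le> 6 * (r - 1) / (c\<^sup>2 * ?d\<^sup>2)"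
      unfolding P_eq[OF r(1)] norm_divide using c(1) d r
      by (intro frac_le num den) auto
    also have "\<dots> \<le> 6 * (r - 1) / (c\<^sup>2 * ((r - 1)\<^sup>2 + (x - s)\<^sup>2))"
    proof (intro divide_left_mono mult_left_mono)
      have "((r - 1)\<^sup>2 + (x - s)\<^sup>2) = (r - 1)\<^sup>2 + \<bar>x - s\<bar>\<^sup>2" by simp
      also have "\<dots> \<le> ?d\<^sup>2" unfolding power2_sum[of "r - 1" "\<bar>x - s\<bar>"] using r by simp
      finally show "(r - 1)\<^sup>2 + (x - s)\<^sup>2 \<le> ?d\<^sup>2" .
      show "0 < c\<^sup>2 * ?d\<^sup>2 * (c\<^sup>2 * ((r - 1)\<^sup>2 + (x - s)\<^sup>2))"
        using c(1) d r by (intro mult_pos_pos add_pos_nonneg) auto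
    qed (use r c in auto)
    finally show ?thesis by simp
  qed
  with c(1) show ?thesis by (intro that[of "6 / c\<^sup>2"]) auto
qed

text \<open>In differential form, \<open>z' s\<close> ds = - i dq / q. Integrals of functions of q
  against \<open>z'\<close> are therefore contour integrals in q.\<close>

lemma DERIV_q: "((\<lambda>s. q x s) has_vector_derivative \<i> * z' s * q x s) (at s)"
proof -
  have "((\<lambda>s. complex_of_real (h x - h s) + \<i> * of_real (s - x)) has_vector_derivative
      (- of_real (h' s) + \<i>)) (at s)"
  proof -
    have "((\<lambda>s. complex_of_real (h x - h s)) has_vector_derivative of_real (- h' s)) (at s)"
      by (intro has_vector_derivative_of_real) (auto intro!: derivative_eq_intros deriv)
    moreover have "((\<lambda>s. \<i> * complex_of_real (s - x)) has_vector_derivative \<i> * of_real 1) (at s)"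
      by (intro has_vector_derivative_mult_right has_vector_derivative_of_real)
        (auto intro!: derivative_eq_intros)
    ultimately show ?thesis using has_vector_derivative_add by fastforce
  qed
  moreover have "(exp has_field_derivative exp u) (at u within S)" for u :: complex and S
    by (rule DERIV_exp[THEN has_field_derivative_at_within])
  ultimately have "((\<lambda>s. exp (complex_of_real (h x - h s) + \<i> * of_real (s - x))) has_vector_derivative
      (- of_real (h' s) + \<i>) * exp (complex_of_real (h x - h s) + \<i> * of_real (s - x))) (at s)"
    using field_vector_diff_chain_at[where g = exp] by (fastforce simp: o_def)
  moreover have "exp (complex_of_real (h x - h s) + \<i> * of_real (s - x)) = q x s" for s
    by (simp add: q_eq Complex_eq)
  moreover have "- of_real (h' s) + \<i> = \<i> * z' s"
    by (simp add: z'_def Complex_eq algebra_simps)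
  ultimately show ?thesis by simp
qed

end

subsection \<open>Square integrable functions on the circle\<close>

abbreviation circ :: "real measure" where
  "circ \<equiv> restrict_space lborel {0..2 * pi}"

lemma space_circ [simp]: "space circ = {0..2 * pi}"
  by (simp add: space_restrict_space)

lemma measurable_circ [measurable (raw)]: "f \<in> borel_measurable borel \<Longrightarrow> f \<in> borel_measurable circ"
  by (intro measurable_restrict_space1) simp

lemma finite_measure_circ: "finite_measure circ"
  by (rule finite_measureI) (simp add: emeasure_restrict_space)

lemma nn_integral_periodic:
  fixes f :: "real \<Rightarrow> ennreal"
  assumes [measurable]: "f \<in> borel_measurable borel" and per: "\<And>x. f (x + 2 * pi) = f x"
  shows "(\<integral>\<^sup>+x\<in>{a..a + 2 * pi}. f x \<partial>lborel) = (\<integral>\<^sup>+x\<in>{0..2 * pi}. f x \<partial>lborel)"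
proof -
  have shift: "(\<integral>\<^sup>+x\<in>{a..b}. f x \<partial>lborel)
      = (\<integral>\<^sup>+x\<in>{a + 2 * pi * of_int n..b + 2 * pi * of_int n}. f x \<partial>lborel)" for a b and n :: int
  proof -
    let ?t = "2 * pi * of_int n"
    have "(\<integral>\<^sup>+x\<in>{a + ?t..b + ?t}. f x \<partial>lborel)
        = (\<integral>\<^sup>+x. f (?t + x) * indicator {a + ?t..b + ?t} (?t + x) \<partial>lborel)"
      using nn_integral_real_affine[of "\<lambda>x. f x * indicator {a + ?t..b + ?t} x" 1 ?t] by simp
    also have "\<dots> = (\<integral>\<^sup>+x\<in>{a..b}. f x \<partial>lborel)"
    proof (intro nn_integral_cong)
      fix x
      show "f (?t + x) * indicator {a + ?t..b + ?t} (?t + x) = f x * indicator {a..b} x"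
        using periodic_int_shift[of f x n, OF per] by (simp add: add.commute indicator_def)
    qed
    finally show ?thesis by simp
  qed
  have split: "(\<integral>\<^sup>+x\<in>{a..c}. f x \<partial>lborel) = (\<integral>\<^sup>+x\<in>{a..b}. f x \<partial>lborel) + (\<integral>\<^sup>+x\<in>{b..c}. f x \<partial>lborel)"
    if "a \<le> b" "b \<le> c" for a b c
  proof -
    have "AE x in lborel. x \<noteq> b" by (rule AE_lborel_singleton)
    then have "(\<integral>\<^sup>+x\<in>{a..c}. f x \<partial>lborel) = (\<integral>\<^sup>+x. f x * indicator {a..b} x + f x * indicator {b..c} x \<partial>lborel)"
      using that by (intro nn_integral_cong_AE) (auto elim!: eventually_mono simp: indicator_def)
    then show ?thesis by (simp add: nn_integral_add)
  qed
  obtain n :: int where n: "0 \<le> a + 2 * pi * of_int n" "a + 2 * pi * of_int n < 0 + 2 * pi"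
    by (rule shift_into_period)
  let ?a = "a + 2 * pi * of_int n"
  have "(\<integral>\<^sup>+x\<in>{a..a + 2 * pi}. f x \<partial>lborel) = (\<integral>\<^sup>+x\<in>{?a..?a + 2 * pi}. f x \<partial>lborel)"
    using shift[of a "a + 2 * pi" n] by (simp add: algebra_simps)
  also have "\<dots> = (\<integral>\<^sup>+x\<in>{?a..2 * pi}. f x \<partial>lborel) + (\<integral>\<^sup>+x\<in>{2 * pi..?a + 2 * pi}. f x \<partial>lborel)"
    using n by (intro split) auto
  also have "(\<integral>\<^sup>+x\<in>{2 * pi..?a + 2 * pi}. f x \<partial>lborel) = (\<integral>\<^sup>+x\<in>{0..?a}. f x \<partial>lborel)"
    using shift[of 0 ?a 1] by simp
  also have "(\<integral>\<^sup>+x\<in>{?a..2 * pi}. f x \<partial>lborel) + (\<integral>\<^sup>+x\<in>{0..?a}. f x \<partial>lborel) = (\<integral>\<^sup>+x\<in>{0..2 * pi}. f x \<partial>lborel)"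
    using split[of 0 ?a "2 * pi"] n by (simp add: add.commute)
  finally show ?thesis .
qed

lemma ennreal_norm_diff_power2_le:
  "ennreal ((norm (u - v))\<^sup>2) \<le> 2 * ennreal ((norm u)\<^sup>2) + 2 * ennreal ((norm v)\<^sup>2)"
proof -
  have "(norm (u - v))\<^sup>2 \<le> (norm u + norm v)\<^sup>2"
    by (intro power_mono norm_triangle_ineq4) auto
  also have "\<dots> \<le> 2 * (norm u)\<^sup>2 + 2 * (norm v)\<^sup>2"
    using sum_squares_bound[of "norm u" "norm v"] by (simp add: power2_sum)
  finally have "ennreal ((norm (u - v))\<^sup>2) \<le> ennreal (2 * (norm u)\<^sup>2 + 2 * (norm v)\<^sup>2)"
    by (rule ennreal_leI)
  then show ?thesis by (simp add: ennreal_mult')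
qed

text \<open>Any measurable f is an almost everywhere limit of continuous functions, but without
  domination. The radial truncation \<open>\<rho> M\<close> supplies it: it is continuous, so it
  preserves the convergence, and its values are bounded by M on an interval of finite length.
  Truncating f itself costs little because |f|^2 is integrable.\<close>

lemma continuous_approx_L2:
  fixes f :: "real \<Rightarrow> 'a::euclidean_space"
  assumes [measurable]: "f \<in> borel_measurable borel"
    and fin: "(\<integral>\<^sup>+x\<in>{a..b}. ennreal ((norm (f x))\<^sup>2) \<partial>lborel) < \<infinity>" and "e > 0"
  obtains k where "continuous_on UNIV k"
    "(\<integral>\<^sup>+x\<in>{a..b}. ennreal ((norm (f x - k x))\<^sup>2) \<partial>lborel) < ennreal e"
proof -
  define \<rho> :: "real \<Rightarrow> 'a \<Rightarrow> 'a" where "\<rho> = (\<lambda>M v. (M / max M (norm v)) *\<^sub>R v)"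
  have \<rho>_cont: "continuous_on UNIV (\<rho> M)" if "M > 0" for M
    unfolding \<rho>_def using that by (intro continuous_intros) auto
  have \<rho>_id: "\<rho> M v = v" if "norm v \<le> M" "M > 0" for M v
    using that by (simp add: \<rho>_def max_def)
  have \<rho>_norm: "norm (\<rho> M v) \<le> M" if "M > 0" for M v
    using that by (simp add: \<rho>_def max_def field_simps)
  have \<rho>_diff: "norm (v - \<rho> M v) \<le> norm v" if "M > 0" for M v
  proof -
    have "v - \<rho> M v = (1 - M / max M (norm v)) *\<^sub>R v" by (simp add: \<rho>_def algebra_simps)
    moreover have "0 \<le> M / max M (norm v)" "M / max M (norm v) \<le> 1"
      using that by (simp_all add: divide_le_eq_1 less_max_iff_disj)
    then have "\<bar>1 - M / max M (norm v)\<bar> \<le> 1" by linarith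
    ultimately show ?thesis by (simp add: mult_left_le_one_le)
  qed
  have \<rho>_meas[measurable]: "(\<lambda>x. \<rho> M (g x)) \<in> borel_measurable borel"
    if "M > 0" "g \<in> borel_measurable borel" for M and g :: "real \<Rightarrow> 'a"
    using that borel_measurable_continuous_onI[OF \<rho>_cont[OF that(1)]] by measurable

  have "(\<lambda>n. \<integral>\<^sup>+x\<in>{a..b}. ennreal ((norm (f x - \<rho> (real (Suc n)) (f x)))\<^sup>2) \<partial>lborel)
      \<longlonglongrightarrow> (\<integral>\<^sup>+x. 0 \<partial>(lborel :: real measure))"
  proof (rule nn_integral_dominated_convergence[where w = "\<lambda>x. ennreal ((norm (f x))\<^sup>2) * indicator {a..b} x"])
    show "AE x in lborel. (\<lambda>n. ennreal ((norm (f x - \<rho> (real (Suc n)) (f x)))\<^sup>2) * indicator {a..b} x) \<longlonglongrightarrow> 0"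
    proof (intro AE_I2 tendsto_eventually)
      fix x
      obtain N :: nat where N: "norm (f x) \<le> real N" using real_arch_simple by blast
      show "\<forall>\<^sub>F n in sequentially. ennreal ((norm (f x - \<rho> (real (Suc n)) (f x)))\<^sup>2) * indicator {a..b} x = 0"
        using eventually_ge_at_top[of N]
        by eventually_elim (use N in \<open>simp add: \<rho>_id\<close>)
    qed
    show "AE x in lborel. ennreal ((norm (f x - \<rho> (real (Suc n)) (f x)))\<^sup>2) * indicator {a..b} x
        \<le> ennreal ((norm (f x))\<^sup>2) * indicator {a..b} x" for n
      using \<rho>_diff[of "real (Suc n)"]
      by (intro AE_I2 mult_right_mono ennreal_leI power_mono) auto
  qed (use fin in auto)
  then have "\<forall>\<^sub>F n in sequentially. (\<integral>\<^sup>+x\<in>{a..b}. ennreal ((norm (f x - \<rho> (real (Suc n)) (f x)))\<^sup>2) \<partial>lborel) < ennreal (e / 4)"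
    using \<open>e > 0\<close> by (intro order_tendstoD(2)) auto
  then obtain n where n: "(\<integral>\<^sup>+x\<in>{a..b}. ennreal ((norm (f x - \<rho> (real (Suc n)) (f x)))\<^sup>2) \<partial>lborel) < ennreal (e / 4)"
    by (auto simp: eventually_sequentially)
  define M where "M = real (Suc n)"
  have M: "M > 0" by (simp add: M_def)

  have "f \<in> borel_measurable (lebesgue_on UNIV)"
    using measurable_restrict_space1[OF measurable_completion[of f lborel borel]] by simp
  then have "f measurable_on UNIV"
    by (intro lebesgue_measurable_imp_measurable_on) auto
  then obtain N g where N: "negligible N" and g: "\<And>n. continuous_on UNIV (g n)"
    "\<And>x. x \<notin> N \<Longrightarrow> (\<lambda>n. g n x) \<longlonglongrightarrow> f x"
    unfolding measurable_on_def by auto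
  have gm[measurable]: "g n \<in> borel_measurable borel" for n
    by (rule borel_measurable_continuous_onI[OF g(1)])
  have AE: "AE x in lborel. x \<notin> N"
    using N AE_not_in[of N lebesgue] by (simp add: AE_completion_iff negligible_iff_null_sets)
  have "(\<lambda>n. \<integral>\<^sup>+x\<in>{a..b}. ennreal ((norm (\<rho> M (f x) - \<rho> M (g n x)))\<^sup>2) \<partial>lborel) \<longlonglongrightarrow> (\<integral>\<^sup>+x. 0 \<partial>(lborel :: real measure))"
  proof (rule nn_integral_dominated_convergence[where w = "\<lambda>x. ennreal ((2 * M)\<^sup>2) * indicator {a..b} x"])
    show "AE x in lborel. (\<lambda>n. ennreal ((norm (\<rho> M (f x) - \<rho> M (g n x)))\<^sup>2) * indicator {a..b} x) \<longlonglongrightarrow> 0"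
      using AE
    proof eventually_elim
      fix x assume "x \<notin> N"
      then have "(\<lambda>n. \<rho> M (g n x)) \<longlonglongrightarrow> \<rho> M (f x)"
        using \<rho>_cont[OF M] by (intro continuous_on_tendsto_compose[of UNIV "\<rho> M"] g) auto
      then have "(\<lambda>n. (norm (\<rho> M (f x) - \<rho> M (g n x)))\<^sup>2) \<longlonglongrightarrow> (norm (\<rho> M (f x) - \<rho> M (f x)))\<^sup>2"
        by (intro tendsto_intros)
      then have "(\<lambda>n. ennreal ((norm (\<rho> M (f x) - \<rho> M (g n x)))\<^sup>2)) \<longlonglongrightarrow> ennreal 0"
        by (intro tendsto_ennrealI) simp
      then show "(\<lambda>n. ennreal ((norm (\<rho> M (f x) - \<rho> M (g n x)))\<^sup>2) * indicator {a..b} x) \<longlonglongrightarrow> 0"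
        by (auto simp: indicator_def)
    qed
    show "AE x in lborel. ennreal ((norm (\<rho> M (f x) - \<rho> M (g n x)))\<^sup>2) * indicator {a..b} x
        \<le> ennreal ((2 * M)\<^sup>2) * indicator {a..b} x" for n
    proof (intro AE_I2 mult_right_mono ennreal_leI power_mono)
      fix x
      show "norm (\<rho> M (f x) - \<rho> M (g n x)) \<le> 2 * M"
        using norm_triangle_ineq4[of "\<rho> M (f x)" "\<rho> M (g n x)"] \<rho>_norm[OF M, of "f x"] \<rho>_norm[OF M, of "g n x"] by linarith
    qed auto
    show "(\<integral>\<^sup>+ x. ennreal ((2 * M)\<^sup>2) * indicator {a..b} x \<partial>lborel) < \<infinity>"
      by (simp add: nn_integral_cmult_indicator ennreal_mult_less_top emeasure_lborel_Icc_eq)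
  qed (use M in auto)
  then have "\<forall>\<^sub>F n in sequentially. (\<integral>\<^sup>+x\<in>{a..b}. ennreal ((norm (\<rho> M (f x) - \<rho> M (g n x)))\<^sup>2) \<partial>lborel) < ennreal (e / 4)"
    using \<open>e > 0\<close> by (intro order_tendstoD(2)) auto
  then obtain m where m: "(\<integral>\<^sup>+x\<in>{a..b}. ennreal ((norm (\<rho> M (f x) - \<rho> M (g m x)))\<^sup>2) \<partial>lborel) < ennreal (e / 4)"
    by (auto simp: eventually_sequentially)
  have "(\<integral>\<^sup>+x\<in>{a..b}. ennreal ((norm (f x - \<rho> M (g m x)))\<^sup>2) \<partial>lborel)
      \<le> (\<integral>\<^sup>+x. 2 * (ennreal ((norm (f x - \<rho> M (f x)))\<^sup>2) * indicator {a..b} x)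
          + 2 * (ennreal ((norm (\<rho> M (f x) - \<rho> M (g m x)))\<^sup>2) * indicator {a..b} x) \<partial>lborel)"
  proof (intro nn_integral_mono)
    fix x
    let ?u = "norm (f x - \<rho> M (f x))" and ?v = "norm (\<rho> M (f x) - \<rho> M (g m x))"
    have "ennreal ((norm (f x - \<rho> M (g m x)))\<^sup>2) \<le> 2 * ennreal (?u\<^sup>2) + 2 * ennreal (?v\<^sup>2)"
      using ennreal_norm_diff_power2_le[of "f x - \<rho> M (f x)" "\<rho> M (g m x) - \<rho> M (f x)"]
      by (simp add: norm_minus_commute[of "\<rho> M (g m x)"])
    then show "ennreal ((norm (f x - \<rho> M (g m x)))\<^sup>2) * indicator {a..b} x
        \<le> 2 * (ennreal (?u\<^sup>2) * indicator {a..b} x) + 2 * (ennreal (?v\<^sup>2) * indicator {a..b} x)"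
      by (auto simp: indicator_def)
  qed
  also have "\<dots> = 2 * (\<integral>\<^sup>+x\<in>{a..b}. ennreal ((norm (f x - \<rho> M (f x)))\<^sup>2) \<partial>lborel)
      + 2 * (\<integral>\<^sup>+x\<in>{a..b}. ennreal ((norm (\<rho> M (f x) - \<rho> M (g m x)))\<^sup>2) \<partial>lborel)"
    using M by (subst nn_integral_add) (auto simp: nn_integral_cmult)
  also have "\<dots> < ennreal (e / 2) + ennreal (e / 2)"
  proof (rule add_strict_mono)
    have *: "2 * u < ennreal (e / 2)" if "u < ennreal (e / 4)" for u
    proof -
      have "2 * u < 2 * ennreal (e / 4)" using that by (intro ennreal_mult_strict_left_mono) auto
      also have "2 * ennreal (e / 4) = ennreal (e / 2)"
        using \<open>e > 0\<close> by (simp flip: ennreal_numeral ennreal_mult')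
      finally show ?thesis .
    qed
    show "2 * (\<integral>\<^sup>+x\<in>{a..b}. ennreal ((norm (f x - \<rho> M (f x)))\<^sup>2) \<partial>lborel) < ennreal (e / 2)"
      using n by (intro *) (simp add: M_def)
    show "2 * (\<integral>\<^sup>+x\<in>{a..b}. ennreal ((norm (\<rho> M (f x) - \<rho> M (g m x)))\<^sup>2) \<partial>lborel) < ennreal (e / 2)"
      using m by (intro *)
  qed
  also have "ennreal (e / 2) + ennreal (e / 2) = ennreal e"
    using \<open>e > 0\<close> by (simp flip: ennreal_plus)
  finally have "(\<integral>\<^sup>+x\<in>{a..b}. ennreal ((norm (f x - \<rho> M (g m x)))\<^sup>2) \<partial>lborel) < ennreal e" .
  moreover have "continuous_on UNIV (\<lambda>x. \<rho> M (g m x))"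
    using continuous_on_compose2[OF \<rho>_cont[OF M] g(1)] by auto
  ultimately show ?thesis by (rule that[rotated])
qed

lemma nn_integral_Icc_shift:
  fixes f :: "real \<Rightarrow> ennreal"
  assumes [measurable]: "f \<in> borel_measurable borel"
  shows "(\<integral>\<^sup>+x\<in>{a..b}. f (x + t) \<partial>lborel) = (\<integral>\<^sup>+x\<in>{a + t..b + t}. f x \<partial>lborel)"
proof -
  have "(\<integral>\<^sup>+x\<in>{a + t..b + t}. f x \<partial>lborel) = (\<integral>\<^sup>+x. f (t + x) * indicator {a + t..b + t} (t + x) \<partial>lborel)"
    using nn_integral_real_affine[of "\<lambda>x. f x * indicator {a + t..b + t} x" 1 t] by simp
  then show ?thesis by (simp add: indicator_def add.commute)
qed

section \<open>Continuity of translations in L2\<close>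

locale periodic_L2 =
  fixes f :: "real \<Rightarrow> complex"
  assumes meas [measurable]: "f \<in> borel_measurable borel"
    and per: "f (x + 2 * pi) = f x"
    and fin: "(\<integral>\<^sup>+x\<in>{0..2 * pi}. ennreal ((norm (f x))\<^sup>2) \<partial>lborel) < \<infinity>"
begin

text \<open>The squared L2 modulus of continuity at shift t, with values in \<open>ennreal\<close>
  so that Tonelli applies directly.\<close>

definition \<omega> :: "real \<Rightarrow> ennreal" where
  "\<omega> t = (\<integral>\<^sup>+x\<in>{0..2 * pi}. ennreal ((norm (f x - f (x + t)))\<^sup>2) \<partial>lborel)"

lemma nn_integral_translate:
  "(\<integral>\<^sup>+x\<in>{a..a + 2 * pi}. ennreal ((norm (f x))\<^sup>2) \<partial>lborel) = (\<integral>\<^sup>+x\<in>{0..2 * pi}. ennreal ((norm (f x))\<^sup>2) \<partial>lborel)"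
  by (rule nn_integral_periodic) (auto simp: per)

lemma \<omega>_bounded: "\<omega> t \<le> 4 * (\<integral>\<^sup>+x\<in>{0..2 * pi}. ennreal ((norm (f x))\<^sup>2) \<partial>lborel)"
proof -
  let ?N = "\<integral>\<^sup>+x\<in>{0..2 * pi}. ennreal ((norm (f x))\<^sup>2) \<partial>lborel"
  have "\<omega> t \<le> (\<integral>\<^sup>+x. 2 * (ennreal ((norm (f x))\<^sup>2) * indicator {0..2 * pi} x)
      + 2 * (ennreal ((norm (f (x + t)))\<^sup>2) * indicator {0..2 * pi} x) \<partial>lborel)"
    unfolding \<omega>_def
    by (intro nn_integral_mono) (auto simp: indicator_def ennreal_norm_diff_power2_le)
  also have "\<dots> = 2 * ?N + 2 * (\<integral>\<^sup>+x\<in>{0..2 * pi}. ennreal ((norm (f (x + t)))\<^sup>2) \<partial>lborel)"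
    by (subst nn_integral_add) (auto simp: nn_integral_cmult)
  also have "(\<integral>\<^sup>+x\<in>{0..2 * pi}. ennreal ((norm (f (x + t)))\<^sup>2) \<partial>lborel)
      = (\<integral>\<^sup>+x\<in>{0 + t..2 * pi + t}. ennreal ((norm (f x))\<^sup>2) \<partial>lborel)"
    by (rule nn_integral_Icc_shift[of "\<lambda>x. ennreal ((norm (f x))\<^sup>2)"]) measurable
  also have "\<dots> = ?N"
    using nn_integral_translate[of t] by (simp add: add.commute)
  also have "2 * ?N + 2 * ?N = 4 * ?N" by (simp flip: distrib_right)
  finally show ?thesis .
qed

lemma \<omega>_small:
  assumes "e > 0"
  obtains \<delta> where "\<delta> > 0" "\<And>t. \<bar>t\<bar> < \<delta> \<Longrightarrow> \<omega> t \<le> ennreal e"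
proof -
  let ?I = "\<lambda>g a b. \<integral>\<^sup>+x\<in>{a..b}. ennreal ((norm (g x :: complex))\<^sup>2) \<partial>lborel"
  \<comment> \<open>The continuous approximant k need not be periodic, so it is taken close to f on
    an interval that contains [0, 2 pi] and its translates by less than pi.\<close>
  have "?I f (- pi) (3 * pi) \<le> (\<integral>\<^sup>+x. ennreal ((norm (f x))\<^sup>2) * indicator {-pi..pi} x
      + ennreal ((norm (f x))\<^sup>2) * indicator {pi..3 * pi} x \<partial>lborel)"
    by (intro nn_integral_mono) (auto simp: indicator_def)
  also have "\<dots> = ?I f (- pi) pi + ?I f pi (3 * pi)"
    by (intro nn_integral_add) auto
  also have "\<dots> < \<infinity>"
    using nn_integral_translate[of "- pi"] nn_integral_translate[of pi] fin by simp
  finally have "?I f (- pi) (3 * pi) < \<infinity>" .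
  from continuous_approx_L2[OF meas this, of "e / 16"] assms obtain k where
    k: "continuous_on UNIV k" "?I (\<lambda>x. f x - k x) (- pi) (3 * pi) < ennreal (e / 16)" by auto
  have [measurable]: "k \<in> borel_measurable borel" by (rule borel_measurable_continuous_onI[OF k(1)])
  have "uniformly_continuous_on {-pi..3 * pi} k"
    by (intro compact_uniformly_continuous continuous_on_subset[OF k(1)]) auto
  \<comment> \<open>Chosen so that 2 \<epsilon>^2 integrated over a period gives e / 2; the two
    approximation errors, at most 4 (e / 16) each, make up the rest.\<close>
  moreover define \<epsilon> where "\<epsilon> = sqrt (e / (8 * pi))"
  have \<epsilon>: "\<epsilon> > 0" "\<epsilon>\<^sup>2 = e / (8 * pi)" using assms by (auto simp: \<epsilon>_def)
  ultimately obtain d where d: "d > 0"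
    "\<And>x y. x \<in> {-pi..3 * pi} \<Longrightarrow> y \<in> {-pi..3 * pi} \<Longrightarrow> dist y x < d \<Longrightarrow> dist (k y) (k x) < \<epsilon>"
    unfolding uniformly_continuous_on_def by metis
  show ?thesis
  proof (rule that[of "min d pi"])
    fix t assume t: "\<bar>t\<bar> < min d pi"
    let ?J = "indicator {0..2 * pi} :: real \<Rightarrow> ennreal"
    have "\<omega> t \<le> (\<integral>\<^sup>+x. 2 * (ennreal (\<epsilon>\<^sup>2) * ?J x) + (4 * (ennreal ((norm (f x - k x))\<^sup>2) * ?J x)
        + 4 * (ennreal ((norm (f (x + t) - k (x + t)))\<^sup>2) * ?J x)) \<partial>lborel)"
      unfolding \<omega>_def
    proof (intro nn_integral_mono)
      fix x
      show "ennreal ((norm (f x - f (x + t)))\<^sup>2) * ?J x \<le> 2 * (ennreal (\<epsilon>\<^sup>2) * ?J x)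
        + (4 * (ennreal ((norm (f x - k x))\<^sup>2) * ?J x) + 4 * (ennreal ((norm (f (x + t) - k (x + t)))\<^sup>2) * ?J x))"
      proof (cases "x \<in> {0..2 * pi}")
        case True
        define u v where "u = f x - k x" and "v = f (x + t) - k (x + t)"
        have "dist (k x) (k (x + t)) < \<epsilon>"
          using True t by (intro d(2)) (auto simp: dist_real_def abs_less_iff)
        then have "(norm (k x - k (x + t)))\<^sup>2 \<le> \<epsilon>\<^sup>2" by (intro power_mono) (auto simp: dist_norm)
        then have 1: "ennreal ((norm (k x - k (x + t)))\<^sup>2) \<le> ennreal (\<epsilon>\<^sup>2)" by (rule ennreal_leI)
        have "f x - f (x + t) = (k x - k (x + t)) - (v - u)" by (simp add: u_def v_def)
        then have "ennreal ((norm (f x - f (x + t)))\<^sup>2) \<le>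
            2 * ennreal ((norm (k x - k (x + t)))\<^sup>2) + 2 * ennreal ((norm (v - u))\<^sup>2)"
          using ennreal_norm_diff_power2_le by metis
        also have "\<dots> \<le> 2 * ennreal (\<epsilon>\<^sup>2) + 2 * (2 * ennreal ((norm v)\<^sup>2) + 2 * ennreal ((norm u)\<^sup>2))"
          by (intro add_mono mult_left_mono 1 ennreal_norm_diff_power2_le) auto
        also have "\<dots> = 2 * ennreal (\<epsilon>\<^sup>2) + (4 * ennreal ((norm u)\<^sup>2) + 4 * ennreal ((norm v)\<^sup>2))"
          by (simp add: distrib_left add.commute mult.assoc[symmetric])
        finally show ?thesis using True by (simp add: u_def v_def)
      qed simp
    qed
    also have "\<dots> = 2 * (ennreal (\<epsilon>\<^sup>2) * (2 * ennreal pi)) + (4 * ?I (\<lambda>x. f x - k x) 0 (2 * pi)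
        + 4 * ?I (\<lambda>x. f (x + t) - k (x + t)) 0 (2 * pi))"
      by (simp add: nn_integral_add nn_integral_cmult nn_integral_cmult_indicator ennreal_mult')
    also have "\<dots> \<le> ennreal (e / 2) + (ennreal (e / 4) + ennreal (e / 4))"
    proof (intro add_mono)
      show "2 * (ennreal (\<epsilon>\<^sup>2) * (2 * ennreal pi)) \<le> ennreal (e / 2)"
        using assms unfolding \<epsilon>(2) by (simp flip: ennreal_numeral ennreal_mult')
      have *: "4 * u \<le> ennreal (e / 4)" if "u \<le> ?I (\<lambda>x. f x - k x) (- pi) (3 * pi)" for u
      proof -
        have "4 * u \<le> 4 * ennreal (e / 16)" using that k(2) by (intro mult_left_mono) auto
        also have "\<dots> = ennreal (e / 4)" using assms by (simp flip: ennreal_numeral ennreal_mult')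
        finally show ?thesis .
      qed
      show "4 * ?I (\<lambda>x. f x - k x) 0 (2 * pi) \<le> ennreal (e / 4)"
        by (intro * nn_integral_mono mult_left_mono) (auto simp: indicator_def)
      have "?I (\<lambda>x. f (x + t) - k (x + t)) 0 (2 * pi) = ?I (\<lambda>x. f x - k x) (0 + t) (2 * pi + t)"
        by (rule nn_integral_Icc_shift[of "\<lambda>x. ennreal ((norm (f x - k x))\<^sup>2)"]) measurable
      also have "\<dots> \<le> ?I (\<lambda>x. f x - k x) (- pi) (3 * pi)"
        using t by (intro nn_integral_mono mult_left_mono) (auto simp: indicator_def)
      finally show "4 * ?I (\<lambda>x. f (x + t) - k (x + t)) 0 (2 * pi) \<le> ennreal (e / 4)"
        by (rule *)
    qed
    also have "\<dots> = ennreal e" using assms by (simp flip: ennreal_plus)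
    finally show "\<omega> t \<le> ennreal e" .
  qed (use d in auto)
qed

end

subsection \<open>The Poisson kernel as an approximate identity\<close>

text \<open>The primitive arctan (t / \<eta>) varies by at most pi, whatever \<eta> is.\<close>

lemma nn_integral_Poisson_kernel_le:
  assumes "\<eta> > 0"
  shows "(\<integral>\<^sup>+t\<in>{- pi..pi}. ennreal (\<eta> / (\<eta>\<^sup>2 + t\<^sup>2)) \<partial>lborel) \<le> ennreal pi"
proof -
  have "((\<lambda>t. arctan (t / \<eta>)) has_real_derivative \<eta> / (\<eta>\<^sup>2 + t\<^sup>2)) (at t)" for t
  proof -
    have "\<eta>\<^sup>2 + t\<^sup>2 > 0" using assms by (intro add_pos_nonneg) auto
    then show ?thesis
      using assms by (auto intro!: derivative_eq_intros simp: power2_eq_square field_simps)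
  qed
  then have "(\<integral>\<^sup>+t\<in>{- pi..pi}. ennreal (\<eta> / (\<eta>\<^sup>2 + t\<^sup>2)) \<partial>lborel) = ennreal (arctan (pi / \<eta>) - arctan (- pi / \<eta>))"
    using assms by (intro nn_integral_FTC_Icc) auto
  also have "\<dots> \<le> ennreal pi"
    using arctan_bounded[of "pi / \<eta>"] by (intro ennreal_leI) (simp add: arctan_minus)
  finally show ?thesis .
qed

context C1_graph
begin

lemma w_measurable [measurable]: "w \<in> borel_measurable borel"
  unfolding w_def Complex_eq
  by (intro borel_measurable_continuous_onI continuous_intros continuous_h)

lemma z'_measurable [measurable]: "z' \<in> borel_measurable borel"
  unfolding z'_def Complex_eq
  by (intro borel_measurable_continuous_onI continuous_intros cont)

lemma z'_bounded:
  obtains B where "B > 0" "\<And>x. norm (z' x) \<le> B"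
proof -
  have "continuous_on UNIV z'"
    unfolding z'_def Complex_eq by (intro continuous_intros cont)
  then show ?thesis
    using periodic_bounded[of z'] that by (auto simp: z'_def h'_periodic)
qed

text \<open>The Schwarz kernel (w(x) + r w(s)) / (w(x) - r w(s)). It equals 1 + 2 r / (q - r), so up
  to constants it is the Cauchy kernel with its pole outside the curve.\<close>

definition K :: "real \<Rightarrow> real \<Rightarrow> real \<Rightarrow> complex" where
  "K r x s = (q x s + of_real r) / (q x s - of_real r)"

lemma P_eq_K: "r > 1 \<Longrightarrow> P r x s = K r x s + K r s x"
  using q_ne[of r x s] q_ne[of r s x] unfolding P_def K_def q_swap[of s x]
  by (simp add: divide_simps)

lemma K_bounded:
  assumes "r > 1"
  obtains B where "\<And>x s. norm (K r x s) \<le> B"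
proof -
  obtain c where c: "0 < c" "\<And>r x s. r > 1 \<Longrightarrow> c * (r - 1) \<le> norm (q x s - of_real r)"
    using q_lower_bound_global by metis
  have pos: "c * (r - 1) > 0" using c(1) assms by simp
  have "norm (K r x s) \<le> 1 + 2 * r / (c * (r - 1))" for x s
  proof -
    let ?d = "q x s - of_real r"
    have "?d \<noteq> 0" using q_ne(1)[OF assms] by simp
    then have "K r x s = 1 + of_real (2 * r) / ?d" by (simp add: K_def field_simps)
    then have "norm (K r x s) \<le> 1 + norm (of_real (2 * r) / ?d)" by (metis norm_one norm_triangle_ineq)
    also have "norm (of_real (2 * r) / ?d) = 2 * r / norm ?d"
      using assms unfolding norm_divide norm_of_real by simp
    also have "\<dots> \<le> 2 * r / (c * (r - 1))"
      using \<open>?d \<noteq> 0\<close> pos c(1) c(2)[OF assms, of x s] assms by (intro divide_left_mono mult_pos_pos) auto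
    finally show ?thesis by simp
  qed
  then show ?thesis by (rule that)
qed

lemma q_not_positive_real_less:
  assumes "t > 1"
  shows "q x s \<noteq> of_real t" "q x s \<noteq> of_real (1 / t)"
  using q_ne[OF assms, of x s] assms by (auto simp: field_simps)

lemma continuous_q: "continuous_on UNIV (q x)"
proof -
  have "continuous (at s) (q x)" for s
    using DERIV_q[of x s] by (rule has_vector_derivative_continuous)
  then show ?thesis by (simp add: continuous_at_imp_continuous_on)
qed

text \<open>As the curve is star-shaped, \<open>1 - q / r\<close> and \<open>1 - 1 / (r q)\<close> avoid the branch cut of the logarithm, so
  the logarithms in the primitive \<open>A\<close> are periodic and only its linear part contributes.\<close>

lemma has_integral_P:
  assumes "r > 1"
  shows "integrable circ (\<lambda>s. z' s * P r x s)" "(LINT s|circ. z' s * P r x s) = - 4 * pi"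
proof -
  \<comment> \<open>Partial fractions: P = - 2 - 2 q / (r - q) - 2 / (r q - 1). With z' ds = - i dq
    / q the three terms integrate to the linear part and the two logarithms.\<close>
  define A where "A = (\<lambda>s. - 2 * (of_real s + \<i> * of_real (h s)) - 2 * \<i> * Ln (1 - q x s / of_real r)
      + 2 * \<i> * Ln (1 - 1 / (of_real r * q x s)))"
  have ne: "q x s \<noteq> of_real r" "of_real r * q x s \<noteq> 1" for s
    using q_ne[OF assms] by auto
  have np1: "1 - q x s / of_real r \<notin> \<real>\<^sub>\<le>\<^sub>0" for s
  proof
    assume "1 - q x s / of_real r \<in> \<real>\<^sub>\<le>\<^sub>0"
    then obtain t where t: "t \<le> 0" "1 - q x s / of_real r = of_real t" by (auto simp: nonpos_Reals_def)
    then have "q x s = of_real (r * (1 - t))" using assms by (simp add: field_simps)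
    moreover have "r * t \<le> 0" using assms t(1) by (simp add: mult_nonneg_nonpos)
    then have "r * (1 - t) > 1" using assms by (simp add: right_diff_distrib)
    ultimately show False using q_not_positive_real_less(1) by blast
  qed
  have np2: "1 - 1 / (of_real r * q x s) \<notin> \<real>\<^sub>\<le>\<^sub>0" for s
  proof
    assume "1 - 1 / (of_real r * q x s) \<in> \<real>\<^sub>\<le>\<^sub>0"
    then obtain t where t: "t \<le> 0" "1 - 1 / (of_real r * q x s) = of_real t" by (auto simp: nonpos_Reals_def)
    then have "1 / (of_real r * q x s) = of_real (1 - t)" by (simp add: algebra_simps)
    moreover have "1 - t \<noteq> 0" using t(1) by simp
    ultimately have "q x s = of_real (1 / (r * (1 - t)))" using assms by (simp add: field_simps)
    moreover have "r * t \<le> 0" using assms t(1) by (simp add: mult_nonneg_nonpos)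
    then have "r * (1 - t) > 1" using assms by (simp add: right_diff_distrib)
    ultimately show False using q_not_positive_real_less(2) by blast
  qed
  have A: "(A has_vector_derivative z' s * P r x s) (at s)" for s
  proof -
    have r0: "of_real r \<noteq> (0::complex)" using assms by simp
    have 1: "((\<lambda>s. of_real s + \<i> * of_real (h s)) has_vector_derivative z' s) (at s)"
      unfolding z'_def Complex_eq using has_vector_derivative_of_real[of "\<lambda>s. s" 1]
      by (intro has_vector_derivative_add has_vector_derivative_mult_right
          has_vector_derivative_of_real) (auto intro!: deriv derivative_eq_intros)
    have 2: "((\<lambda>s. Ln (1 - q x s / of_real r)) has_vector_derivative
        - (\<i> * z' s * q x s / of_real r) * inverse (1 - q x s / of_real r)) (at s)"
    proof -
      have "((\<lambda>v. Ln (1 - v / of_real r)) has_field_derivative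
          - (1 / of_real r) * inverse (1 - q x s / of_real r)) (at (q x s))"
        using np1[of s] r0 by (auto intro!: derivative_eq_intros simp: field_simps)
      from field_vector_diff_chain_at[OF DERIV_q this]
      show ?thesis by (simp add: o_def mult_ac)
    qed
    have 3: "((\<lambda>s. Ln (1 - 1 / (of_real r * q x s))) has_vector_derivative
        \<i> * z' s / (of_real r * q x s) * inverse (1 - 1 / (of_real r * q x s))) (at s)"
    proof -
      have "((\<lambda>v. Ln (1 - 1 / (of_real r * v))) has_field_derivative
          1 / (of_real r * (q x s)\<^sup>2) * inverse (1 - 1 / (of_real r * q x s))) (at (q x s))"
        using np2[of s] r0 by (auto intro!: derivative_eq_intros simp: power2_eq_square field_simps)
      from field_vector_diff_chain_at[OF DERIV_q this]
      show ?thesis by (simp add: o_def power2_eq_square mult_ac)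
    qed
    have "(A has_vector_derivative - 2 * z' s
        - 2 * \<i> * (- (\<i> * z' s * q x s / of_real r) * inverse (1 - q x s / of_real r))
        + 2 * \<i> * (\<i> * z' s / (of_real r * q x s) * inverse (1 - 1 / (of_real r * q x s)))) (at s)"
      unfolding A_def
      by (intro has_vector_derivative_add has_vector_derivative_diff has_vector_derivative_mult_right 1 2 3)
    also have "- 2 * z' s
        - 2 * \<i> * (- (\<i> * z' s * q x s / of_real r) * inverse (1 - q x s / of_real r))
        + 2 * \<i> * (\<i> * z' s / (of_real r * q x s) * inverse (1 - 1 / (of_real r * q x s)))
        = z' s * (- 2 - 2 * q x s / (of_real r - q x s) - 2 / (of_real r * q x s - 1))"
    proof -
      have a: "q x s / of_real r * inverse (1 - q x s / of_real r) = q x s / (of_real r - q x s)"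
        using r0 ne(1)[of s] by (simp add: field_simps)
      have b: "1 / (of_real r * q x s) * inverse (1 - 1 / (of_real r * q x s)) = 1 / (of_real r * q x s - 1)"
        using r0 ne(2)[of s] by (simp add: field_simps)
      have "- 2 * z' s - 2 * \<i> * (- (\<i> * z' s * q x s / of_real r) * inverse (1 - q x s / of_real r))
        + 2 * \<i> * (\<i> * z' s / (of_real r * q x s) * inverse (1 - 1 / (of_real r * q x s)))
        = z' s * (- 2 + 2 * (\<i> * \<i>) * (q x s / of_real r * inverse (1 - q x s / of_real r))
            + 2 * (\<i> * \<i>) * (1 / (of_real r * q x s) * inverse (1 - 1 / (of_real r * q x s))))"
        by (simp add: algebra_simps)
      then show ?thesis unfolding a b by (simp add: algebra_simps)
    qed
    also have "- 2 - 2 * q x s / (of_real r - q x s) - 2 / (of_real r * q x s - 1) = P r x s"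
    proof -
      have n: "of_real r - q x s \<noteq> 0" "q x s - of_real r \<noteq> 0" "of_real r * q x s - 1 \<noteq> 0" "1 - of_real r * q x s \<noteq> 0"
        using ne[of s] by auto
      have "(q x s + of_real r) / (q x s - of_real r) = - 1 - 2 * q x s / (of_real r - q x s)"
        using n(1,2) by (simp add: field_simps)
      moreover have "(1 + of_real r * q x s) / (1 - of_real r * q x s) = - 1 - 2 / (of_real r * q x s - 1)"
        using n(3,4) by (simp add: field_simps)
      ultimately show ?thesis by (simp add: P_def)
    qed
    finally show ?thesis .
  qed
  have cont: "continuous_on {0..2 * pi} (\<lambda>s. z' s * P r x s)"
    unfolding P_def z'_def Complex_eq using ne
    by (intro continuous_intros continuous_on_subset[OF continuous_q] continuous_on_subset[OF cont])
      (auto simp: eq_commute[of 1])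
  have *: "has_bochner_integral lborel (\<lambda>s. indicator {0..2 * pi} s *\<^sub>R (z' s * P r x s)) (A (2 * pi) - A 0)"
    using A cont by (intro has_bochner_integral_FTC_Icc) (auto intro: has_vector_derivative_at_within)
  moreover have "A (2 * pi) - A 0 = - 4 * pi"
    using q_periodic(2)[of x 0] periodic[of 0] by (simp add: A_def)
  ultimately show "integrable circ (\<lambda>s. z' s * P r x s)" "(LINT s|circ. z' s * P r x s) = - 4 * pi"
    by (auto simp: integrable_restrict_space integral_restrict_space has_bochner_integral_iff)
qed

end

section \<open>Decay of the energy\<close>

locale graph_L2 = C1_graph h h' + periodic_L2 f for h h' f
begin

definition energy :: "real \<Rightarrow> ennreal" where
  "energy r = (\<integral>\<^sup>+x\<in>{0..2 * pi}. (\<integral>\<^sup>+s\<in>{0..2 * pi}. ennreal ((norm (f x - f s))\<^sup>2 * norm (P r x s)) \<partial>lborel) \<partial>lborel)"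

lemma P_measurable [measurable]:
  assumes [measurable]: "a \<in> borel_measurable M" "b \<in> borel_measurable M"
  shows "(\<lambda>p. P r (a p) (b p)) \<in> borel_measurable M"
  unfolding P_def q_def by measurable

text \<open>With s = x + t and Tonelli, the energy is at most the integral over |t| \<le> pi of
  \<open>\<omega> t\<close> against a Poisson kernel of width \<eta> = r - 1, which concentrates
  where \<open>\<omega>\<close> is small.\<close>

lemma energy_small:
  assumes "e > 0"
  obtains r where "1 < r" "energy r \<le> ennreal e"
proof -
  obtain C where C: "C > 0"
    "\<And>r x s. 1 < r \<Longrightarrow> r \<le> 2 \<Longrightarrow> \<bar>x - s\<bar> \<le> pi \<Longrightarrow> norm (P r x s) \<le> C * ((r - 1) / ((r - 1)\<^sup>2 + (x - s)\<^sup>2))"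
    using P_bounds by metis
  define W where "W = 4 * enn2real (\<integral>\<^sup>+x\<in>{0..2 * pi}. ennreal ((norm (f x))\<^sup>2) \<partial>lborel)"
  have W: "W \<ge> 0" "\<And>t. \<omega> t \<le> ennreal W"
    using \<omega>_bounded fin by (auto simp: W_def ennreal_mult')
  define e1 where "e1 = e / (2 * (C * pi))"
  have e1: "e1 > 0" using assms C by (simp add: e1_def)
  obtain \<delta> where \<delta>: "\<delta> > 0" "\<And>t. \<bar>t\<bar> < \<delta> \<Longrightarrow> \<omega> t \<le> ennreal e1"
    using \<omega>_small[OF e1] by blast
  \<comment> \<open>One bound for all t replaces splitting the integral at \<delta>: the kernel
    times t^2 is at most a multiple of \<eta>, so the second term contributes O(\<eta>).\<close>
  have \<omega>_le: "\<omega> t \<le> ennreal (e1 + W * t\<^sup>2 / \<delta>\<^sup>2)" for t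
  proof (cases "\<bar>t\<bar> < \<delta>")
    case True
    then show ?thesis
      using W(1) by (intro order.trans[OF \<delta>(2)] ennreal_leI) auto
  next
    case False
    then have "\<delta>\<^sup>2 \<le> t\<^sup>2" using \<delta>(1) by (metis abs_le_square_iff abs_of_pos not_le)
    then have "1 \<le> t\<^sup>2 / \<delta>\<^sup>2" using \<delta>(1) by simp
    from mult_left_mono[OF this W(1)] have "W \<le> W * t\<^sup>2 / \<delta>\<^sup>2" by simp
    then show ?thesis using e1 by (intro order.trans[OF W(2)] ennreal_leI) auto
  qed
  define D where "D = C * W / \<delta>\<^sup>2 * (2 * pi)"
  have D: "D \<ge> 0" using C W by (simp add: D_def)
  \<comment> \<open>The minimum with 1 gives r \<le> 2, the range of the kernel bound. The other
    entry gives D \<eta> \<le> e / 2, and e1 was chosen to make the remaining contribution C e1 pi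
    equal to e / 2.\<close>
  define \<eta> where "\<eta> = min 1 (e / (2 * (D + 1)))"
  have \<eta>: "\<eta> > 0" "\<eta> \<le> 1" using assms D by (auto simp: \<eta>_def)
  have D\<eta>: "D * \<eta> \<le> e / 2"
  proof -
    have "D * \<eta> \<le> D * (e / (2 * (D + 1)))" using D by (intro mult_left_mono) (auto simp: \<eta>_def)
    also have "\<dots> \<le> e / 2" using D assms by (simp add: field_simps)
    finally show ?thesis .
  qed
  define r where "r = 1 + \<eta>"
  have r: "1 < r" "r \<le> 2" using \<eta> by (auto simp: r_def)
  let ?k = "\<lambda>t. C * (\<eta> / (\<eta>\<^sup>2 + t\<^sup>2))"
  have den: "\<eta>\<^sup>2 + t\<^sup>2 > 0" for t using \<eta> by (intro add_pos_nonneg) auto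
  have k0: "?k t \<ge> 0" for t using C \<eta> den[of t] by simp
  have "energy r \<le> (\<integral>\<^sup>+x. (\<integral>\<^sup>+t. ennreal ((norm (f x - f (x + t)))\<^sup>2) * ennreal (?k t)
      * (indicator {- pi..pi} t * indicator {0..2 * pi} x) \<partial>lborel) \<partial>lborel)"
    unfolding energy_def
  proof (intro nn_integral_mono)
    fix x
    let ?g = "\<lambda>s. ennreal ((norm (f x - f s))\<^sup>2 * norm (P r x s))"
    have "(\<integral>\<^sup>+s\<in>{0..2 * pi}. ?g s \<partial>lborel) = (\<integral>\<^sup>+s\<in>{- pi + x..- pi + x + 2 * pi}. ?g s \<partial>lborel)"
      by (rule nn_integral_periodic[symmetric]) (auto simp: per P_periodic)
    also have "\<dots> = (\<integral>\<^sup>+t\<in>{- pi..pi}. ?g (t + x) \<partial>lborel)"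
      by (subst nn_integral_Icc_shift) (auto simp: algebra_simps)
    also have "\<dots> \<le> (\<integral>\<^sup>+t. ennreal ((norm (f x - f (x + t)))\<^sup>2) * ennreal (?k t) * indicator {- pi..pi} t \<partial>lborel)"
    proof (intro nn_integral_mono)
      fix t
      show "?g (t + x) * indicator {- pi..pi} t
          \<le> ennreal ((norm (f x - f (x + t)))\<^sup>2) * ennreal (?k t) * indicator {- pi..pi} t"
      proof (cases "t \<in> {- pi..pi}")
        case True
        then have "norm (P r x (t + x)) \<le> ?k t"
          using C(2)[OF r, of x "t + x"] by (simp add: r_def abs_le_iff)
        then have "(norm (f x - f (t + x)))\<^sup>2 * norm (P r x (t + x)) \<le> (norm (f x - f (t + x)))\<^sup>2 * ?k t"
          by (intro mult_left_mono) auto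
        then show ?thesis using True k0[of t]
          by (simp add: ennreal_leI add.commute[of t] flip: ennreal_mult)
      qed simp
    qed
    finally show "(\<integral>\<^sup>+s\<in>{0..2 * pi}. ?g s \<partial>lborel) * indicator {0..2 * pi} x
      \<le> (\<integral>\<^sup>+t. ennreal ((norm (f x - f (x + t)))\<^sup>2) * ennreal (?k t) * (indicator {- pi..pi} t * indicator {0..2 * pi} x) \<partial>lborel)"
      by (auto simp: indicator_def)
  qed
  also have "\<dots> = (\<integral>\<^sup>+t. (\<integral>\<^sup>+x. ennreal ((norm (f x - f (x + t)))\<^sup>2) * ennreal (?k t)
      * (indicator {- pi..pi} t * indicator {0..2 * pi} x) \<partial>lborel) \<partial>lborel)"
    by (rule lborel_pair.Fubini'[symmetric]) measurable
  also have "\<dots> = (\<integral>\<^sup>+t. (ennreal (?k t) * indicator {- pi..pi} t) * \<omega> t \<partial>lborel)"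
    unfolding \<omega>_def by (intro nn_integral_cong) (auto simp: nn_integral_cmult[symmetric] mult_ac)
  also have "\<dots> \<le> (\<integral>\<^sup>+t. ennreal (C * e1) * (ennreal (\<eta> / (\<eta>\<^sup>2 + t\<^sup>2)) * indicator {- pi..pi} t)
      + ennreal (C * W / \<delta>\<^sup>2 * \<eta>) * indicator {- pi..pi} t \<partial>lborel)"
  proof (intro nn_integral_mono)
    fix t
    have "ennreal (?k t) * \<omega> t \<le> ennreal (?k t) * ennreal (e1 + W * t\<^sup>2 / \<delta>\<^sup>2)"
      by (intro mult_left_mono \<omega>_le) auto
    also have "\<dots> = ennreal (?k t * (e1 + W * t\<^sup>2 / \<delta>\<^sup>2))"
      by (rule ennreal_mult'[OF k0, symmetric])
    also have "\<dots> \<le> ennreal (C * e1 * (\<eta> / (\<eta>\<^sup>2 + t\<^sup>2)) + C * W / \<delta>\<^sup>2 * \<eta>)"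
    proof (intro ennreal_leI)
      have "?k t * (W * t\<^sup>2 / \<delta>\<^sup>2) = (C * W / \<delta>\<^sup>2 * \<eta>) * (t\<^sup>2 / (\<eta>\<^sup>2 + t\<^sup>2))" by (simp add: mult_ac)
      also have "\<dots> \<le> (C * W / \<delta>\<^sup>2 * \<eta>) * 1"
        using C W \<eta> den[of t] by (intro mult_left_mono) (auto simp: divide_le_eq_1)
      finally have "?k t * (W * t\<^sup>2 / \<delta>\<^sup>2) \<le> C * W / \<delta>\<^sup>2 * \<eta>" by simp
      moreover have "?k t * (e1 + X) = C * e1 * (\<eta> / (\<eta>\<^sup>2 + t\<^sup>2)) + ?k t * X" for X
        by (simp only: distrib_left) (simp only: mult_ac)
      ultimately show "?k t * (e1 + W * t\<^sup>2 / \<delta>\<^sup>2) \<le> C * e1 * (\<eta> / (\<eta>\<^sup>2 + t\<^sup>2)) + C * W / \<delta>\<^sup>2 * \<eta>"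
        by (simp only: add_left_mono)
    qed
    also have "\<dots> = ennreal (C * e1) * ennreal (\<eta> / (\<eta>\<^sup>2 + t\<^sup>2)) + ennreal (C * W / \<delta>\<^sup>2 * \<eta>)"
    proof -
      have "ennreal (C * e1 * (\<eta> / (\<eta>\<^sup>2 + t\<^sup>2))) = ennreal (C * e1) * ennreal (\<eta> / (\<eta>\<^sup>2 + t\<^sup>2))"
        using C e1 by (intro ennreal_mult') auto
      moreover have "0 \<le> C * e1 * (\<eta> / (\<eta>\<^sup>2 + t\<^sup>2))" "0 \<le> C * W / \<delta>\<^sup>2 * \<eta>"
        using C W e1 \<eta> den[of t] by auto
      ultimately show ?thesis by (simp only: ennreal_plus)
    qed
    finally show "(ennreal (?k t) * indicator {- pi..pi} t) * \<omega> t
        \<le> ennreal (C * e1) * (ennreal (\<eta> / (\<eta>\<^sup>2 + t\<^sup>2)) * indicator {- pi..pi} t)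
          + ennreal (C * W / \<delta>\<^sup>2 * \<eta>) * indicator {- pi..pi} t"
      by (auto simp: indicator_def)
  qed
  also have "\<dots> = ennreal (C * e1) * (\<integral>\<^sup>+t\<in>{- pi..pi}. ennreal (\<eta> / (\<eta>\<^sup>2 + t\<^sup>2)) \<partial>lborel)
      + ennreal (C * W / \<delta>\<^sup>2 * \<eta>) * ennreal (2 * pi)"
    by (subst nn_integral_add) (auto simp: nn_integral_cmult nn_integral_cmult_indicator)
  also have "\<dots> \<le> ennreal (C * e1) * ennreal pi + ennreal (C * W / \<delta>\<^sup>2 * \<eta>) * ennreal (2 * pi)"
    by (intro add_right_mono mult_left_mono nn_integral_Poisson_kernel_le \<eta>) auto
  also have "\<dots> = ennreal (C * e1 * pi + C * W / \<delta>\<^sup>2 * \<eta> * (2 * pi))"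
  proof -
    have nn: "0 \<le> C * e1" "0 \<le> C * W / \<delta>\<^sup>2 * \<eta>" using C W e1 \<eta> by auto
    have "0 \<le> C * e1 * pi" "0 \<le> C * W / \<delta>\<^sup>2 * \<eta> * (2 * pi)"
      by (rule mult_nonneg_nonneg[OF nn(1)] mult_nonneg_nonneg[OF nn(2)]; simp)+
    then show ?thesis by (simp only: ennreal_plus ennreal_mult'[OF nn(1)] ennreal_mult'[OF nn(2)])
  qed
  also have "\<dots> \<le> ennreal e"
  proof (intro ennreal_leI)
    have "C * e1 * pi = e / 2" using C by (simp add: e1_def)
    moreover have "C * W / \<delta>\<^sup>2 * \<eta> * (2 * pi) = D * \<eta>" by (simp add: D_def)
    ultimately show "C * e1 * pi + C * W / \<delta>\<^sup>2 * \<eta> * (2 * pi) \<le> e" using D\<eta> by simp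
  qed
  finally show ?thesis using r that by blast
qed

end

lemma integrable_bounded_mult:
  fixes g k :: "'b \<Rightarrow> 'a::{real_normed_div_algebra, banach, second_countable_topology}"
  assumes "integrable M g" "k \<in> borel_measurable M" "\<And>p. p \<in> space M \<Longrightarrow> norm (k p) \<le> B"
  shows "integrable M (\<lambda>p. g p * k p)"
proof (rule Bochner_Integration.integrable_bound)
  show "integrable M (\<lambda>p. B * norm (g p))" using assms(1) by auto
  show "(\<lambda>p. g p * k p) \<in> borel_measurable M" using assms(1,2) by measurable
  show "AE p in M. norm (g p * k p) \<le> norm (B * norm (g p))"
  proof (rule AE_I2)
    fix p assume "p \<in> space M"
    have "norm (g p * k p) = norm (k p) * norm (g p)" by (simp add: norm_mult)
    also have "\<dots> \<le> B * norm (g p)" by (intro mult_right_mono assms(3) \<open>p \<in> space M\<close>) auto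
    finally show "norm (g p * k p) \<le> norm (B * norm (g p))" by simp
  qed
qed

context graph_L2
begin

lemma integrable_norm_power2: "integrable circ (\<lambda>x. (norm (f x))\<^sup>2)"
proof (rule integrableI_nonneg)
  show "(\<integral>\<^sup>+x. ennreal ((norm (f x))\<^sup>2) \<partial>circ) < \<infinity>"
    using fin by (simp add: nn_integral_restrict_space)
qed auto

abbreviation circ2 :: "(real \<times> real) measure" where
  "circ2 \<equiv> circ \<Otimes>\<^sub>M circ"

sublocale circ: finite_measure circ
  by (rule finite_measure_circ)

sublocale circ2: pair_sigma_finite circ circ ..

lemma integrable_circ2_fst:
  fixes g :: "real \<Rightarrow> 'a::{banach, second_countable_topology}"
  assumes g: "integrable circ g"
  shows "integrable circ2 (\<lambda>p. g (fst p))"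
proof (rule circ2.Fubini_integrable)
  show "(\<lambda>p. g (fst p)) \<in> borel_measurable circ2"
    using g by measurable
qed (use g in auto)

lemma integrable_circ2_snd:
  fixes g :: "real \<Rightarrow> 'a::{banach, second_countable_topology}"
  assumes g: "integrable circ g"
  shows "integrable circ2 (\<lambda>p. g (snd p))"
proof (rule circ2.Fubini_integrable)
  show "(\<lambda>p. g (snd p)) \<in> borel_measurable circ2"
    using g by measurable
qed (use g in auto)

lemma circ2_measurable_fst [measurable]: "fst \<in> borel_measurable circ2"
  by (rule measurable_compose[OF measurable_fst]) simp

lemma circ2_measurable_snd [measurable]: "snd \<in> borel_measurable circ2"
  by (rule measurable_compose[OF measurable_snd]) simp

text \<open>Polarisation: \<open>2 f(x) f(s) = f(x)\<^sup>2 + f(s)\<^sup>2 - (f(x) - f(s))\<^sup>2\<close>. Against the kernel, the product gives 0 by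
  hypothesis, each square gives \<open>- 4 \<pi>\<close> times the integral in question, and the difference is controlled
  by the energy.\<close>

lemma integral_square_eq_0:
  assumes ann: "\<And>r s. r > 1 \<Longrightarrow> (LINT x|circ. f x * z' x * K r x s) = 0"
  shows "(LINT x|circ. (f x)\<^sup>2 * z' x) = 0"
proof -
  define A where "A = (LINT x|circ. (f x)\<^sup>2 * z' x)"
  obtain B where B: "B > 0" "\<And>x. norm (z' x) \<le> B" using z'_bounded by blast
  have z'zz: "norm (z' x * z' s) \<le> B\<^sup>2" for x s
    unfolding norm_mult power2_eq_square using B by (intro mult_mono) auto
  have f2: "integrable circ (\<lambda>x. (f x)\<^sup>2)"
    by (rule Bochner_Integration.integrable_bound[OF integrable_norm_power2]) (auto simp: norm_power)
  have ff: "integrable circ2 (\<lambda>p. f (fst p) * f (snd p))"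
  proof (rule Bochner_Integration.integrable_bound)
    show "integrable circ2 (\<lambda>p. (norm (f (fst p)))\<^sup>2 + (norm (f (snd p)))\<^sup>2)"
      using integrable_circ2_fst[OF integrable_norm_power2] integrable_circ2_snd[OF integrable_norm_power2]
      by (rule Bochner_Integration.integrable_add)
    show "AE p in circ2. norm (f (fst p) * f (snd p)) \<le> norm ((norm (f (fst p)))\<^sup>2 + (norm (f (snd p)))\<^sup>2)"
    proof (rule AE_I2)
      fix p :: "real \<times> real"
      let ?a = "norm (f (fst p))" and ?b = "norm (f (snd p))"
      define m where "m = ?a * ?b"
      have "0 \<le> m" "2 * m \<le> ?a\<^sup>2 + ?b\<^sup>2" using sum_squares_bound[of ?a ?b] by (auto simp: m_def)
      then have "m \<le> ?a\<^sup>2 + ?b\<^sup>2" by linarith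
      then show "norm (f (fst p) * f (snd p)) \<le> norm (?a\<^sup>2 + ?b\<^sup>2)" by (simp add: norm_mult m_def)
    qed
  qed measurable
  have bound: "ennreal (norm (8 * pi * A)) \<le> ennreal (B\<^sup>2) * energy r" if r: "r > 1" for r
  proof -
    obtain k where k: "\<And>x s. norm (K r x s) \<le> k" using K_bounded[OF r] by blast
    have [measurable]: "(\<lambda>p. K r (a p) (b p)) \<in> borel_measurable circ2"
      if [measurable]: "a \<in> borel_measurable circ2" "b \<in> borel_measurable circ2" for a b
      unfolding K_def q_def by measurable
    have k': "norm (P r x s) \<le> 2 * k" for x s
      unfolding P_eq_K[OF r] using norm_triangle_ineq[of "K r x s" "K r s x"] k[of x s] k[of s x] by simp
    let ?\<kappa> = "\<lambda>x s. z' x * z' s * P r x s"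
    have \<kappa>: "norm (?\<kappa> x s) \<le> B\<^sup>2 * (2 * k)" for x s
      unfolding norm_mult[of "z' x * z' s"] by (intro mult_mono z'zz k') auto
    have zk: "norm (z' x * z' s * K r x' s') \<le> B\<^sup>2 * k" for x s x' s'
      unfolding norm_mult[of "z' x * z' s"] by (intro mult_mono z'zz k) auto
    have i1: "integrable circ2 (\<lambda>(x, s). (f x * f s) * (z' x * z' s * K r x s))"
      unfolding case_prod_beta by (rule integrable_bounded_mult[OF ff _ zk]) measurable
    have i2: "integrable circ2 (\<lambda>(x, s). (f x * f s) * (z' x * z' s * K r s x))"
      unfolding case_prod_beta by (rule integrable_bounded_mult[OF ff _ zk]) measurable
    have i3: "integrable circ2 (\<lambda>(x, s). (f x)\<^sup>2 * ?\<kappa> x s)"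
      unfolding case_prod_beta by (rule integrable_bounded_mult[OF integrable_circ2_fst[OF f2] _ \<kappa>]) measurable
    have i4: "integrable circ2 (\<lambda>(x, s). (f s)\<^sup>2 * ?\<kappa> x s)"
      unfolding case_prod_beta by (rule integrable_bounded_mult[OF integrable_circ2_snd[OF f2] _ \<kappa>]) measurable
    \<comment> \<open>The hypothesis concerns the first argument of \<open>K\<close>, so the two
      halves of \<open>P\<close> vanish by integrating in opposite orders: in x first here, in s
      first for the exchanged kernel.\<close>
    have e1: "(\<integral>p. (case p of (x, s) \<Rightarrow> (f x * f s) * (z' x * z' s * K r x s)) \<partial>circ2) = 0"
    proof -
      have "(LINT x|circ. (f x * f s) * (z' x * z' s * K r x s)) = (f s * z' s) * (LINT x|circ. f x * z' x * K r x s)" for s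
        by (subst integral_mult_right_zero[symmetric]) (simp only: mult_ac)
      then show ?thesis using circ2.integral_snd[OF i1] by (simp add: ann[OF r])
    qed
    have e2: "(\<integral>p. (case p of (x, s) \<Rightarrow> (f x * f s) * (z' x * z' s * K r s x)) \<partial>circ2) = 0"
    proof -
      have "(LINT s|circ. (f x * f s) * (z' x * z' s * K r s x)) = (f x * z' x) * (LINT s|circ. f s * z' s * K r s x)" for x
        by (subst integral_mult_right_zero[symmetric]) (simp only: mult_ac)
      then show ?thesis using circ2.integral_fst[OF i2] by (simp add: ann[OF r])
    qed
    \<comment> \<open>The weight \<open>z' x * z' s\<close> makes the inner integral the constant
      mass of the kernel and leaves \<open>(f x)\<^sup>2 * z' x\<close> for the outer one.\<close>
    have e3: "(\<integral>p. (case p of (x, s) \<Rightarrow> (f x)\<^sup>2 * ?\<kappa> x s) \<partial>circ2) = A * (- 4 * pi)"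
    proof -
      have "(LINT s|circ. (f x)\<^sup>2 * ?\<kappa> x s) = ((f x)\<^sup>2 * z' x) * (- 4 * pi)" for x
        by (subst has_integral_P(2)[OF r, symmetric], subst integral_mult_right_zero[symmetric]) (simp only: mult_ac)
      then show ?thesis
        using circ2.integral_fst[OF i3] by (simp only: A_def integral_mult_left_zero)
    qed
    have e4: "(\<integral>p. (case p of (x, s) \<Rightarrow> (f s)\<^sup>2 * ?\<kappa> x s) \<partial>circ2) = A * (- 4 * pi)"
    proof -
      have "(LINT x|circ. (f s)\<^sup>2 * ?\<kappa> x s) = ((f s)\<^sup>2 * z' s) * (- 4 * pi)" for s
        unfolding P_symmetric[OF r, of _ s]
        by (subst has_integral_P(2)[OF r, symmetric], subst integral_mult_right_zero[symmetric]) (simp only: mult_ac)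
      then show ?thesis
        using circ2.integral_snd[OF i4] by (simp only: A_def integral_mult_left_zero)
    qed
    define g where "g = (\<lambda>p. (f (fst p) - f (snd p))\<^sup>2 * ?\<kappa> (fst p) (snd p))"
    have g_eq: "g = (\<lambda>p. (case p of (x, s) \<Rightarrow> (f x)\<^sup>2 * ?\<kappa> x s) + (case p of (x, s) \<Rightarrow> (f s)\<^sup>2 * ?\<kappa> x s)
        - 2 * ((case p of (x, s) \<Rightarrow> (f x * f s) * (z' x * z' s * K r x s))
          + (case p of (x, s) \<Rightarrow> (f x * f s) * (z' x * z' s * K r s x))))"
      by (auto simp: g_def P_eq_K[OF r] power2_eq_square algebra_simps)
    have int_g: "integrable circ2 g"
      unfolding g_eq by (intro Bochner_Integration.integrable_diff Bochner_Integration.integrable_add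
          integrable_mult_right i1 i2 i3 i4)
    have "(\<integral>p. g p \<partial>circ2) = - 8 * pi * A"
      unfolding g_eq using i1 i2 i3 i4 by (simp add: e1 e2 e3 e4)
    then have "ennreal (norm (8 * pi * A)) = ennreal (norm (\<integral>p. g p \<partial>circ2))"
      by (simp add: norm_mult)
    also have "\<dots> \<le> (\<integral>\<^sup>+p. ennreal (norm (g p)) \<partial>circ2)"
      by (rule integral_norm_bound_ennreal[OF int_g])
    also have "\<dots> = (\<integral>\<^sup>+x. (\<integral>\<^sup>+s. ennreal (norm (g (x, s))) \<partial>circ) \<partial>circ)"
    proof (rule circ.nn_integral_fst[symmetric])
      have "(\<lambda>v::complex. ennreal (norm v)) \<in> borel_measurable borel" by measurable
      then show "(\<lambda>p. ennreal (norm (g p))) \<in> borel_measurable circ2"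
        by (rule measurable_compose[OF borel_measurable_integrable[OF int_g]])
    qed
    also have "\<dots> \<le> (\<integral>\<^sup>+x. (\<integral>\<^sup>+s. ennreal (B\<^sup>2) * ennreal ((norm (f x - f s))\<^sup>2 * norm (P r x s)) \<partial>circ) \<partial>circ)"
    proof (intro nn_integral_mono)
      fix x s
      have "norm (g (x, s)) = norm (z' x * z' s) * ((norm (f x - f s))\<^sup>2 * norm (P r x s))"
        by (simp add: g_def norm_mult norm_power)
      also have "\<dots> \<le> B\<^sup>2 * ((norm (f x - f s))\<^sup>2 * norm (P r x s))"
        by (intro mult_right_mono z'zz) auto
      finally show "ennreal (norm (g (x, s))) \<le> ennreal (B\<^sup>2) * ennreal ((norm (f x - f s))\<^sup>2 * norm (P r x s))"
        by (simp add: ennreal_leI flip: ennreal_mult)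
    qed
    also have "\<dots> = ennreal (B\<^sup>2) * energy r"
      unfolding energy_def by (simp add: nn_integral_cmult nn_integral_restrict_space)
    finally show ?thesis .
  qed
  have "norm (8 * pi * A) \<le> e" if "e > 0" for e
  proof -
    have "e / B\<^sup>2 > 0" using that B by simp
    then obtain r where r: "1 < r" "energy r \<le> ennreal (e / B\<^sup>2)" by (rule energy_small)
    have "ennreal (norm (8 * pi * A)) \<le> ennreal (B\<^sup>2) * ennreal (e / B\<^sup>2)"
      by (rule order.trans[OF bound[OF r(1)] mult_left_mono[OF r(2)]]) auto
    also have "\<dots> = ennreal e" using B that by (simp flip: ennreal_mult)
    finally show ?thesis using that by (simp add: ennreal_le_iff)
  qed
  then have "norm (8 * pi * A) \<le> 0" using field_le_epsilon[of "norm (8 * pi * A)" 0] by simp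
  then show ?thesis by (simp add: A_def)
qed

end

subsection \<open>Polynomial approximation of the Cauchy kernel\<close>

context C1_graph
begin

text \<open>Membership in the uniform closure, on the curve, of the polynomials in \<open>w\<close>.
  Bounded products and 1 / (1 - g) for small g stay in it, and integration against a function
  orthogonal to all powers of \<open>w\<close> gives 0 on it.\<close>

definition poly_approx :: "(real \<Rightarrow> complex) \<Rightarrow> bool" where
  "poly_approx g \<longleftrightarrow> (\<forall>e>0. \<exists>p. \<forall>x. norm (g x - poly p (w x)) \<le> e)"

lemma q_bounded:
  obtains B where "B \<ge> 1" "\<And>x s. norm (q x s) \<le> B"
proof -
  obtain H where H: "H > 0" "\<And>x. norm (h x) \<le> H"
    using periodic_bounded[of h] periodic continuous_h by blast
  have "norm (q x s) \<le> exp (2 * H)" for x s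
  proof -
    have "h x - h s \<le> 2 * H" using H(2)[of x] H(2)[of s] by (simp add: abs_le_iff)
    then show ?thesis by (simp add: q_eq)
  qed
  then show ?thesis using H(1) by (intro that[of "exp (2 * H)"]) auto
qed

lemma w_bounded:
  obtains W where "W > 0" "\<And>x. norm (w x) \<le> W"
proof -
  have "continuous_on UNIV w"
    unfolding w_def Complex_eq by (intro continuous_intros continuous_h)
  then show ?thesis using periodic_bounded[of w] w_periodic that by blast
qed

lemma poly_approx_mult:
  assumes f: "poly_approx f" "\<And>x. norm (f x) \<le> Bf" and g: "poly_approx g" "\<And>x. norm (g x) \<le> Bg"
  shows "poly_approx (\<lambda>x. f x * g x)"
  unfolding poly_approx_def
proof (intro allI impI)
  fix e :: real assume "e > 0"
  have B: "Bf \<ge> 0" "Bg \<ge> 0" using f(2)[of 0] g(2)[of 0] norm_ge_zero order.trans by blast+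
  \<comment> \<open>The entry 1 keeps the polynomial s below Bg + 1, the factor that multiplies the
    error made in f. The added 1 in the denominators covers bounds equal to 0.\<close>
  define d where "d = min 1 (e / (2 * (Bf + 1)))"
  have "d > 0" using \<open>e > 0\<close> B by (simp add: d_def)
  then obtain s where s: "\<And>x. norm (g x - poly s (w x)) \<le> d" using g(1) unfolding poly_approx_def by blast
  have "e / (2 * (Bg + 1)) > 0" using \<open>e > 0\<close> B by simp
  then obtain p where p: "\<And>x. norm (f x - poly p (w x)) \<le> e / (2 * (Bg + 1))"
    using f(1) unfolding poly_approx_def by blast
  have "norm (f x * g x - poly (p * s) (w x)) \<le> e" for x
  proof -
    have "norm (poly s (w x)) \<le> norm (g x) + norm (g x - poly s (w x))"
      using norm_triangle_ineq4[of "g x" "g x - poly s (w x)"] by simp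
    then have ns: "norm (poly s (w x)) \<le> Bg + 1"
      using g(2)[of x] s[of x] by (simp add: d_def)
    have "f x * g x - poly (p * s) (w x) = f x * (g x - poly s (w x)) + (f x - poly p (w x)) * poly s (w x)"
      by (simp add: algebra_simps)
    then have "norm (f x * g x - poly (p * s) (w x))
        \<le> norm (f x) * norm (g x - poly s (w x)) + norm (f x - poly p (w x)) * norm (poly s (w x))"
      by (metis norm_mult norm_triangle_ineq)
    also have "\<dots> \<le> Bf * (e / (2 * (Bf + 1))) + e / (2 * (Bg + 1)) * (Bg + 1)"
      using B \<open>e > 0\<close> s[of x] by (intro add_mono mult_mono f(2) p ns) (auto simp: d_def)
    also have "\<dots> \<le> (Bf + 1) * (e / (2 * (Bf + 1))) + e / (2 * (Bg + 1)) * (Bg + 1)"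
      using B \<open>e > 0\<close> by (intro add_right_mono mult_right_mono) auto
    also have "\<dots> = e" using B by (simp add: divide_simps) (simp add: algebra_simps)
    finally show ?thesis .
  qed
  then show "\<exists>p. \<forall>x. norm (f x * g x - poly p (w x)) \<le> e" by blast
qed

lemma poly_approx_add:
  assumes "poly_approx f" "poly_approx g"
  shows "poly_approx (\<lambda>x. f x + g x)"
  unfolding poly_approx_def
proof (intro allI impI)
  fix e :: real assume "e > 0"
  then obtain p s where ps: "\<And>x. norm (f x - poly p (w x)) \<le> e / 2" "\<And>x. norm (g x - poly s (w x)) \<le> e / 2"
    using assms unfolding poly_approx_def by (meson half_gt_zero)
  have "norm (f x + g x - poly (p + s) (w x)) \<le> e" for x
    using norm_triangle_ineq[of "f x - poly p (w x)" "g x - poly s (w x)"] ps[of x] by (simp add: algebra_simps)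
  then show "\<exists>p. \<forall>x. norm (f x + g x - poly p (w x)) \<le> e" by blast
qed

lemma poly_approx_poly: "poly_approx (\<lambda>x. poly p (w x))"
  unfolding poly_approx_def by (intro allI impI exI[of _ p]) simp

lemma poly_approx_const: "poly_approx (\<lambda>x. c)"
  using poly_approx_poly[of "[:c:]"] by simp

text \<open>A truncated Neumann series: after n terms the remainder g^n / (1 - g) has norm at most 2
  (1 / 2)^n.\<close>

lemma poly_approx_geometric:
  assumes g: "poly_approx g" "\<And>x. norm (g x) \<le> 1 / 2"
  shows "poly_approx (\<lambda>x. 1 / (1 - g x))"
  unfolding poly_approx_def
proof (intro allI impI)
  fix e :: real assume "e > 0"
  have pow: "poly_approx (\<lambda>x. g x ^ n)" for n
  proof (induction n)
    case (Suc n)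
    have "norm (g x ^ n) \<le> 1" for x using g(2)[of x] by (simp add: norm_power power_le_one)
    from poly_approx_mult[OF g Suc this] show ?case by simp
  qed (simp add: poly_approx_const)
  have sum: "poly_approx (\<lambda>x. \<Sum>k<n. g x ^ k)" for n
    by (induction n) (simp_all add: poly_approx_const poly_approx_add pow)
  obtain n where n: "(1 / 2) ^ n < e / 4" using real_arch_pow_inv[of "e / 4" "1 / 2"] \<open>e > 0\<close> by auto
  obtain p where p: "\<And>x. norm ((\<Sum>k<n. g x ^ k) - poly p (w x)) \<le> e / 2"
    using sum \<open>e > 0\<close> unfolding poly_approx_def by (meson half_gt_zero)
  have "norm (1 / (1 - g x) - poly p (w x)) \<le> e" for x
  proof -
    have g1: "1 / 2 \<le> norm (1 - g x)" using g(2)[of x] norm_triangle_ineq2[of 1 "g x"] by simp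
    then have ne: "1 - g x \<noteq> 0" by auto
    then have "1 / (1 - g x) - (\<Sum>k<n. g x ^ k) = g x ^ n / (1 - g x)"
      using geometric_sum[of "g x" n] by (simp add: field_simps)
    then have "norm (1 / (1 - g x) - (\<Sum>k<n. g x ^ k)) = norm (g x) ^ n / norm (1 - g x)"
      by (simp add: norm_divide norm_power)
    also have "\<dots> \<le> (1 / 2) ^ n / (1 / 2)"
      using g(2)[of x] g1 by (intro frac_le power_mono) auto
    also have "\<dots> \<le> e / 2" using n by simp
    finally show ?thesis
      using p[of x] norm_triangle_ineq[of "1 / (1 - g x) - (\<Sum>k<n. g x ^ k)" "(\<Sum>k<n. g x ^ k) - poly p (w x)"]
      by simp
  qed
  then show "\<exists>p. \<forall>x. norm (1 / (1 - g x) - poly p (w x)) \<le> e" by blast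
qed

lemma poly_approx_q: "poly_approx (\<lambda>x. q x s)"
  using poly_approx_poly[of "[:0, 1 / w s:]"] by (simp add: q_def)

text \<open>The pole is pushed from a neighbourhood of infinity towards the curve along a ray; the distance
  bound for \<open>q\<close> makes each step reduce \<open>r - 1\<close> by a fixed factor.\<close>

lemma poly_approx_resolvent:
  assumes "r > 1"
  shows "poly_approx (\<lambda>x. 1 / (q x s - of_real r))"
proof -
  obtain c where c: "0 < c" "c \<le> 1" "\<And>r x s. r > 1 \<Longrightarrow> c * (r - 1) \<le> norm (q x s - of_real r)"
    using q_lower_bound_global by metis
  obtain B where B: "B \<ge> 1" "\<And>x s. norm (q x s) \<le> B" using q_bounded by metis
  \<comment> \<open>For r \<ge> 2 B the ratio q / r has norm at most 1 / 2, so the series converges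
    directly; this is the base of the induction.\<close>
  define R where "R = 2 * B"
  have "poly_approx (\<lambda>x. 1 / (q x s - of_real r))" if "r > 1" "(1 - c / 2) ^ n * (R - 1) \<le> r - 1" for r n
    using that
  proof (induction n arbitrary: r)
    case 0
    then have r: "2 * B \<le> r" by (simp add: R_def)
    have "poly_approx (\<lambda>x. q x s * (1 / of_real r))"
      by (rule poly_approx_mult[OF poly_approx_q B(2) poly_approx_const order.refl])
    moreover have "norm (q x s * (1 / of_real r)) \<le> 1 / 2" for x
    proof -
      have "norm (q x s * (1 / of_real r)) = norm (q x s) / r" using 0(1) by (simp add: norm_divide)
      also have "\<dots> \<le> B / (2 * B)" using r B(1) B(2)[of x s] 0(1) by (intro frac_le) auto
      finally show ?thesis using B(1) by simp
    qed
    ultimately have geo: "poly_approx (\<lambda>x. 1 / (1 - q x s * (1 / of_real r)))"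
      by (rule poly_approx_geometric)
    have bd: "norm (1 / (1 - q x s * (1 / of_real r))) \<le> r / (c * (r - 1))" for x
    proof -
      have "1 / (1 - q x s * (1 / of_real r)) = - of_real r / (q x s - of_real r)"
        using 0(1) q_ne[OF 0(1), of x s] by (simp add: divide_simps) (simp add: algebra_simps)
      then have "norm (1 / (1 - q x s * (1 / of_real r))) = r / norm (q x s - of_real r)"
        using 0(1) by (simp add: norm_divide)
      also have "\<dots> \<le> r / (c * (r - 1))"
        using c 0(1) by (intro divide_left_mono mult_pos_pos) (use q_ne[OF 0(1), of x s] in auto)
      finally show ?thesis .
    qed
    have eq: "1 / (q x s - of_real r) = - (1 / of_real r) * (1 / (1 - q x s * (1 / of_real r)))" for x
      using 0(1) q_ne[OF 0(1), of x s] by (simp add: divide_simps)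
    show ?case unfolding eq
      by (rule poly_approx_mult[OF poly_approx_const order.refl geo bd])
  next
    case (Suc n)
    \<comment> \<open>The previous pole, with r - 1 = (1 - c / 2) (t - 1). The displacement t - r =
      (c / 2) (t - 1) is half of the guaranteed distance c (t - 1) from t to the values of q, so the
      expansion around t has ratio at most 1 / 2.\<close>
    define t where "t = 1 + (r - 1) / (1 - c / 2)"
    have c': "1 - c / 2 > 0" using c by simp
    have t: "t > 1" using Suc.prems(1) c' by (simp add: t_def)
    have rt: "r - 1 = (1 - c / 2) * (t - 1)" using c' by (simp add: t_def)
    have "(1 - c / 2) * ((1 - c / 2) ^ n * (R - 1)) \<le> (1 - c / 2) * (t - 1)"
      using Suc.prems(2) rt by (simp add: mult_ac)
    then have "(1 - c / 2) ^ n * (R - 1) \<le> t - 1" using c' by simp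
    from Suc.IH[OF t this] have IH: "poly_approx (\<lambda>x. 1 / (q x s - of_real t))" .
    have bd: "norm (1 / (q x s - of_real t)) \<le> 1 / (c * (t - 1))" for x
    proof -
      have "0 < c * (t - 1)" using c t by simp
      then show ?thesis using c(3)[OF t, of x s] by (simp add: norm_divide frac_le)
    qed
    let ?g = "\<lambda>x. of_real (r - t) * (1 / (q x s - of_real t))"
    have g: "poly_approx ?g"
      by (rule poly_approx_mult[OF poly_approx_const order.refl IH bd])
    have g_bd: "norm (?g x) \<le> 1 / 2" for x
    proof -
      have "t - r = (c / 2) * (t - 1)" using rt by (simp only: left_diff_distrib[of 1 "c / 2"]) simp
      moreover have "0 < (c / 2) * (t - 1)" using c t by simp
      ultimately have "norm (complex_of_real (r - t)) = (c / 2) * (t - 1)"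
        unfolding norm_of_real by linarith
      then have "norm (?g x) = (c / 2) * (t - 1) * norm (1 / (q x s - of_real t))"
        by (simp only: norm_mult)
      also have "\<dots> \<le> (c / 2) * (t - 1) * (1 / (c * (t - 1)))"
        using c t by (intro mult_left_mono bd) auto
      also have "\<dots> = 1 / 2" using c t by simp
      finally show ?thesis .
    qed
    have geo: "poly_approx (\<lambda>x. 1 / (1 - ?g x))"
      by (rule poly_approx_geometric[OF g g_bd])
    have geo_bd: "norm (1 / (1 - ?g x)) \<le> 2" for x
    proof -
      have "1 / 2 \<le> norm (1 - ?g x)" using g_bd[of x] norm_triangle_ineq2[of 1 "?g x"] by simp
      then have "1 / norm (1 - ?g x) \<le> 1 / (1 / 2)" by (intro frac_le) auto
      then show ?thesis by (simp add: norm_divide)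
    qed
    have eq: "1 / (q x s - of_real r) = 1 / (q x s - of_real t) * (1 / (1 - ?g x))" for x
    proof -
      have ne: "q x s - of_real t \<noteq> 0" using q_ne[OF t] by simp
      have "(q x s - of_real t) * (1 - ?g x) = q x s - of_real r"
        using ne by (simp add: algebra_simps divide_simps)
      then show ?thesis by (metis divide_divide_eq_left mult.right_neutral times_divide_eq_right)
    qed
    show ?case unfolding eq
      by (rule poly_approx_mult[OF IH bd geo geo_bd])
  qed
  moreover obtain n where "(1 - c / 2) ^ n * (R - 1) \<le> r - 1"
  proof -
    have R: "R - 1 > 0" using B by (simp add: R_def)
    then obtain n where "(1 - c / 2) ^ n < (r - 1) / (R - 1)"
      using real_arch_pow_inv[of "(r - 1) / (R - 1)" "1 - c / 2"] c assms by auto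
    then show ?thesis using R that[of n] by (simp add: field_simps)
  qed
  ultimately show ?thesis using assms by blast
qed

lemma integral_poly_approx_eq_0:
  assumes F: "integrable circ F" and moments: "\<And>k. (LINT x|circ. F x * w x ^ k) = 0"
    and g: "poly_approx g" "g \<in> borel_measurable circ" "\<And>x. norm (g x) \<le> B"
  shows "(LINT x|circ. F x * g x) = 0"
proof -
  obtain W where W: "W > 0" "\<And>x. norm (w x) \<le> W" using w_bounded by metis
  have intw: "integrable circ (\<lambda>x. F x * w x ^ k)" for k
    by (rule integrable_bounded_mult[OF F, of _ "W ^ k"]) (use W in \<open>auto simp: norm_power intro!: power_mono\<close>)
  have p_eq: "F x * poly p (w x) = (\<Sum>i\<le>degree p. coeff p i * (F x * w x ^ i))" for p x
    by (simp add: poly_altdef sum_distrib_left mult_ac)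
  have intp: "integrable circ (\<lambda>x. F x * poly p (w x))" for p
    unfolding p_eq using intw by auto
  have p0: "(LINT x|circ. F x * poly p (w x)) = 0" for p
    unfolding p_eq using intw by (subst Bochner_Integration.integral_sum) (auto simp: moments)
  have intg: "integrable circ (\<lambda>x. F x * g x)"
    by (rule integrable_bounded_mult[OF F g(2,3)])
  let ?N = "LINT x|circ. norm (F x)"
  have "?N \<ge> 0" by simp
  then have N: "?N + 1 > 0" by linarith
  have "norm (LINT x|circ. F x * g x) \<le> e" if "e > 0" for e
  proof -
    have "e / (?N + 1) > 0" using that N by (rule divide_pos_pos)
    then obtain p where p: "\<And>x. norm (g x - poly p (w x)) \<le> e / (?N + 1)"
      using g(1) unfolding poly_approx_def by blast
    have "(LINT x|circ. F x * g x) = (LINT x|circ. F x * g x - F x * poly p (w x))"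
      using intg intp by (simp add: p0)
    also have "norm \<dots> \<le> (LINT x|circ. e / (?N + 1) * norm (F x))"
    proof (rule Bochner_Integration.integral_norm_bound_integral)
      show "integrable circ (\<lambda>x. F x * g x - F x * poly p (w x))" using intg intp by auto
      show "norm (F x * g x - F x * poly p (w x)) \<le> e / (?N + 1) * norm (F x)" for x
        unfolding right_diff_distrib[symmetric] norm_mult
        using mult_left_mono[OF p[of x], of "norm (F x)"] by (simp add: mult.commute)
    qed (use F in auto)
    also have "\<dots> = e * (?N / (?N + 1))" by simp
    also have "\<dots> \<le> e * 1" using that N by (intro mult_left_mono) (auto simp: divide_le_eq_1)
    finally show ?thesis by simp
  qed
  then have "norm (LINT x|circ. F x * g x) \<le> 0" by (rule field_le_epsilon) simp
  then show ?thesis by simp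
qed

lemma integral_K_eq_0:
  assumes F: "integrable circ F" and moments: "\<And>k. (LINT x|circ. F x * w x ^ k) = 0"
    and r: "r > 1"
  shows "(LINT x|circ. F x * K r x s) = 0"
proof -
  obtain c where c: "0 < c" "\<And>r x s. r > 1 \<Longrightarrow> c * (r - 1) \<le> norm (q x s - of_real r)"
    using q_lower_bound_global by metis
  have bd: "norm (1 / (q x s - of_real r)) \<le> 1 / (c * (r - 1))" for x
  proof -
    have "0 < c * (r - 1)" using c r by simp
    then show ?thesis using c(2)[OF r, of x s] by (simp add: norm_divide frac_le)
  qed
  have K_eq: "K r x s = 1 + of_real (2 * r) * (1 / (q x s - of_real r))" for x
    using q_ne[OF r, of x s] by (simp add: K_def field_simps)
  have "poly_approx (\<lambda>x. K r x s)"
    unfolding K_eq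
    by (rule poly_approx_add[OF poly_approx_const
          poly_approx_mult[OF poly_approx_const order.refl poly_approx_resolvent[OF r] bd]])
  moreover have "(\<lambda>x. K r x s) \<in> borel_measurable circ"
    unfolding K_def q_def by measurable
  moreover obtain B where "\<And>x s. norm (K r x s) \<le> B" using K_bounded[OF r] by metis
  ultimately show ?thesis by (intro integral_poly_approx_eq_0[OF F moments])
qed

end

subsection \<open>Weak derivatives on the circle\<close>

lemma set_lebesgue_integral_circ:
  fixes f :: "real \<Rightarrow> 'a::{banach, second_countable_topology}"
  shows "(LINT x:{0..2 * pi}|lborel. f x) = (LINT x|circ. f x)"
  by (simp add: integral_restrict_space set_lebesgue_integral_def)

lemma L2_torus_circ:
  assumes "L2_torus f"
  shows "f \<in> borel_measurable circ" "integrable circ (\<lambda>x. (f x)\<^sup>2)" "integrable circ f"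
proof -
  show m: "f \<in> borel_measurable circ"
    using assms by (simp add: L2_torus_def L2_on_def set_borel_measurable_def borel_measurable_restrict_space_iff)
  show i: "integrable circ (\<lambda>x. (f x)\<^sup>2)"
    using assms by (simp add: L2_torus_def L2_on_def set_integrable_def integrable_restrict_space)
  interpret finite_measure circ by (rule finite_measure_circ)
  show "integrable circ f"
    using i m square_integrable_imp_integrable by blast
qed

lemma integrable_circ_mult_continuous:
  fixes f c :: "real \<Rightarrow> real"
  assumes f: "integrable circ f" and c: "continuous_on UNIV c"
  shows "integrable circ (\<lambda>x. f x * c x)"
proof -
  have "compact (c ` {0..2 * pi})"
    by (intro compact_continuous_image continuous_on_subset[OF c]) auto
  then obtain B where "\<And>x. x \<in> {0..2 * pi} \<Longrightarrow> norm (c x) \<le> B"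
    using compact_imp_bounded bounded_iff by (metis imageI)
  then show ?thesis
    by (intro integrable_bounded_mult[OF f] measurable_circ borel_measurable_continuous_onI c) auto
qed

text \<open>On a finite measure space L2 convergence implies L1 convergence. In place of
  Cauchy-Schwarz the proof integrates |v| \<le> d + v^2 / d, which works directly with nonnegative
  integrals.\<close>

lemma tendsto_integral_L2:
  fixes g :: "nat \<Rightarrow> 'a \<Rightarrow> real"
  assumes "finite_measure M" and [measurable]: "\<And>n. g n \<in> borel_measurable M" "k \<in> borel_measurable M"
    and lim: "(\<lambda>n. \<integral>\<^sup>+x. ennreal ((g n x)\<^sup>2) \<partial>M) \<longlonglongrightarrow> 0"
    and k: "\<And>x. x \<in> space M \<Longrightarrow> \<bar>k x\<bar> \<le> C"
  shows "(\<lambda>n. LINT x|M. g n x * k x) \<longlonglongrightarrow> 0"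
proof (rule LIMSEQ_I)
  interpret finite_measure M by fact
  fix e :: real assume "e > 0"
  define m where "m = measure M (space M)"
  define D where "D = \<bar>C\<bar> + 1"
  \<comment> \<open>Makes the constant part D d m at most e / 2; the threshold d e / (4 D) brings
    the quadratic part to e / 4.\<close>
  define d where "d = e / (2 * D * (m + 1))"
  have m: "m \<ge> 0" "D > 0" by (auto simp: m_def D_def)
  have d: "d > 0" using \<open>e > 0\<close> m unfolding d_def by (intro divide_pos_pos mult_pos_pos) auto
  have "\<forall>\<^sub>F n in sequentially. (\<integral>\<^sup>+x. ennreal ((g n x)\<^sup>2) \<partial>M) < ennreal (d * e / (4 * D))"
    using lim \<open>e > 0\<close> d m by (intro order_tendstoD(2)) auto
  then obtain n0 where n0: "\<And>n. n \<ge> n0 \<Longrightarrow> (\<integral>\<^sup>+x. ennreal ((g n x)\<^sup>2) \<partial>M) < ennreal (d * e / (4 * D))"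
    by (auto simp: eventually_sequentially)
  have "norm (LINT x|M. g n x * k x) < e" if n: "n \<ge> n0" for n
  proof (cases "integrable M (\<lambda>x. g n x * k x)")
    case True
    have young: "\<bar>v\<bar> \<le> d + v\<^sup>2 / d" for v :: real
    proof (cases "\<bar>v\<bar> \<le> d")
      case True
      moreover have "0 \<le> v\<^sup>2 / d" using d by simp
      ultimately show ?thesis by linarith
    next
      case False
      then have "d * \<bar>v\<bar> \<le> v\<^sup>2" using d mult_right_mono[of d "\<bar>v\<bar>" "\<bar>v\<bar>"] by (simp add: power2_eq_square abs_mult[symmetric])
      then have "\<bar>v\<bar> \<le> v\<^sup>2 / d" using d by (simp add: field_simps)
      then show ?thesis using d by simp
    qed
    have "ennreal (norm (LINT x|M. g n x * k x)) \<le> (\<integral>\<^sup>+x. ennreal (norm (g n x * k x)) \<partial>M)"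
      by (rule integral_norm_bound_ennreal[OF True])
    also have "\<dots> \<le> (\<integral>\<^sup>+x. ennreal (D * d) + ennreal (D / d) * ennreal ((g n x)\<^sup>2) \<partial>M)"
    proof (intro nn_integral_mono)
      fix x assume "x \<in> space M"
      then have "norm (g n x * k x) \<le> D * \<bar>g n x\<bar>"
        using mult_right_mono[of "\<bar>k x\<bar>" D "\<bar>g n x\<bar>"] k[of x] by (simp add: D_def abs_mult mult.commute)
      also have "\<dots> \<le> D * (d + (g n x)\<^sup>2 / d)" using m by (intro mult_left_mono young) auto
      also have "\<dots> = D * d + D / d * (g n x)\<^sup>2" by (simp add: distrib_left)
      finally have "ennreal (norm (g n x * k x)) \<le> ennreal (D * d + D / d * (g n x)\<^sup>2)" by (rule ennreal_leI)
      also have "\<dots> = ennreal (D * d) + ennreal (D / d) * ennreal ((g n x)\<^sup>2)"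
        using m d by (subst ennreal_plus) (auto simp: ennreal_mult' simp del: times_divide_eq_left)
      finally show "ennreal (norm (g n x * k x)) \<le> ennreal (D * d) + ennreal (D / d) * ennreal ((g n x)\<^sup>2)" .
    qed
    also have "\<dots> = ennreal (D * d) * ennreal m + ennreal (D / d) * (\<integral>\<^sup>+x. ennreal ((g n x)\<^sup>2) \<partial>M)"
      by (subst nn_integral_add) (auto simp: nn_integral_cmult emeasure_eq_measure m_def)
    also have "\<dots> \<le> ennreal (D * d) * ennreal m + ennreal (D / d) * ennreal (d * e / (4 * D))"
      using n0[OF n] by (intro add_left_mono mult_left_mono) auto
    also have "\<dots> = ennreal (D * d * m + D / d * (d * e / (4 * D)))"
    proof -
      have nn: "0 \<le> D * d" "0 \<le> D / d" "0 \<le> d * e / (4 * D)" using m d \<open>e > 0\<close> by auto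
      show ?thesis
        by (simp only: ennreal_plus[OF mult_nonneg_nonneg[OF nn(1) m(1)] mult_nonneg_nonneg[OF nn(2,3)]]
            ennreal_mult'[OF nn(1)] ennreal_mult'[OF nn(2)])
    qed
    finally have le: "norm (LINT x|M. g n x * k x) \<le> D * d * m + D / d * (d * e / (4 * D))"
      using m d \<open>e > 0\<close> by (subst (asm) ennreal_le_iff) auto
    have "D / d * (d * e / (4 * D)) = e / 4" using m d by simp
    then have "norm (LINT x|M. g n x * k x) \<le> D * d * m + e / 4" using le by (simp only:)
    moreover have "D * d * m \<le> e / 2"
    proof -
      have "D * d * m = e / 2 * (m / (m + 1))" using m by (simp add: d_def)
      also have "\<dots> \<le> e / 2 * 1" using m \<open>e > 0\<close> by (intro mult_left_mono) (auto simp: divide_le_eq_1)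
      finally show ?thesis by simp
    qed
    ultimately show ?thesis using \<open>e > 0\<close> by simp
  \<comment> \<open>A product that fails to be integrable has Bochner integral 0 by
    convention.\<close>
  qed (use \<open>e > 0\<close> in \<open>simp add: not_integrable_integral_eq\<close>)
  then show "\<exists>no. \<forall>n\<ge>no. norm ((LINT x|M. g n x * k x) - 0) < e" by auto
qed

section \<open>Trigonometric approximation and C1 test functions\<close>

lemma smooth_sin_cos: "smooth (sin :: real \<Rightarrow> real)" "smooth (cos :: real \<Rightarrow> real)"
proof -
  let ?A = "range (\<lambda>(a, b) x. a * sin x + b * cos x :: real)"
  have "\<exists>f'\<in>?A. \<forall>x. (f has_real_derivative f' x) (at x)" if "f \<in> ?A" for f
  proof -
    from that obtain a b where f: "f = (\<lambda>x. a * sin x + b * cos x)" by auto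
    have "\<forall>x. (f has_real_derivative - b * sin x + a * cos x) (at x)"
      unfolding f by (auto intro!: derivative_eq_intros)
    then show ?thesis by (intro bexI[of _ "\<lambda>x. - b * sin x + a * cos x"]) (auto intro: image_eqI[of _ _ "(- b, a)"])
  qed
  note * = smooth_realI[OF _ this]
  show "smooth (sin :: real \<Rightarrow> real)" by (rule *) (auto intro!: image_eqI[of _ _ "(1, 0)"])
  show "smooth (cos :: real \<Rightarrow> real)" by (rule *) (auto intro!: image_eqI[of _ _ "(0, 1)"])
qed

text \<open>Stone-Weierstrass on the unit circle: a real polynomial in cos x and sin x is smooth and
  periodic by construction.\<close>

lemma smooth_approx_periodic:
  assumes per: "periodic_fun f" and cont: "continuous_on UNIV f" and "e > 0"
  obtains g where "smooth g" "periodic_fun g" "\<And>x. \<bar>f x - g x\<bar> < e"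
proof -
  define F where "F = (\<lambda>z. f (Arg2pi z))"
  have per': "f (x + 2 * pi) = f x" for x using per by (simp add: periodic_fun_def)
  have F_cis: "F (cis x) = f x" for x
  proof -
    obtain n :: int where n: "0 \<le> x + 2 * pi * of_int n" "x + 2 * pi * of_int n < 0 + 2 * pi"
      by (rule shift_into_period)
    have "cis (x + 2 * pi * of_int n) = cis x"
      by (rule periodic_int_shift[of cis]) (simp add: cis.ctr)
    then have "Arg2pi (cis x) = x + 2 * pi * of_int n"
      using n by (intro Arg2pi_unique[of 1]) (auto simp: cis_conv_exp)
    then show ?thesis using periodic_int_shift[of f, OF per'] by (simp add: F_def)
  qed
  have F_Arg: "F z = f (Arg z)" if "z \<in> sphere 0 1" for z
  proof -
    have "z = cis (Arg z)" using that by (metis cis_Arg mem_sphere_0 norm_zero sgn_div_norm zero_neq_one inverse_1 scaleR_one)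
    then show ?thesis using F_cis by metis
  qed
  have isCont_f: "isCont f x" for x using cont by (simp add: continuous_on_eq_continuous_at)
  have "continuous_on (sphere 0 1) F"
    unfolding continuous_on_eq_continuous_within
  proof
    fix z :: complex assume z: "z \<in> sphere 0 1"
    show "continuous (at z within sphere 0 1) F"
    proof (cases "z \<in> \<real>\<^sub>\<ge>\<^sub>0")
      case False
      then have "isCont (f \<circ> Arg2pi) z"
        by (intro continuous_at_compose continuous_at_Arg2pi isCont_f)
      then show ?thesis unfolding F_def o_def by (rule continuous_at_imp_continuous_within)
    next
      \<comment> \<open>\<open>Arg2pi\<close> jumps across the positive real axis. There F is read
        through \<open>Arg\<close>, whose cut is the negative axis; periodicity of f makes the two
        descriptions agree.\<close>
      case True
      then have "z \<notin> \<real>\<^sub>\<le>\<^sub>0" using z by (auto simp: complex_nonneg_Reals_iff complex_nonpos_Reals_iff complex_eq_iff norm_complex_def)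
      then have "isCont (f \<circ> Arg) z"
        by (intro continuous_at_compose continuous_at_Arg isCont_f)
      then have "continuous (at z within sphere 0 1) (\<lambda>z. f (Arg z))"
        unfolding o_def by (rule continuous_at_imp_continuous_within)
      then show ?thesis
        by (rule continuous_transform_within[OF _ zero_less_one z]) (simp add: F_Arg)
    qed
  qed
  then obtain p where p: "real_polynomial_function p" "\<And>z. z \<in> sphere 0 1 \<Longrightarrow> \<bar>F z - p z\<bar> < e"
    using Stone_Weierstrass_real_polynomial_function[of "sphere 0 1 :: complex set" F e] \<open>e > 0\<close> by auto
  have "smooth (\<lambda>x. p (cis x))"
    using p(1)
  proof (induction rule: real_polynomial_function.induct)
    case (linear L)
    have "L (cis x) = cos x * L 1 + sin x * L \<i>" for x
    proof -
      have "cis x = cos x *\<^sub>R 1 + sin x *\<^sub>R \<i>" by (simp add: complex_eq_iff)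
      then show ?thesis using linear by (simp add: linear_simps(1,5))
    qed
    then show ?case by (simp add: smooth_add smooth_mult smooth_sin_cos)
  qed (auto intro: smooth_add smooth_mult)
  moreover have "periodic_fun (\<lambda>x. p (cis x))" by (simp add: periodic_fun_def cis.ctr)
  moreover have "\<bar>f x - p (cis x)\<bar> < e" for x using p(2)[of "cis x"] by (simp add: F_cis)
  ultimately show ?thesis by (rule that)
qed

text \<open>The restriction of a smooth function to the graph of a C1 function is in general only
  C1, so weak derivatives must be tested against C1 functions. The derivative g' is approximated
  uniformly by a smooth periodic function, and a primitive of that one is corrected to be
  periodic.\<close>

lemma weak_derivative_C1:
  assumes H1: "H1_torus f f'" and per: "periodic_fun g"
    and der: "\<And>x. (g has_real_derivative g' x) (at x)" and cont: "continuous_on UNIV g'"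
  shows "(LINT x|circ. f x * g' x) = - (LINT x|circ. f' x * g x)"
proof -
  have f: "f \<in> borel_measurable circ" "integrable circ f" "f' \<in> borel_measurable circ" "integrable circ f'"
    using H1 L2_torus_circ by (auto simp: H1_torus_def)
  have test: "(LINT x|circ. f x * deriv \<theta> x) = - (LINT x|circ. f' x * \<theta> x)"
    if "smooth \<theta>" "periodic_fun \<theta>" for \<theta>
    using H1 that by (simp add: H1_torus_def set_lebesgue_integral_circ)
  have per': "g (x + 2 * pi) = g x" for x using per by (simp add: periodic_fun_def)
  have g'_per: "periodic_fun g'"
    using derivative_periodic[OF per' der] by (simp add: periodic_fun_def)
  have g_cont: "continuous_on UNIV g"
    using der by (meson DERIV_isCont continuous_at_imp_continuous_on)
  note int = integrable_circ_mult_continuous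
  define N where "N = (LINT x|circ. norm (f x)) + 2 * pi * (LINT x|circ. norm (f' x))"
  have bound: "\<bar>(LINT x|circ. f x * g' x) + (LINT x|circ. f' x * g x)\<bar> \<le> 2 * e * N" if "e > 0" for e
  proof -
    obtain t where t: "smooth t" "periodic_fun t" "\<And>x. \<bar>g' x - t x\<bar> < e"
      using smooth_approx_periodic[OF g'_per cont \<open>e > 0\<close>] by blast
    have t_cont: "continuous_on UNIV t" by (rule smooth_continuous[OF t(1)])
    have t_per: "t (x + 2 * pi) = t x" for x using t(2) by (simp add: periodic_fun_def)
    have "\<exists>F. \<forall>x::real. - \<infinity> < ereal x \<longrightarrow> ereal x < \<infinity> \<longrightarrow> (F has_vector_derivative t x) (at x)"
      by (rule einterval_antiderivative) (use t_cont in \<open>auto simp: continuous_on_eq_continuous_at\<close>)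
    then obtain T where T: "\<And>x. (T has_real_derivative t x) (at x)"
      by (auto simp: has_real_derivative_iff_has_vector_derivative)
    have T_close: "\<bar>(g y - T y) - (g x - T x)\<bar> \<le> e * \<bar>y - x\<bar>" for x y
    proof -
      have "norm ((\<lambda>x. g x - T x) y - (\<lambda>x. g x - T x) x) \<le> e * norm (y - x)"
        by (rule field_differentiable_bound[of UNIV _ "\<lambda>x. g' x - t x"])
          (use t(3) in \<open>auto intro!: DERIV_diff has_field_derivative_at_within[OF der] has_field_derivative_at_within[OF T] less_imp_le\<close>)
      then show ?thesis by simp
    qed
    \<comment> \<open>The mean of t. Subtracting it makes the primitive periodic, and its size is at
      most e because g' has mean 0.\<close>
    define m where "m = (T (2 * pi) - T 0) / (2 * pi)"
    have m: "\<bar>m\<bar> \<le> e"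
    proof -
      have "\<bar>T (2 * pi) - T 0\<bar> \<le> e * (2 * pi)" using T_close[of "2 * pi" 0] per'[of 0] by simp
      then show ?thesis by (simp add: m_def abs_divide pos_divide_le_eq)
    qed
    have T_shift: "T (x + 2 * pi) - T x = 2 * pi * m" for x
    proof -
      have "((\<lambda>x. T (x + 2 * pi) - T x) has_real_derivative t (x + 2 * pi) - t x) (at x)" for x
        using DERIV_shift[of T "t (x + 2 * pi)" x "2 * pi"] T by (intro DERIV_diff) auto
      then have "\<forall>x. ((\<lambda>x. T (x + 2 * pi) - T x) has_real_derivative 0) (at x)" by (simp add: t_per)
      from DERIV_isconst_all[OF this, of x 0] show ?thesis by (simp add: m_def)
    qed
    \<comment> \<open>Normalised to agree with g at 0, so that closeness of the derivatives passes
      to the functions over one period.\<close>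
    define \<theta> where "\<theta> = (\<lambda>x. T x + (- m * x + (g 0 - T 0)))"
    have \<theta>: "(\<theta> has_real_derivative t x + - m) (at x)" for x
      unfolding \<theta>_def by (auto intro!: derivative_eq_intros T)
    have "smooth \<theta>"
      by (rule smooth_real_primitive[OF \<theta>]) (intro smooth_add t smooth_const)
    moreover have "periodic_fun \<theta>"
      using T_shift unfolding periodic_fun_def \<theta>_def by (simp add: algebra_simps)
    moreover have "deriv \<theta> x = t x + - m" for x by (rule DERIV_imp_deriv[OF \<theta>])
    ultimately have weak: "(LINT x|circ. f x * (t x + - m)) = - (LINT x|circ. f' x * \<theta> x)"
      using test[of \<theta>] by simp
    have \<theta>_cont: "continuous_on UNIV \<theta>"
      using \<theta> by (meson DERIV_isCont continuous_at_imp_continuous_on)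
    have c1: "\<bar>g' x - (t x + - m)\<bar> \<le> 2 * e" for x
      using t(3)[of x] m by linarith
    have c2: "\<bar>g x - \<theta> x\<bar> \<le> 2 * e * (2 * pi)" if "x \<in> {0..2 * pi}" for x
    proof -
      have "\<bar>g x - \<theta> x\<bar> \<le> \<bar>(g x - T x) - (g 0 - T 0)\<bar> + \<bar>m\<bar> * \<bar>x\<bar>"
        by (simp add: \<theta>_def algebra_simps flip: abs_mult)
      also have "\<dots> \<le> e * \<bar>x - 0\<bar> + e * \<bar>x\<bar>"
        by (intro add_mono T_close mult_right_mono m) auto
      also have "\<dots> \<le> 2 * e * (2 * pi)" using that \<open>e > 0\<close> by simp
      finally show ?thesis .
    qed
    have i1: "integrable circ (\<lambda>x. f x * (g' x - (t x + - m)))" "integrable circ (\<lambda>x. f' x * (g x - \<theta> x))"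
      by (intro int f continuous_intros cont t_cont g_cont \<theta>_cont)+
    have split: "(LINT x|circ. f x * g' x) + (LINT x|circ. f' x * g x)
        = (LINT x|circ. f x * (g' x - (t x + - m))) + (LINT x|circ. f' x * (g x - \<theta> x))"
      unfolding right_diff_distrib
      by (subst (1 2) Bochner_Integration.integral_diff)
        (auto intro!: int f continuous_intros cont t_cont g_cont \<theta>_cont simp: weak[simplified])
    have "\<bar>(LINT x|circ. f x * g' x) + (LINT x|circ. f' x * g x)\<bar>
        \<le> \<bar>LINT x|circ. f x * (g' x - (t x + - m))\<bar> + \<bar>LINT x|circ. f' x * (g x - \<theta> x)\<bar>"
      unfolding split by (rule abs_triangle_ineq)
    also have "\<dots> \<le> (LINT x|circ. 2 * e * norm (f x)) + (LINT x|circ. 2 * e * (2 * pi) * norm (f' x))"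
    proof (rule add_mono)
      show "\<bar>LINT x|circ. f x * (g' x - (t x + - m))\<bar> \<le> (LINT x|circ. 2 * e * norm (f x))"
      proof (rule Bochner_Integration.integral_abs_bound_integral[OF i1(1)])
        show "integrable circ (\<lambda>x. 2 * e * norm (f x))"
          using f(2) by simp
        show "\<bar>f x * (g' x - (t x + - m))\<bar> \<le> 2 * e * norm (f x)" for x
          using mult_left_mono[OF c1[of x] abs_ge_zero[of "f x"]]
          unfolding abs_mult real_norm_def by (simp only: mult_ac)
      qed
      show "\<bar>LINT x|circ. f' x * (g x - \<theta> x)\<bar> \<le> (LINT x|circ. 2 * e * (2 * pi) * norm (f' x))"
      proof (rule Bochner_Integration.integral_abs_bound_integral[OF i1(2)])
        show "integrable circ (\<lambda>x. 2 * e * (2 * pi) * norm (f' x))"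
          using f(4) by simp
        show "\<bar>f' x * (g x - \<theta> x)\<bar> \<le> 2 * e * (2 * pi) * norm (f' x)" if "x \<in> space circ" for x
          using mult_left_mono[OF c2[OF that[unfolded space_circ]] abs_ge_zero[of "f' x"]]
          unfolding abs_mult real_norm_def by (simp only: mult_ac)
      qed
    qed
    also have "\<dots> = 2 * e * N" by (simp add: N_def algebra_simps)
    finally show ?thesis .
  qed
  have "N \<ge> 0" unfolding N_def by (intro add_nonneg_nonneg mult_nonneg_nonneg Bochner_Integration.integral_nonneg) auto
  have "\<bar>(LINT x|circ. f x * g' x) + (LINT x|circ. f' x * g x)\<bar> \<le> 0"
  proof (rule field_le_epsilon)
    fix e :: real assume "e > 0"
    then have "e / (2 * (N + 1)) > 0" using \<open>N \<ge> 0\<close> by simp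
    from bound[OF this] have "\<bar>(LINT x|circ. f x * g' x) + (LINT x|circ. f' x * g x)\<bar> \<le> 2 * (e / (2 * (N + 1))) * N" .
    also have "\<dots> = e * (N / (N + 1))" using \<open>N \<ge> 0\<close> by (simp add: field_simps)
    also have "\<dots> \<le> e * 1" using \<open>N \<ge> 0\<close> \<open>e > 0\<close> by (intro mult_left_mono) (auto simp: divide_le_eq_1)
    finally show "\<bar>(LINT x|circ. f x * g' x) + (LINT x|circ. f' x * g x)\<bar> \<le> 0 + e" by simp
  qed
  then show ?thesis by simp
qed

subsection \<open>Integration over the fluid domain\<close>

lemma integral_FTC_restrict_space:
  fixes f :: "real \<Rightarrow> real"
  assumes "a \<le> b" "\<And>x. (F has_real_derivative f x) (at x)" "continuous_on UNIV f"
  shows "(LINT x|restrict_space lborel {a..b}. f x) = F b - F a"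
proof -
  have "(\<integral>x. indicator {a..b} x *\<^sub>R f x \<partial>lborel) = F b - F a"
  proof (rule integral_FTC_Icc[OF assms(1)])
    show "(F has_vector_derivative f x) (at x within {a..b})" for x
      using assms(2)[of x] unfolding has_real_derivative_iff_has_vector_derivative
      by (rule has_vector_derivative_at_within)
    show "continuous_on {a..b} f" using assms(3) by (rule continuous_on_subset) simp
  qed
  then show ?thesis by (simp add: integral_restrict_space)
qed

lemma integrable_continuous_rectangle:
  fixes f :: "real \<times> real \<Rightarrow> real"
  assumes f: "continuous_on UNIV f"
  shows "integrable (restrict_space lborel {a..b} \<Otimes>\<^sub>M restrict_space lborel {c..d}) f"
proof -
  let ?M = "restrict_space lborel {a..b} \<Otimes>\<^sub>M restrict_space lborel {c..d}"
  interpret M: finite_measure ?M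
    by (intro finite_measure_pair_measure finite_measureI) (simp_all add: emeasure_restrict_space emeasure_lborel_Icc_eq space_restrict_space)
  have "compact (f ` ({a..b} \<times> {c..d}))"
    using f by (intro compact_continuous_image compact_Times) (auto intro: continuous_on_subset)
  then obtain B where B: "\<And>p. p \<in> {a..b} \<times> {c..d} \<Longrightarrow> norm (f p) \<le> B"
    using compact_imp_bounded bounded_iff by (metis imageI)
  have sp: "space ?M = {a..b} \<times> {c..d}" by (simp add: space_pair_measure space_restrict_space)
  have [measurable]: "fst \<in> borel_measurable ?M" "snd \<in> borel_measurable ?M"
    by (rule measurable_compose[OF measurable_fst] measurable_compose[OF measurable_snd];
        simp add: measurable_restrict_space1)+
  have "(\<lambda>p. f (fst p, snd p)) \<in> borel_measurable ?M"
    by (rule borel_measurable_continuous_Pair) (use f in auto)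
  then have "f \<in> borel_measurable ?M" by simp
  then show ?thesis
    by (intro M.integrable_const_bound[of _ B] AE_I2) (use B sp in auto)
qed

context C1_graph
begin

lemma h_measurable [measurable]: "h \<in> borel_measurable borel"
  by (rule borel_measurable_continuous_onI[OF continuous_h])

lemma fluid_cell_measurable [measurable]: "fluid_cell h \<in> sets borel"
proof -
  have [measurable]: "fst \<in> borel_measurable (borel :: (real \<times> real) measure)"
    "snd \<in> borel_measurable (borel :: (real \<times> real) measure)"
    by (intro borel_measurable_continuous_onI continuous_intros)+
  have "fluid_cell h = {p \<in> space (borel :: (real \<times> real) measure). 0 \<le> fst p \<and> fst p \<le> 2 * pi \<and> snd p < h (fst p)}"
    by (auto simp: fluid_cell_def)
  also have "\<dots> \<in> sets borel" by measurable
  finally show ?thesis .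
qed

lemma h_bounded:
  obtains H where "H > 0" "\<And>x. \<bar>h x\<bar> \<le> H"
  using periodic_bounded[of h] periodic continuous_h by (metis real_norm_def)

text \<open>The shear (x, t) -> (x, h(x) + t) preserves area and flattens the boundary. One N that
  dominates R + |h x| for all x truncates every vertical line at the same t, which leaves a
  rectangle.\<close>

lemma fluid_cell_integral:
  fixes G :: "real \<times> real \<Rightarrow> real"
  assumes G: "continuous_on UNIV G" and supp: "\<And>x y. y < - R \<Longrightarrow> G (x, y) = 0"
    and N: "\<And>x. R + \<bar>h x\<bar> \<le> N"
  shows "set_integrable lborel (fluid_cell h) G" (is ?int)
    and "(LINT p:fluid_cell h|lborel. G p)
      = (LINT x|circ. LINT t|restrict_space lborel {- N..0}. G (x, h x + t))" (is ?eq)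
proof -
  obtain H where H: "H > 0" "\<And>x. \<bar>h x\<bar> \<le> H" using h_bounded by metis
  have [measurable]: "G \<in> borel_measurable borel" by (rule borel_measurable_continuous_onI[OF G])
  let ?K = "cbox (0, - R) (2 * pi, H)"
  have K: "integrable lborel (\<lambda>p. indicator ?K p *\<^sub>R G p)"
    using G by (intro borel_integrable_compact) (auto intro: continuous_on_subset)
  show int: ?int
    unfolding set_integrable_def
  proof (rule Bochner_Integration.integrable_bound[OF K])
    show "AE p in lborel. norm (indicator (fluid_cell h) p *\<^sub>R G p) \<le> norm (indicator ?K p *\<^sub>R G p)"
    proof (rule AE_I2)
      fix p :: "real \<times> real"
      obtain x y where p: "p = (x, y)" by fastforce
      show "norm (indicator (fluid_cell h) p *\<^sub>R G p) \<le> norm (indicator ?K p *\<^sub>R G p)"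
        using H(2)[of x] supp[of y x] by (cases "y < - R") (auto simp: p indicator_def fluid_cell_def abs_le_iff)
    qed
  qed measurable
  have inner: "(\<integral>y. indicator (fluid_cell h) (x, y) *\<^sub>R G (x, y) \<partial>lborel)
      = indicator {0..2 * pi} x *\<^sub>R (LINT t|restrict_space lborel {- N..0}. G (x, h x + t))" for x
  proof -
    have "(\<integral>y. indicator (fluid_cell h) (x, y) *\<^sub>R G (x, y) \<partial>lborel)
        = (\<integral>t. indicator (fluid_cell h) (x, h x + t) *\<^sub>R G (x, h x + t) \<partial>lborel)"
      using lborel_integral_real_affine[of 1 "\<lambda>y. indicator (fluid_cell h) (x, y) *\<^sub>R G (x, y)" "h x"] by simp
    also have "\<dots> = (\<integral>t. indicator {0..2 * pi} x *\<^sub>R (indicator {- N..0} t *\<^sub>R G (x, h x + t)) \<partial>lborel)"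
    proof (rule integral_cong_AE)
      \<comment> \<open>At t = 0 the two indicators differ, the cell being open along the
        graph.\<close>
      have "AE t in lborel. t \<noteq> (0::real)" by (rule AE_lborel_singleton)
      then show "AE t in lborel. indicator (fluid_cell h) (x, h x + t) *\<^sub>R G (x, h x + t)
          = indicator {0..2 * pi} x *\<^sub>R (indicator {- N..0} t *\<^sub>R G (x, h x + t))"
      proof eventually_elim
        fix t :: real assume "t \<noteq> 0"
        moreover have "G (x, h x + t) = 0" if "t < - N" using supp[of "h x + t" x] N[of x] that by simp
        ultimately show "indicator (fluid_cell h) (x, h x + t) *\<^sub>R G (x, h x + t)
          = indicator {0..2 * pi} x *\<^sub>R (indicator {- N..0} t *\<^sub>R G (x, h x + t))"
          by (cases "t < - N") (auto simp: indicator_def fluid_cell_def)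
      qed
    qed measurable
    finally show ?thesis by (simp add: integral_restrict_space)
  qed
  have "(LINT p:fluid_cell h|lborel. G p) = (\<integral>p. indicator (fluid_cell h) p *\<^sub>R G p \<partial>(lborel \<Otimes>\<^sub>M lborel))"
    by (simp add: set_lebesgue_integral_def lborel_prod)
  also have "\<dots> = (\<integral>x. (\<integral>y. indicator (fluid_cell h) (x, y) *\<^sub>R G (x, y) \<partial>lborel) \<partial>lborel)"
    using int by (intro lborel_pair.integral_fst'[symmetric]) (simp add: set_integrable_def lborel_prod)
  also have "\<dots> = (LINT x|circ. LINT t|restrict_space lborel {- N..0}. G (x, h x + t))"
    unfolding inner by (rule integral_restrict_space[symmetric]) simp
  finally show ?eq .
qed

end

section \<open>Green's identity below the graph\<close>

lemma test_fun_chain: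
  assumes "test_fun F"
  shows "(F has_derivative (\<lambda>v. Dx F p * fst v + Dy F p * snd v)) (at p)"
    and "continuous_on UNIV F" "continuous_on UNIV (Dx F)" "continuous_on UNIV (Dy F)"
proof -
  have ck: "Ck k F" for k using assms by (simp add: test_fun_def smooth_def)
  have d: "(F has_derivative frechet_derivative F (at p)) (at p)"
    by (rule Ck_Suc_has_derivative[OF ck])
  have "frechet_derivative F (at p) v = Dx F p * fst v + Dy F p * snd v" for v
  proof -
    have lin: "linear (frechet_derivative F (at p))" by (rule has_derivative_linear[OF d])
    have "v = fst v *\<^sub>R (1, 0) + snd v *\<^sub>R (0, 1)" by (simp add: prod_eq_iff)
    then have "frechet_derivative F (at p) v = frechet_derivative F (at p) (fst v *\<^sub>R (1, 0) + snd v *\<^sub>R (0, 1))"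
      by simp
    also have "\<dots> = Dx F p * fst v + Dy F p * snd v"
      unfolding Dx_def Dy_def linear_add[OF lin] linear_scale[OF lin] by simp
    finally show ?thesis .
  qed
  with d show "(F has_derivative (\<lambda>v. Dx F p * fst v + Dy F p * snd v)) (at p)"
    by (metis (no_types, lifting) ext)
  show "continuous_on UNIV F" using ck[of 0] by simp
  show "continuous_on UNIV (Dx F)" "continuous_on UNIV (Dy F)"
    using ck[of 1] unfolding Dx_def Dy_def by (simp_all add: Basis_prod_def)
qed

context C1_graph
begin

text \<open>With \<Phi> = a \<otimes> b the integrand is, up to sign, the Jacobian of (F, \<Phi>),
  and the integral of that is the boundary integral of F d\<Phi>. In sheared coordinates it is the
  t-derivative of F \<Phi>_x minus the x-derivative of F \<Phi>_t. Neither of these differentiates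
  h', which is how a C1 graph suffices.\<close>

lemma Green_identity:
  fixes F :: "real \<times> real \<Rightarrow> real" and a b :: "real \<Rightarrow> real"
  assumes F: "test_fun F" and a: "smooth a" "periodic_fun a" and b: "smooth b" "\<And>y. y < - R \<Longrightarrow> b y = 0"
    and a': "\<And>x. (a has_real_derivative a' x) (at x)" and b': "\<And>y. (b has_real_derivative b' y) (at y)"
  shows "(LINT p:fluid_cell h|lborel. Dy F p * (a' (fst p) * b (snd p)) - Dx F p * (a (fst p) * b' (snd p)))
    = (LINT x|circ. F (x, h x) * (a' x * b (h x) + a x * b' (h x) * h' x))"
proof -
  have sa': "smooth a'" and sb': "smooth b'"
    using smooth_derivative a(1) a' b(1) b' by blast+
  obtain b2 where b2: "smooth b2" "\<And>x. (b' has_real_derivative b2 x) (at x)"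
    using smooth_real_derivative[OF sb'] by auto
  have b'0: "b' y = 0" if "y < - R" for y
    using derivative_eq_0_below[OF b' b(2) that] .
  obtain H where H: "H > 0" "\<And>x. \<bar>h x\<bar> \<le> H" using h_bounded by metis
  \<comment> \<open>The added 1 puts the lower end h x - N strictly below - R, where b and b'
    vanish.\<close>
  define N where "N = \<bar>R\<bar> + H + 1"
  have N: "R + \<bar>h x\<bar> \<le> N" "h x + - N < - R" for x using H(2)[of x] by (auto simp: N_def abs_le_iff)
  have N0: "- N \<le> 0" using H(1) by (simp add: N_def)
  let ?T = "restrict_space lborel {- N..0}"

  note Fc = test_fun_chain[OF F]
  define \<gamma> where "\<gamma> = (\<lambda>p. (fst p, h (fst p) + snd p))"
  have \<gamma>: "continuous_on UNIV \<gamma>"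
    unfolding \<gamma>_def by (intro continuous_intros continuous_on_compose2[OF continuous_h[of UNIV]]) auto
  have c\<gamma>: "continuous_on UNIV (\<lambda>p. u (\<gamma> p))" if "continuous_on UNIV u" for u :: "real \<times> real \<Rightarrow> real"
    using continuous_on_compose2[OF that \<gamma>] by simp
  have cx: "continuous_on UNIV (\<lambda>p::real \<times> real. u (fst p))" if "continuous_on UNIV u" for u :: "real \<Rightarrow> real"
    using continuous_on_compose2[OF that, of UNIV fst] by (simp add: continuous_on_fst)
  have cy: "continuous_on UNIV (\<lambda>p. u (h (fst p) + snd p))" if "continuous_on UNIV u" for u :: "real \<Rightarrow> real"
  proof -
    have "continuous_on UNIV (\<lambda>p. u (snd p))"
      using continuous_on_compose2[OF that, of UNIV snd] by (simp add: continuous_on_snd)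
    from c\<gamma>[OF this] show ?thesis by (simp add: \<gamma>_def)
  qed
  note ca = cx[OF smooth_continuous[OF a(1)]] and ca' = cx[OF smooth_continuous[OF sa']]
    and cb = cy[OF smooth_continuous[OF b(1)]] and cb' = cy[OF smooth_continuous[OF sb']] and cb2 = cy[OF smooth_continuous[OF b2(1)]]
    and ch' = cx[OF cont] and cF = c\<gamma>[OF Fc(2)] and cFx = c\<gamma>[OF Fc(3)] and cFy = c\<gamma>[OF Fc(4)]
  note conts = ca ca' cb cb' cb2 ch' cF cFx cFy

  \<comment> \<open>The x-derivative of F a b' and the t-derivative of F (a' b + a b' h') in sheared
    coordinates. Their terms with undifferentiated F coincide and cancel in the difference.\<close>
  define Ax where "Ax = (\<lambda>p. (Dx F (\<gamma> p) + h' (fst p) * Dy F (\<gamma> p)) * (a (fst p) * b' (h (fst p) + snd p))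
      + F (\<gamma> p) * (a' (fst p) * b' (h (fst p) + snd p) + a (fst p) * b2 (h (fst p) + snd p) * h' (fst p)))"
  define At where "At = (\<lambda>p. Dy F (\<gamma> p) * (a' (fst p) * b (h (fst p) + snd p) + a (fst p) * b' (h (fst p) + snd p) * h' (fst p))
      + F (\<gamma> p) * (a' (fst p) * b' (h (fst p) + snd p) + a (fst p) * b2 (h (fst p) + snd p) * h' (fst p)))"
  have cAx: "continuous_on UNIV Ax" unfolding Ax_def by (intro continuous_intros conts)
  have cAt: "continuous_on UNIV At" unfolding At_def by (intro continuous_intros conts)
  have slice: "continuous_on UNIV (\<lambda>x. u (x, t))" "continuous_on UNIV (\<lambda>t. u (x, t))"
    if "continuous_on UNIV u" for u :: "real \<times> real \<Rightarrow> real" and x t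
    using continuous_on_compose2[OF that, of UNIV "\<lambda>x. (x, t)"] continuous_on_compose2[OF that, of UNIV "\<lambda>t. (x, t)"]
    by (simp_all add: continuous_on_Pair)

  have dFx: "((\<lambda>x. F (x, h x + t)) has_real_derivative Dx F (x, h x + t) + h' x * Dy F (x, h x + t)) (at x)" for x t
  proof -
    have "((\<lambda>x. (x, h x + t)) has_derivative (\<lambda>v. (v, h' x * v))) (at x)"
      using deriv[of x] unfolding has_field_derivative_def
      by (auto intro!: derivative_eq_intros)
    from has_derivative_compose[OF this Fc(1)] show ?thesis
      unfolding has_field_derivative_def
      by (rule has_derivative_eq_rhs) (simp add: fun_eq_iff algebra_simps)
  qed
  have dFt: "((\<lambda>t. F (x, h x + t)) has_real_derivative Dy F (x, h x + t)) (at t)" for x t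
  proof -
    have "((\<lambda>t. (x, h x + t)) has_derivative (\<lambda>v. (0, v))) (at t)"
      by (auto intro!: derivative_eq_intros)
    from has_derivative_compose[OF this Fc(1)] show ?thesis
      unfolding has_field_derivative_def
      by (rule has_derivative_eq_rhs) (simp add: fun_eq_iff)
  qed
  have db: "((\<lambda>x. u (h x + t)) has_real_derivative u' (h x + t) * h' x) (at x)"
    if "\<And>y. (u has_real_derivative u' y) (at y)" for u u' x t
    by (rule DERIV_chain2[OF that]) (auto intro!: derivative_eq_intros deriv)
  have dbt: "((\<lambda>t. u (h x + t)) has_real_derivative u' (h x + t)) (at t)"
    if "\<And>y. (u has_real_derivative u' y) (at y)" for u u' x t
  proof -
    have "((\<lambda>t. h x + t) has_real_derivative 1) (at t)" by (auto intro!: derivative_eq_intros)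
    from DERIV_chain2[OF that this] show ?thesis by simp
  qed

  \<comment> \<open>Exact x-derivatives integrate to 0 over a period. Exact t-derivatives leave the
    value on the graph, as the end t = - N lies below the support of b.\<close>
  have Ax0: "(LINT x|circ. Ax (x, t)) = 0" for t
  proof -
    define E where "E = (\<lambda>x. F (x, h x + t) * (a x * b' (h x + t)))"
    have "(E has_real_derivative Ax (x, t)) (at x)" for x
      unfolding E_def Ax_def \<gamma>_def
      by (rule DERIV_cong[OF DERIV_mult[OF dFx DERIV_mult[OF a' db[OF b2(2)]]]]) (simp add: algebra_simps)
    then have "(LINT x|circ. Ax (x, t)) = E (2 * pi) - E 0"
      by (intro integral_FTC_restrict_space slice(1) cAx) auto
    also have "E (2 * pi) = E 0"
      using F a(2) periodic[of 0]
      by (simp add: E_def test_fun_def x_periodic_def periodic_fun_def) (metis add_0)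
    finally show ?thesis by simp
  qed
  have At_eq: "(LINT t|?T. At (x, t)) = F (x, h x) * (a' x * b (h x) + a x * b' (h x) * h' x)" for x
  proof -
    define E where "E = (\<lambda>t. F (x, h x + t) * (a' x * b (h x + t) + a x * b' (h x + t) * h' x))"
    have "(E has_real_derivative At (x, t)) (at t)" for t
      unfolding E_def At_def \<gamma>_def
      by (rule DERIV_cong[OF DERIV_mult[OF dFt DERIV_add[OF DERIV_cmult[OF dbt[OF b']]
              DERIV_cmult_right[OF DERIV_cmult[OF dbt[OF b2(2)]]]]]]) (simp add: algebra_simps)
    then have "(LINT t|?T. At (x, t)) = E 0 - E (- N)"
      using N0 by (intro integral_FTC_restrict_space slice(2) cAt) auto
    also have "E (- N) = 0"
      using N(2)[of x] b(2) b'0 by (simp add: E_def)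
    finally show ?thesis by (simp add: E_def)
  qed

  interpret M: pair_sigma_finite circ ?T
  proof -
    interpret c: finite_measure circ by (rule finite_measure_circ)
    interpret t: finite_measure ?T by (rule finite_measureI) (simp add: emeasure_restrict_space space_restrict_space emeasure_lborel_Icc_eq)
    show "pair_sigma_finite circ ?T" ..
  qed
  let ?G = "\<lambda>p. Dy F p * (a' (fst p) * b (snd p)) - Dx F p * (a (fst p) * b' (snd p))"
  have cG: "continuous_on UNIV ?G"
    by (intro continuous_intros Fc continuous_on_compose2[OF smooth_continuous[OF a(1)]]
        continuous_on_compose2[OF smooth_continuous[OF sa']] continuous_on_compose2[OF smooth_continuous[OF b(1)]]
        continuous_on_compose2[OF smooth_continuous[OF sb']]) auto
  have "(LINT p:fluid_cell h|lborel. ?G p) = (LINT x|circ. LINT t|?T. ?G (x, h x + t))"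
    by (rule fluid_cell_integral[OF cG]) (use b(2) b'0 N in auto)
  also have "\<dots> = (LINT x|circ. LINT t|?T. At (x, t) - Ax (x, t))"
    by (simp add: At_def Ax_def \<gamma>_def algebra_simps)
  also have "\<dots> = (LINT x|circ. (LINT t|?T. At (x, t)) - (LINT t|?T. Ax (x, t)))"
  proof (rule Bochner_Integration.integral_cong[OF refl])
    have int: "integrable ?T (\<lambda>t. u (x, t))" if "continuous_on UNIV u" for u :: "real \<times> real \<Rightarrow> real" and x
    proof -
      have "integrable lborel (\<lambda>t. indicator {- N..0} t *\<^sub>R u (x, t))"
        by (intro borel_integrable_compact continuous_on_subset[OF slice(2)[OF that]]) auto
      then show ?thesis by (simp add: integrable_restrict_space)
    qed
    show "(LINT t|?T. At (x, t) - Ax (x, t)) = (LINT t|?T. At (x, t)) - (LINT t|?T. Ax (x, t))" for x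
      by (intro Bochner_Integration.integral_diff int cAt cAx)
  qed
  also have "\<dots> = (LINT x|circ. LINT t|?T. At (x, t)) - (LINT x|circ. LINT t|?T. Ax (x, t))"
    by (intro Bochner_Integration.integral_diff M.integrable_fst'
        integrable_continuous_rectangle[OF cAt] integrable_continuous_rectangle[OF cAx])
  also have "(LINT x|circ. LINT t|?T. Ax (x, t)) = (LINT t|?T. LINT x|circ. Ax (x, t))"
    using integrable_continuous_rectangle[OF cAx] by (intro M.Fubini_integral[symmetric]) simp
  also have "\<dots> = 0" by (simp add: Ax0)
  finally show ?thesis by (simp add: At_eq)
qed

end

subsection \<open>Weak formulas for the boundary data\<close>

context C1_graph
begin

lemma strip_measurable: "fluid_cell h \<inter> {p. - S < snd p} \<in> sets lborel"
proof -
  have "{p :: real \<times> real. - S < snd p} \<in> sets borel"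
    by (intro borel_open open_Collect_less continuous_intros)
  then show ?thesis by simp
qed

lemma cell_strip:
  fixes f :: "real \<times> real \<Rightarrow> real"
  assumes "\<And>x y. y \<le> - S \<Longrightarrow> f (x, y) = 0"
  shows "set_integrable lborel (fluid_cell h) f
      \<longleftrightarrow> integrable (restrict_space lborel (fluid_cell h \<inter> {p. - S < snd p})) f"
    and "(LINT p:fluid_cell h|lborel. f p) = (LINT p|restrict_space lborel (fluid_cell h \<inter> {p. - S < snd p}). f p)"
proof -
  note S = strip_measurable[of S]
  have eq: "indicator (fluid_cell h) p *\<^sub>R f p = indicator (fluid_cell h \<inter> {p. - S < snd p}) p *\<^sub>R f p" for p
    using assms[of "snd p" "fst p"] by (auto simp: indicator_def)
  show "set_integrable lborel (fluid_cell h) f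
      \<longleftrightarrow> integrable (restrict_space lborel (fluid_cell h \<inter> {p. - S < snd p})) f"
    using S by (simp only: set_integrable_def integrable_restrict_space eq sets.Int_space_eq2)
  show "(LINT p:fluid_cell h|lborel. f p) = (LINT p|restrict_space lborel (fluid_cell h \<inter> {p. - S < snd p}). f p)"
    using S by (simp only: set_lebesgue_integral_def integral_restrict_space eq sets.Int_space_eq2)
qed

lemma strip_subset:
  obtains H where "fluid_cell h \<inter> {p. - S < snd p} \<subseteq> cbox (0, - S) (2 * pi, H)"
proof -
  obtain H where H: "\<And>x. \<bar>h x\<bar> \<le> H" using h_bounded by metis
  have "fluid_cell h \<inter> {p. - S < snd p} \<subseteq> cbox (0, - S) (2 * pi, H)"
  proof
    fix p assume "p \<in> fluid_cell h \<inter> {p. - S < snd p}"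
    then show "p \<in> cbox (0, - S) (2 * pi, H)"
      using H[of "fst p"] by (cases p) (auto simp: fluid_cell_def)
  qed
  then show ?thesis by (rule that)
qed

lemma finite_measure_strip:
  "finite_measure (restrict_space lborel (fluid_cell h \<inter> {p. - S < snd p}))"
proof (rule finite_measureI)
  let ?A = "fluid_cell h \<inter> {p. - S < snd p}"
  obtain H where "?A \<subseteq> cbox (0, - S) (2 * pi, H)" by (rule strip_subset)
  then have "emeasure lborel ?A \<le> emeasure lborel (cbox (0, - S) (2 * pi, H))"
    by (intro emeasure_mono) auto
  also have "\<dots> < \<infinity>" by (rule emeasure_lborel_cbox_finite)
  finally show "emeasure (restrict_space lborel ?A) (space (restrict_space lborel ?A)) \<noteq> \<infinity>"
    using strip_measurable[of S] by (simp add: emeasure_restrict_space space_restrict_space)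
qed

lemma bounded_on_strip:
  fixes k :: "real \<times> real \<Rightarrow> real"
  assumes "continuous_on UNIV k"
  obtains B where "\<And>p. p \<in> fluid_cell h \<inter> {p. - S < snd p} \<Longrightarrow> \<bar>k p\<bar> \<le> B"
proof -
  obtain H where H: "fluid_cell h \<inter> {p. - S < snd p} \<subseteq> cbox (0, - S) (2 * pi, H)" by (rule strip_subset)
  have "compact (k ` cbox (0, - S) (2 * pi, H))"
    by (intro compact_continuous_image continuous_on_subset[OF assms]) auto
  then obtain B where "\<And>p. p \<in> cbox (0, - S) (2 * pi, H) \<Longrightarrow> norm (k p) \<le> B"
    using compact_imp_bounded bounded_iff by (metis imageI)
  with H show ?thesis by (intro that[of B]) auto
qed

lemma L2_on_strip:
  assumes u: "L2_on (fluid_cell h) u"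
  shows "u \<in> borel_measurable (restrict_space lborel (fluid_cell h \<inter> {p. - S < snd p}))"
    "integrable (restrict_space lborel (fluid_cell h \<inter> {p. - S < snd p})) u"
proof -
  let ?A = "fluid_cell h \<inter> {p. - S < snd p}"
  let ?M = "restrict_space lborel ?A"
  interpret finite_measure ?M by (rule finite_measure_strip)
  have "set_borel_measurable lborel ?A u"
    using u unfolding L2_on_def by (intro set_borel_measurable_subset[of lborel "fluid_cell h" u ?A] strip_measurable) auto
  then show m: "u \<in> borel_measurable ?M"
    using strip_measurable[of S] by (simp add: set_borel_measurable_def borel_measurable_restrict_space_iff)
  have "set_integrable lborel ?A (\<lambda>p. (u p)\<^sup>2)"
    using u unfolding L2_on_def by (intro set_integrable_subset[of lborel "fluid_cell h" _ ?A] strip_measurable) auto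
  then have "integrable ?M (\<lambda>p. (u p)\<^sup>2)"
    using strip_measurable[of S] by (simp add: set_integrable_def integrable_restrict_space)
  then show "integrable ?M u" using m square_integrable_imp_integrable by blast
qed

lemma set_integrable_L2_mult:
  assumes u: "L2_on (fluid_cell h) u" and k: "continuous_on UNIV k" "\<And>x y. y < - R \<Longrightarrow> k (x, y) = 0"
  shows "set_integrable lborel (fluid_cell h) (\<lambda>p. u p * k p)"
proof -
  \<comment> \<open>The strip is cut strictly below - R: k is known to vanish for y < - R, while
    \<open>cell_strip\<close> asks for vanishing at every y \<le> - S.\<close>
  let ?S = "R + 1"
  obtain B where B: "\<And>p. p \<in> fluid_cell h \<inter> {p. - ?S < snd p} \<Longrightarrow> \<bar>k p\<bar> \<le> B"
    using bounded_on_strip[OF k(1)] by metis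
  have "integrable (restrict_space lborel (fluid_cell h \<inter> {p. - ?S < snd p})) (\<lambda>p. u p * k p)"
  proof (rule integrable_bounded_mult[OF L2_on_strip(2)[OF u]])
    show "k \<in> borel_measurable (restrict_space lborel (fluid_cell h \<inter> {p. - ?S < snd p}))"
      using borel_measurable_continuous_onI[OF k(1)] by (intro measurable_restrict_space1) simp
    show "norm (k p) \<le> B" if "p \<in> space (restrict_space lborel (fluid_cell h \<inter> {p. - ?S < snd p}))" for p
      using that B by (simp add: space_restrict_space)
  qed
  then show ?thesis using k(2) by (subst cell_strip(1)[of ?S]) auto
qed

text \<open>With \<open>\<Phi> = a \<otimes> b\<close>, this is \<open>\<integral> \<zeta>\<^sub>x \<Phi>| = \<integral>\<integral> \<nabla>\<phi> \<cdot> (\<Phi>\<^sub>y, - \<Phi>\<^sub>x)\<close>, the companion of the weak formula that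
  defines \<open>G(h)\<zeta>\<close>.\<close>

lemma tangential_weak_formula:
  assumes H1: "H1_torus \<zeta> \<zeta>'" and tr: "has_trace h \<phi> u v \<zeta>"
    and u: "L2_on (fluid_cell h) u" and v: "L2_on (fluid_cell h) v"
    and a: "smooth a" "periodic_fun a" and b: "smooth b" "\<And>y. y < - R \<Longrightarrow> b y = 0"
    and a': "\<And>x. (a has_real_derivative a' x) (at x)" and b': "\<And>y. (b has_real_derivative b' y) (at y)"
  shows "(LINT x|circ. \<zeta>' x * (a x * b (h x)))
    = (LINT p:fluid_cell h|lborel. u p * (a (fst p) * b' (snd p)) - v p * (a' (fst p) * b (snd p)))"
proof -
  have b'0: "b' y = 0" if "y < - R" for y
    using derivative_eq_0_below[OF b' b(2) that] .
  note ca = smooth_continuous[OF a(1)] and ca' = smooth_continuous[OF smooth_derivative[OF a(1) a']]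
    and cb = smooth_continuous[OF b(1)] and cb' = smooth_continuous[OF smooth_derivative[OF b(1) b']]
  have c2: "continuous_on UNIV (\<lambda>p::real \<times> real. c (fst p) * d (snd p))"
    if "continuous_on UNIV c" "continuous_on UNIV d" for c d :: "real \<Rightarrow> real"
    by (intro continuous_intros continuous_on_compose2[OF that(1)] continuous_on_compose2[OF that(2)]) auto
  define k1 where "k1 = (\<lambda>p. a' (fst p) * b (snd p))"
  define k2 where "k2 = (\<lambda>p. a (fst p) * b' (snd p))"
  have ck: "continuous_on UNIV k1" "continuous_on UNIV k2"
    unfolding k1_def k2_def by (intro c2 ca ca' cb cb')+
  have k0: "k1 (x, y) = 0" "k2 (x, y) = 0" if "y < - R" for x y
    using that b(2) b'0 by (auto simp: k1_def k2_def)
  let ?A = "fluid_cell h \<inter> {p. - (R + 1) < snd p}"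
  let ?M = "restrict_space lborel ?A"
  have spM: "space ?M = ?A" by (simp add: space_restrict_space)
  obtain F where F: "\<And>n. test_fun (F n)"
    "\<And>S. (\<lambda>n. \<integral>\<^sup>+p\<in>fluid_cell h \<inter> {p. - S < snd p}.
        ennreal ((F n p - \<phi> p)\<^sup>2 + (Dx (F n) p - u p)\<^sup>2 + (Dy (F n) p - v p)\<^sup>2) \<partial>lborel) \<longlonglongrightarrow> 0"
    "(\<lambda>n. \<integral>\<^sup>+x\<in>{0..2 * pi}. ennreal ((F n (x, h x) - \<zeta> x)\<^sup>2) \<partial>lborel) \<longlonglongrightarrow> 0"
    using tr unfolding has_trace_def by blast
  note Fc = test_fun_chain[OF F(1)]

  \<comment> \<open>The derivative of x -> \<Phi>(x, h(x)) for \<Phi> = a \<otimes> b. It is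
    continuous but in general no smoother than h', hence the C1 version of weak
    differentiation.\<close>
  define B where "B = (\<lambda>x. a' x * b (h x) + a x * b' (h x) * h' x)"
  have ch: "continuous_on UNIV (\<lambda>x. c (h x))" if "continuous_on UNIV c" for c :: "real \<Rightarrow> real"
    by (rule continuous_on_compose2[OF that continuous_h]) auto
  have cB: "continuous_on UNIV B"
    unfolding B_def by (intro continuous_intros ca ca' ch[OF cb] ch[OF cb'] cont)
  have dB: "((\<lambda>x. a x * b (h x)) has_real_derivative B x) (at x)" for x
    unfolding B_def
    by (rule DERIV_cong[OF DERIV_mult[OF a' DERIV_chain2[OF b' deriv]]]) (simp add: algebra_simps)
  have "periodic_fun (\<lambda>x. a x * b (h x))"
    using a(2) periodic by (simp add: periodic_fun_def)
  from weak_derivative_C1[OF H1 this dB cB]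
  have weak: "(LINT x|circ. \<zeta> x * B x) = - (LINT x|circ. \<zeta>' x * (a x * b (h x)))" .

  have \<zeta>: "\<zeta> \<in> borel_measurable circ" "integrable circ \<zeta>"
    using H1 L2_torus_circ by (auto simp: H1_torus_def)
  have "compact (B ` {0..2 * pi})" by (intro compact_continuous_image continuous_on_subset[OF cB]) auto
  then obtain C where C: "\<And>x. x \<in> {0..2 * pi} \<Longrightarrow> norm (B x) \<le> C"
    using compact_imp_bounded bounded_iff by (metis imageI)
  have B_meas[measurable]: "B \<in> borel_measurable circ"
    by (intro measurable_circ borel_measurable_continuous_onI cB)
  have cFh: "continuous_on UNIV (\<lambda>x. F n (x, h x))" for n
    by (rule continuous_on_compose2[OF Fc(2)]) (auto intro!: continuous_intros continuous_h)
  have Fh_meas: "(\<lambda>x. F n (x, h x)) \<in> borel_measurable circ" for n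
    by (intro measurable_circ borel_measurable_continuous_onI cFh)
  have intFB: "integrable circ (\<lambda>x. F n (x, h x) * B x)" for n
  proof -
    have "integrable circ (\<lambda>x. 1 * (F n (x, h x) * B x))"
      using finite_measure.integrable_const[OF finite_measure_circ]
      by (intro integrable_circ_mult_continuous continuous_intros cFh cB)
    then show ?thesis by simp
  qed
  have lim1: "(\<lambda>n. LINT x|circ. (F n (x, h x) - \<zeta> x) * B x) \<longlonglongrightarrow> 0"
  proof (rule tendsto_integral_L2[OF finite_measure_circ _ B_meas, of _ C])
    show "(\<lambda>x. F n (x, h x) - \<zeta> x) \<in> borel_measurable circ" for n
      using Fh_meas \<zeta>(1) by (rule borel_measurable_diff)
    show "(\<lambda>n. \<integral>\<^sup>+x. ennreal ((F n (x, h x) - \<zeta> x)\<^sup>2) \<partial>circ) \<longlonglongrightarrow> 0"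
      using F(3) by (simp add: nn_integral_restrict_space)
  qed (use C in auto)
  have int\<zeta>B: "integrable circ (\<lambda>x. \<zeta> x * B x)"
    by (rule integrable_circ_mult_continuous[OF \<zeta>(2) cB])
  have eq1: "(LINT x|circ. (F n (x, h x) - \<zeta> x) * B x) = (LINT x|circ. F n (x, h x) * B x) - (LINT x|circ. \<zeta> x * B x)" for n
    unfolding left_diff_distrib
    by (rule Bochner_Integration.integral_diff[OF intFB int\<zeta>B])

  have nn_lim: "(\<lambda>n. \<integral>\<^sup>+p. ennreal ((D n p)\<^sup>2) \<partial>?M) \<longlonglongrightarrow> 0"
    if "\<And>n p. (D n p)\<^sup>2 \<le> (F n p - \<phi> p)\<^sup>2 + (Dx (F n) p - u p)\<^sup>2 + (Dy (F n) p - v p)\<^sup>2" for D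
  proof (rule tendsto_sandwich[OF _ _ tendsto_const F(2)[of "R + 1"]])
    show "\<forall>\<^sub>F n in sequentially. (\<integral>\<^sup>+p. ennreal ((D n p)\<^sup>2) \<partial>?M)
      \<le> (\<integral>\<^sup>+p\<in>?A. ennreal ((F n p - \<phi> p)\<^sup>2 + (Dx (F n) p - u p)\<^sup>2 + (Dy (F n) p - v p)\<^sup>2) \<partial>lborel)"
    proof (intro always_eventually allI)
      fix n
      have "(\<integral>\<^sup>+p. ennreal ((D n p)\<^sup>2) \<partial>?M) = (\<integral>\<^sup>+p\<in>?A. ennreal ((D n p)\<^sup>2) \<partial>lborel)"
        using strip_measurable[of "R + 1"] by (intro nn_integral_restrict_space) simp
      also have "\<dots> \<le> (\<integral>\<^sup>+p\<in>?A. ennreal ((F n p - \<phi> p)\<^sup>2 + (Dx (F n) p - u p)\<^sup>2 + (Dy (F n) p - v p)\<^sup>2) \<partial>lborel)"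
        by (intro nn_integral_mono mult_right_mono ennreal_leI that) auto
      finally show "(\<integral>\<^sup>+p. ennreal ((D n p)\<^sup>2) \<partial>?M)
        \<le> (\<integral>\<^sup>+p\<in>?A. ennreal ((F n p - \<phi> p)\<^sup>2 + (Dx (F n) p - u p)\<^sup>2 + (Dy (F n) p - v p)\<^sup>2) \<partial>lborel)" .
    qed
  qed auto
  have cont_meas: "c \<in> borel_measurable ?M" if "continuous_on UNIV c" for c :: "real \<times> real \<Rightarrow> real"
    using borel_measurable_continuous_onI[OF that] by (intro measurable_restrict_space1) simp
  obtain C1 where C1: "\<And>p. p \<in> ?A \<Longrightarrow> \<bar>k1 p\<bar> \<le> C1" using bounded_on_strip[OF ck(1)] by metis
  obtain C2 where C2: "\<And>p. p \<in> ?A \<Longrightarrow> \<bar>k2 p\<bar> \<le> C2" using bounded_on_strip[OF ck(2)] by metis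
  have lim2: "(\<lambda>n. LINT p|?M. (Dy (F n) p - v p) * k1 p) \<longlonglongrightarrow> 0"
  proof (rule tendsto_integral_L2[OF finite_measure_strip _ cont_meas[OF ck(1)] nn_lim])
    show "(\<lambda>p. Dy (F n) p - v p) \<in> borel_measurable ?M" for n
      by (rule borel_measurable_diff[OF cont_meas[OF Fc(4)] L2_on_strip(1)[OF v]])
    show "\<bar>k1 p\<bar> \<le> C1" if "p \<in> space ?M" for p
      using that unfolding spM by (rule C1)
  qed simp
  have lim3: "(\<lambda>n. LINT p|?M. (Dx (F n) p - u p) * k2 p) \<longlonglongrightarrow> 0"
  proof (rule tendsto_integral_L2[OF finite_measure_strip _ cont_meas[OF ck(2)] nn_lim])
    show "(\<lambda>p. Dx (F n) p - u p) \<in> borel_measurable ?M" for n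
      by (rule borel_measurable_diff[OF cont_meas[OF Fc(3)] L2_on_strip(1)[OF u]])
    show "\<bar>k2 p\<bar> \<le> C2" if "p \<in> space ?M" for p
      using that unfolding spM by (rule C2)
  qed simp
  have Zd: "c (x, y) * k1 (x, y) = 0" "c (x, y) * k2 (x, y) = 0" if "y \<le> - (R + 1)" for c :: "real \<times> real \<Rightarrow> real" and x y
    using k0 that by auto
  have iv: "set_integrable lborel (fluid_cell h) (\<lambda>p. v p * k1 p)" "set_integrable lborel (fluid_cell h) (\<lambda>p. u p * k2 p)"
    by (rule set_integrable_L2_mult[OF v ck(1) k0(1)] set_integrable_L2_mult[OF u ck(2) k0(2)]; assumption)+
  have iF: "set_integrable lborel (fluid_cell h) (\<lambda>p. Dy (F n) p * k1 p)" "set_integrable lborel (fluid_cell h) (\<lambda>p. Dx (F n) p * k2 p)" for n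
  proof -
    obtain H where H: "\<And>x. \<bar>h x\<bar> \<le> H" using h_bounded by metis
    then have N: "R + \<bar>h x\<bar> \<le> R + H" for x by simp
    show "set_integrable lborel (fluid_cell h) (\<lambda>p. Dy (F n) p * k1 p)"
      by (rule fluid_cell_integral(1)[OF _ _ N]) (use k0 in \<open>auto intro!: continuous_intros Fc ck\<close>)
    show "set_integrable lborel (fluid_cell h) (\<lambda>p. Dx (F n) p * k2 p)"
      by (rule fluid_cell_integral(1)[OF _ _ N]) (use k0 in \<open>auto intro!: continuous_intros Fc ck\<close>)
  qed
  have eq2: "(LINT p|?M. (Dy (F n) p - v p) * k1 p)
      = (LINT p:fluid_cell h|lborel. Dy (F n) p * k1 p) - (LINT p:fluid_cell h|lborel. v p * k1 p)" for n
    unfolding set_integral_diff(2)[OF iF(1) iv(1), symmetric] left_diff_distrib[symmetric]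
    by (rule cell_strip(2)[symmetric]) (rule Zd)
  have eq3: "(LINT p|?M. (Dx (F n) p - u p) * k2 p)
      = (LINT p:fluid_cell h|lborel. Dx (F n) p * k2 p) - (LINT p:fluid_cell h|lborel. u p * k2 p)" for n
    unfolding set_integral_diff(2)[OF iF(2) iv(2), symmetric] left_diff_distrib[symmetric]
    by (rule cell_strip(2)[symmetric]) (rule Zd)
  have green: "(LINT x|circ. F n (x, h x) * B x)
      = (LINT p:fluid_cell h|lborel. Dy (F n) p * k1 p) - (LINT p:fluid_cell h|lborel. Dx (F n) p * k2 p)" for n
    unfolding set_integral_diff(2)[OF iF(1) iF(2), symmetric]
    unfolding B_def k1_def k2_def by (rule Green_identity[OF F(1) a b a' b', symmetric])
  \<comment> \<open>Green's identity for the approximants cancels every term that depends on n: the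
    sequence is constant, so its limit 0 is the identity for \<phi> and \<zeta> themselves.\<close>
  have "(\<lambda>n. (LINT p|?M. (Dy (F n) p - v p) * k1 p) - (LINT p|?M. (Dx (F n) p - u p) * k2 p)
      - (LINT x|circ. (F n (x, h x) - \<zeta> x) * B x)) \<longlonglongrightarrow> 0 - 0 - 0"
    by (intro tendsto_diff lim1 lim2 lim3)
  then have "(LINT x|circ. \<zeta> x * B x) = (LINT p:fluid_cell h|lborel. v p * k1 p) - (LINT p:fluid_cell h|lborel. u p * k2 p)"
    unfolding eq1 eq2 eq3 green by (simp add: LIMSEQ_const_iff)
  then show ?thesis
    using weak unfolding set_integral_diff(2)[OF iv(2) iv(1), unfolded k1_def k2_def] k1_def k2_def by simp
qed

end

section \<open>Exponential test functions and the moments of the boundary data\<close>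

lemma smooth_exp: "smooth (\<lambda>y::real. exp (c * y))"
proof (rule smooth_realI[of _ "range (\<lambda>d y. d * exp (c * y))"])
  show "(\<lambda>y. exp (c * y)) \<in> range (\<lambda>d y. d * exp (c * y))"
    by (intro image_eqI[of _ _ 1]) auto
  fix f :: "real \<Rightarrow> real" assume "f \<in> range (\<lambda>d y. d * exp (c * y))"
  then obtain d where "f = (\<lambda>y. d * exp (c * y))" by auto
  then have "\<forall>y. (f has_real_derivative (d * c) * exp (c * y)) (at y)"
    by (auto intro!: derivative_eq_intros)
  then show "\<exists>f'\<in>range (\<lambda>d y. d * exp (c * y)). \<forall>y. (f has_real_derivative f' y) (at y)"
    by (intro bexI[of _ "\<lambda>y. (d * c) * exp (c * y)"]) auto
qed

context C1_graph
begin

lemma w_power: "w x ^ k = of_real (exp (k * h x)) * Complex (cos (k * x)) (- sin (k * x))"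
proof -
  have "w x ^ k = exp (of_nat k * Complex (h x) (- x))"
    by (simp add: w_def exp_of_nat_mult)
  also have "of_nat k * Complex (h x) (- x) = Complex (k * h x) (- (k * x))"
    by (simp add: complex_eq_iff)
  finally show ?thesis by (simp add: exp_eq_polar cis.ctr)
qed

text \<open>The layer where the cutoff varies has height 1 at every depth, so its area stays 2 pi as
  it is moved down. The hypothesis holds almost everywhere only, because the decay of the gradient
  is an essential supremum.\<close>

lemma abs_integral_strip_le:
  fixes f :: "real \<times> real \<Rightarrow> real"
  assumes f: "AE p in lborel. p \<in> fluid_cell h \<longrightarrow> \<bar>f p\<bar> \<le> B * indicator (cbox (0, - S) (2 * pi, - S + 1)) p"
    and "B \<ge> 0"
  shows "\<bar>LINT p:fluid_cell h|lborel. f p\<bar> \<le> B * (2 * pi)"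
proof -
  let ?K = "cbox (0, - S) (2 * pi, - S + 1) :: (real \<times> real) set"
  have "\<bar>LINT p:fluid_cell h|lborel. f p\<bar> \<le> (\<integral>p. norm (indicator (fluid_cell h) p *\<^sub>R f p) \<partial>lborel)"
    unfolding set_lebesgue_integral_def real_norm_def[symmetric] by (rule integral_norm_bound)
  also have "\<dots> \<le> (\<integral>p. B * indicator ?K p \<partial>lborel)"
  proof (rule integral_mono_AE')
    show "integrable lborel (\<lambda>p. B * indicator ?K p)"
      by (intro integrable_mult_right integrable_real_indicator emeasure_lborel_cbox_finite) simp
    show "AE p in lborel. norm (indicator (fluid_cell h) p *\<^sub>R f p) \<le> B * indicator ?K p"
      using f
    proof eventually_elim
      case (elim p)
      then show ?case using \<open>B \<ge> 0\<close> by (cases "p \<in> fluid_cell h") simp_all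
    qed
  qed (use \<open>B \<ge> 0\<close> in auto)
  also have "\<dots> = B * measure lborel ?K" by simp
  also have "measure lborel ?K = 2 * pi"
    by (subst measure_lborel_cbox_eq) (auto simp: Basis_prod_def)
  finally show ?thesis .
qed

text \<open>The normal formula and its tangential companion are added for two conjugate harmonic
  functions, cut off at depth. The domain integrals cancel up to the terms with the derivative of
  the cutoff. These live in a layer of height 1, where the gradient of the solution is small and exp
  (k y) \<le> 1.\<close>

lemma DtN_moments:
  assumes H1: "H1_torus \<zeta> \<zeta>'" and G: "dirichlet_to_neumann h \<zeta> g"
  shows "(LINT x|circ. (of_real (\<zeta>' x) - \<i> * of_real (g x)) * w x ^ k) = 0"
proof -
  obtain \<phi> u v where sol: "variational_solution h \<zeta> \<phi> u v"
    and weak: "\<And>F. test_fun F \<Longrightarrow> (LINT x:{0..2 * pi}|lborel. g x * F (x, h x)) =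
           (LINT p:fluid_cell h|lborel. u p * Dx F p + v p * Dy F p)"
    using G unfolding dirichlet_to_neumann_def by blast
  have u: "L2_on (fluid_cell h) u" and v: "L2_on (fluid_cell h) v" and tr: "has_trace h \<phi> u v \<zeta>"
    and decay: "\<And>\<epsilon>. \<epsilon> > 0 \<Longrightarrow> \<exists>Y. AE p in lborel. snd p < Y \<longrightarrow> norm (u p, v p) \<le> \<epsilon>"
    using sol unfolding variational_solution_def finite_energy_def by auto
  have gL2: "integrable circ g" "integrable circ \<zeta>'"
    using H1 G L2_torus_circ(3) by (auto simp: H1_torus_def dirichlet_to_neumann_def)
  obtain \<beta> \<beta>' :: "real \<Rightarrow> real" where \<beta>: "smooth \<beta>" "smooth \<beta>'" "\<And>x. (\<beta> has_real_derivative \<beta>' x) (at x)"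
    "\<And>x. x \<le> 0 \<Longrightarrow> \<beta> x = 0" "\<And>x. x \<ge> 1 \<Longrightarrow> \<beta> x = 1" "\<And>x. x \<le> 0 \<or> x \<ge> 1 \<Longrightarrow> \<beta>' x = 0"
    using smooth_step_exists by metis
  obtain C where C: "C > 0" "\<And>x. \<bar>\<beta>' x\<bar> \<le> C"
  proof -
    have "continuous_on UNIV \<beta>'" by (rule smooth_continuous[OF \<beta>(2)])
    then have "compact (\<beta>' ` {0..1})" by (intro compact_continuous_image) (auto intro: continuous_on_subset)
    then obtain C where C: "C > 0" "\<And>x. x \<in> {0..1} \<Longrightarrow> norm (\<beta>' x) \<le> C"
      using compact_imp_bounded bounded_pos by (metis imageI)
    have "\<bar>\<beta>' x\<bar> \<le> C" for x using C(1) C(2)[of x] \<beta>(6)[of x] by (cases "x \<in> {0..1}") auto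
    with C(1) show ?thesis by (rule that)
  qed
  obtain H where H: "H > 0" "\<And>x. \<bar>h x\<bar> \<le> H" using h_bounded by metis

  \<comment> \<open>\<open>I1\<close> is the real part of the moment, \<open>I2\<close> minus its
    imaginary part.\<close>
  define I1 where "I1 = (LINT x|circ. exp (real k * h x) * (\<zeta>' x * cos (real k * x) - g x * sin (real k * x)))"
  define I2 where "I2 = (LINT x|circ. exp (real k * h x) * (\<zeta>' x * sin (real k * x) + g x * cos (real k * x)))"
  have small: "\<bar>I1\<bar> \<le> 2 * e * C * (2 * pi) \<and> \<bar>I2\<bar> \<le> 2 * e * C * (2 * pi)" if "e > 0" for e
  proof -
    obtain Y where Y: "AE p in lborel. snd p < Y \<longrightarrow> norm (u p, v p) \<le> e" using decay[OF \<open>e > 0\<close>] by blast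
    \<comment> \<open>Places the layer [- S, - S + 1] under the graph, below the level Y where the
      gradient is at most e, and in y \<le> 0 where exp (k y) \<le> 1.\<close>
    define S where "S = max (H + 1) (2 - Y)"
    have S: "S \<ge> H + 1" "- S + 1 < Y" "S \<ge> 1" using H(1) by (auto simp: S_def)
    \<comment> \<open>The first factor cuts off at depth S. The second is 1 for y \<le> H, hence on
      the fluid and its boundary, and 0 for y \<ge> H + 1; it gives compact support from
      above.\<close>
    define \<sigma> where "\<sigma> = (\<lambda>y. \<beta> (1 * y + S) * \<beta> (- 1 * y + (H + 1)))"
    define \<sigma>' where "\<sigma>' = (\<lambda>y. \<beta>' (1 * y + S) * \<beta> (- 1 * y + (H + 1)) - \<beta> (1 * y + S) * \<beta>' (- 1 * y + (H + 1)))"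
    have d\<beta>: "((\<lambda>y. \<beta> (c * y + d)) has_real_derivative \<beta>' (c * y + d) * c) (at y)" for c d y
      by (rule DERIV_chain2[OF \<beta>(3)]) (auto intro!: derivative_eq_intros)
    have \<sigma>_der: "(\<sigma> has_real_derivative \<sigma>' y) (at y)" for y
      unfolding \<sigma>_def \<sigma>'_def
      by (rule DERIV_cong[OF DERIV_mult[OF d\<beta>[of 1 S] d\<beta>[of "- 1" "H + 1"]]]) simp
    define b where "b = (\<lambda>y. exp (real k * y) * \<sigma> y)"
    define b' where "b' = (\<lambda>y. real k * b y + exp (real k * y) * \<sigma>' y)"
    have b_der: "(b has_real_derivative b' y) (at y)" for y
    proof -
      have "((\<lambda>y. exp (real k * y)) has_real_derivative exp (real k * y) * k) (at y)"
        by (auto intro!: derivative_eq_intros)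
      then show ?thesis
        unfolding b_def b'_def by (rule DERIV_cong[OF DERIV_mult[OF _ \<sigma>_der]]) (simp add: algebra_simps)
    qed
    have b_smooth: "smooth b"
      unfolding b_def \<sigma>_def by (intro smooth_mult smooth_exp smooth_affine \<beta>(1))
    have b0: "b y = 0" if "y < - S" for y using that \<beta>(4)[of "y + S"] by (simp add: b_def \<sigma>_def)
    have b0': "b y = 0" if "\<bar>y\<bar> > S + H + 1" for y
      using that H(1) S \<beta>(4)[of "y + S"] \<beta>(4)[of "- y + (H + 1)"] by (cases "y > 0") (auto simp: b_def \<sigma>_def)
    have bh: "b (h x) = exp (real k * h x)" for x
      using H(2)[of x] S \<beta>(5)[of "h x + S"] \<beta>(5)[of "- h x + (H + 1)"] by (simp add: b_def \<sigma>_def abs_le_iff)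
    have \<sigma>'_le: "\<bar>exp (real k * y) * \<sigma>' y\<bar> \<le> C" "y < - S \<or> y > - S + 1 \<Longrightarrow> \<sigma>' y = 0" if y: "y < H" for y
    proof -
      have eq: "\<sigma>' y = \<beta>' (y + S)"
        using y \<beta>(5)[of "- y + (H + 1)"] \<beta>(6)[of "- y + (H + 1)"] by (simp add: \<sigma>'_def)
      show z: "\<sigma>' y = 0" if "y < - S \<or> y > - S + 1"
        using that \<beta>(6)[of "y + S"] by (auto simp: eq)
      show "\<bar>exp (real k * y) * \<sigma>' y\<bar> \<le> C"
      proof (cases "y < - S \<or> y > - S + 1")
        case False
        then have "real k * y \<le> 0" using S by (intro mult_nonneg_nonpos) auto
        then have "exp (real k * y) * \<bar>\<sigma>' y\<bar> \<le> 1 * C" unfolding eq by (intro mult_mono C) auto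
        then show ?thesis by (simp add: abs_mult)
      qed (use z C in auto)
    qed
    have cb: "continuous_on UNIV b" by (rule smooth_continuous[OF b_smooth])
    have cb': "continuous_on UNIV b'"
      by (rule smooth_continuous[OF smooth_derivative[OF b_smooth b_der]])
    have b'0: "b' y = 0" if "y < - S" for y
      using derivative_eq_0_below[OF b_der b0 that] .
    have trig_smooth: "smooth (\<lambda>x. cos (real k * x))" "smooth (\<lambda>x. sin (real k * x))"
      using smooth_affine[OF smooth_sin_cos(2), of "real k" 0] smooth_affine[OF smooth_sin_cos(1), of "real k" 0] by auto
    have shift: "real k * (x + 2 * pi) = real k * x + 2 * pi * of_int (int k)" for x by (simp add: algebra_simps)
    have trig_per: "periodic_fun (\<lambda>x. cos (real k * x))" "periodic_fun (\<lambda>x. sin (real k * x))"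
      unfolding periodic_fun_def shift periodic_int_shift[of cos, OF cos_periodic]
        periodic_int_shift[of sin, OF sin_periodic] by simp_all
    have dcos: "((\<lambda>x. cos (real k * x)) has_real_derivative - real k * sin (real k * x)) (at x)" for x
      by (auto intro!: derivative_eq_intros)
    have dsin: "((\<lambda>x. sin (real k * x)) has_real_derivative real k * cos (real k * x)) (at x)" for x
      by (auto intro!: derivative_eq_intros)
    have ccos: "continuous_on UNIV (\<lambda>x::real. cos (real k * x))" and csin: "continuous_on UNIV (\<lambda>x::real. sin (real k * x))"
      by (intro continuous_intros)+
    have cneg: "continuous_on UNIV (\<lambda>x::real. - 1 * sin (real k * x))"
      by (intro continuous_intros)

    have normal: "(LINT x|circ. g x * (a x * b (h x)))
        = (LINT p:fluid_cell h|lborel. u p * (a' (fst p) * b (snd p)) + v p * (a (fst p) * b' (snd p)))"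
      if a: "smooth a" "periodic_fun a" "\<And>x. (a has_real_derivative a' x) (at x)" for a a'
    proof -
      have "test_fun (\<lambda>p. a (fst p) * b (snd p))"
        by (rule test_fun_tensor[where R = "S + H + 1", OF a(1) b_smooth a(2)]) (rule b0')
      from weak[OF this] show ?thesis
        unfolding set_lebesgue_integral_circ tensor_partials[OF a(3) b_der] by simp
    qed
    have int: "set_integrable lborel (fluid_cell h) (\<lambda>p. f p * (a (fst p) * c (snd p)))"
      if "L2_on (fluid_cell h) f" "continuous_on UNIV a" "continuous_on UNIV c" "\<And>y. y < - S \<Longrightarrow> c y = 0"
      for f :: "real \<times> real \<Rightarrow> real" and a c :: "real \<Rightarrow> real"
      by (rule set_integrable_L2_mult[OF that(1), of _ S])
        (use that in \<open>auto intro!: continuous_intros continuous_on_compose2[OF that(2)] continuous_on_compose2[OF that(3)]\<close>)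
    have intg: "integrable circ (\<lambda>x. f x * (a x * b (h x)))"
      if f: "integrable circ f" and a: "continuous_on UNIV a" for f a :: "real \<Rightarrow> real"
      by (intro integrable_circ_mult_continuous f continuous_intros a continuous_on_compose2[OF cb continuous_h]) auto
    have tang: "(LINT x|circ. \<zeta>' x * (a x * b (h x)))
        = (LINT p:fluid_cell h|lborel. u p * (a (fst p) * b' (snd p)) - v p * (a' (fst p) * b (snd p)))"
      if a: "smooth a" "periodic_fun a" "\<And>x. (a has_real_derivative a' x) (at x)" for a a'
      by (rule tangential_weak_formula[where R = S, OF H1 tr u v a(1,2) b_smooth _ a(3) b_der]) (rule b0)
    \<comment> \<open>The relations a1' = k a2 and a2' = - k a1 are the Cauchy-Riemann equations for
      exp (k y) a1 and exp (k y) a2. Writing b' = k b + exp (k y) \<sigma>', all terms with k b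
      cancel. In the bound, 2 e estimates u a1 + v a2, C the derivative of the step, and 2 pi is the
      area of the layer.\<close>
    have combine: "\<bar>(LINT x|circ. \<zeta>' x * (a1 x * b (h x))) + (LINT x|circ. g x * (a2 x * b (h x)))\<bar> \<le> 2 * e * C * (2 * pi)"
      if a1: "smooth a1" "periodic_fun a1" "\<And>x. (a1 has_real_derivative real k * a2 x) (at x)" "\<And>x. \<bar>a1 x\<bar> \<le> 1"
        and a2: "smooth a2" "periodic_fun a2" "\<And>x. (a2 has_real_derivative - real k * a1 x) (at x)" "\<And>x. \<bar>a2 x\<bar> \<le> 1"
      for a1 a2
    proof -
      have c: "continuous_on UNIV a1" "continuous_on UNIV a2" using a1(1) a2(1) by (simp_all add: smooth_continuous)
      have c': "continuous_on UNIV (\<lambda>x. real k * a2 x)" "continuous_on UNIV (\<lambda>x. - real k * a1 x)"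
        by (intro continuous_intros c)+
      have "(LINT x|circ. \<zeta>' x * (a1 x * b (h x))) + (LINT x|circ. g x * (a2 x * b (h x)))
        = (LINT p:fluid_cell h|lborel. (u p * (a1 (fst p) * b' (snd p)) - v p * ((real k * a2 (fst p)) * b (snd p)))
          + (u p * ((- real k * a1 (fst p)) * b (snd p)) + v p * (a2 (fst p) * b' (snd p))))"
        unfolding tang[OF a1(1,2,3)] normal[OF a2(1,2,3)]
        by (intro set_integral_add(2)[symmetric] set_integral_diff(1) set_integral_add(1) int u v c c' cb cb' b0 b'0)
      also have "\<dots> = (LINT p:fluid_cell h|lborel. (u p * a1 (fst p) + v p * a2 (fst p)) * (exp (real k * snd p) * \<sigma>' (snd p)))"
        by (intro arg_cong[where f = "set_lebesgue_integral lborel (fluid_cell h)"])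
          (simp add: b'_def fun_eq_iff algebra_simps)
      also have "\<bar>\<dots>\<bar> \<le> 2 * e * C * (2 * pi)"
      proof (rule abs_integral_strip_le[of _ _ S])
        show "AE p in lborel. p \<in> fluid_cell h \<longrightarrow>
          \<bar>(u p * a1 (fst p) + v p * a2 (fst p)) * (exp (real k * snd p) * \<sigma>' (snd p))\<bar>
          \<le> 2 * e * C * indicator (cbox (0, - S) (2 * pi, - S + 1)) p"
          using Y
        proof eventually_elim
          fix p :: "real \<times> real" assume p: "snd p < Y \<longrightarrow> norm (u p, v p) \<le> e"
          obtain x y where xy: "p = (x, y)" by fastforce
          show "p \<in> fluid_cell h \<longrightarrow>
            \<bar>(u p * a1 (fst p) + v p * a2 (fst p)) * (exp (real k * snd p) * \<sigma>' (snd p))\<bar>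
            \<le> 2 * e * C * indicator (cbox (0, - S) (2 * pi, - S + 1)) p"
          proof
            assume cell: "p \<in> fluid_cell h"
            then have yH: "y < H" using H(2)[of x] by (auto simp: xy fluid_cell_def abs_le_iff)
            show "\<bar>(u p * a1 (fst p) + v p * a2 (fst p)) * (exp (real k * snd p) * \<sigma>' (snd p))\<bar>
              \<le> 2 * e * C * indicator (cbox (0, - S) (2 * pi, - S + 1)) p"
            proof (cases "y < - S \<or> y > - S + 1")
              case True
              then have "\<sigma>' y = 0" by (rule \<sigma>'_le(2)[OF yH])
              then show ?thesis using that \<open>e > 0\<close> C(1) by (simp add: xy)
            next
              case False
              then have ind: "p \<in> cbox (0, - S) (2 * pi, - S + 1)" using cell by (simp add: xy fluid_cell_def)
              have "norm (u p, v p) \<le> e" using p False S(2) by (simp add: xy)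
              then have uv: "\<bar>u p\<bar> \<le> e" "\<bar>v p\<bar> \<le> e"
                using norm_fst_le[of "u p" "v p"] norm_snd_le[of "v p" "u p"] by auto
              have "\<bar>u p * a1 x + v p * a2 x\<bar> \<le> \<bar>u p\<bar> * \<bar>a1 x\<bar> + \<bar>v p\<bar> * \<bar>a2 x\<bar>"
                by (simp add: abs_triangle_ineq flip: abs_mult)
              also have "\<dots> \<le> e * 1 + e * 1"
                using \<open>e > 0\<close> by (intro add_mono mult_mono uv a1(4) a2(4)) auto
              finally have "\<bar>u p * a1 x + v p * a2 x\<bar> \<le> 2 * e" by simp
              then have "\<bar>u p * a1 x + v p * a2 x\<bar> * \<bar>exp (real k * y) * \<sigma>' y\<bar> \<le> 2 * e * C"
                using \<open>e > 0\<close> by (intro mult_mono \<sigma>'_le(1)[OF yH]) auto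
              then show ?thesis using ind by (simp add: xy abs_mult)
            qed
          qed
        qed
      qed (use \<open>e > 0\<close> C in simp)
      finally show ?thesis .
    qed
    have "I2 = (LINT x|circ. \<zeta>' x * (sin (real k * x) * b (h x))) + (LINT x|circ. g x * (cos (real k * x) * b (h x)))"
      unfolding I2_def Bochner_Integration.integral_add[OF intg[OF gL2(2) csin] intg[OF gL2(1) ccos], symmetric]
      by (intro Bochner_Integration.integral_cong refl) (simp add: bh algebra_simps)
    then have 2: "\<bar>I2\<bar> \<le> 2 * e * C * (2 * pi)"
      using combine[of "\<lambda>x. sin (real k * x)" "\<lambda>x. cos (real k * x)"] trig_smooth trig_per dsin dcos by simp
    have neg: "smooth (\<lambda>x. - 1 * sin (real k * x))" "periodic_fun (\<lambda>x. - 1 * sin (real k * x))"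
      "((\<lambda>x. - 1 * sin (real k * x)) has_real_derivative - real k * cos (real k * x)) (at x)" for x
      using smooth_mult[OF smooth_const[of "-1"] trig_smooth(2)] trig_per(2) DERIV_cmult[OF dsin, of "-1"]
      by (auto simp: periodic_fun_def)
    have "I1 = (LINT x|circ. \<zeta>' x * (cos (real k * x) * b (h x))) + (LINT x|circ. g x * ((- 1 * sin (real k * x)) * b (h x)))"
      unfolding I1_def Bochner_Integration.integral_add[OF intg[OF gL2(2) ccos] intg[OF gL2(1) cneg], symmetric]
      by (intro Bochner_Integration.integral_cong refl) (simp add: bh algebra_simps)
    then have 1: "\<bar>I1\<bar> \<le> 2 * e * C * (2 * pi)"
      using combine[of "\<lambda>x. cos (real k * x)" "\<lambda>x. - 1 * sin (real k * x)"] trig_smooth trig_per dcos neg by simp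
    from 1 2 show ?thesis by (rule conjI)
  qed
  have zero: "t = 0" if "\<And>e. e > 0 \<Longrightarrow> \<bar>t\<bar> \<le> 2 * e * C * (2 * pi)" for t :: real
  proof -
    have "\<bar>t\<bar> \<le> 0"
    proof (rule field_le_epsilon)
      fix e :: real assume "e > 0"
      then show "\<bar>t\<bar> \<le> 0 + e" using that[of "e / (2 * C * (2 * pi))"] C(1) by simp
    qed
    then show ?thesis by simp
  qed
  have "I1 = 0" "I2 = 0" using small by (auto intro!: zero)
  let ?F = "\<lambda>x. (of_real (\<zeta>' x) - \<i> * of_real (g x)) * w x ^ k"
  have int: "integrable circ ?F"
  proof -
    obtain W where W: "\<And>x. norm (w x) \<le> W" using w_bounded by metis
    show ?thesis
    proof (rule integrable_bounded_mult)
      show "integrable circ (\<lambda>x. complex_of_real (\<zeta>' x) - \<i> * of_real (g x))"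
        using gL2 by auto
      show "norm (w x ^ k) \<le> W ^ k" for x using W by (simp add: norm_power power_mono)
    qed measurable
  qed
  have "Re (LINT x|circ. ?F x) = (LINT x|circ. Re (?F x))" "Im (LINT x|circ. ?F x) = (LINT x|circ. Im (?F x))"
    using integral_Re[OF int] integral_Im[OF int] by auto
  moreover have "Re (?F x) = exp (real k * h x) * (\<zeta>' x * cos (real k * x) - g x * sin (real k * x))"
    "Im (?F x) = - (exp (real k * h x) * (\<zeta>' x * sin (real k * x) + g x * cos (real k * x)))" for x
    unfolding w_power by (simp_all add: algebra_simps)
  ultimately show ?thesis
    using \<open>I1 = 0\<close> \<open>I2 = 0\<close> by (simp add: complex_eq_iff I1_def I2_def)
qed

end

subsection \<open>The contour identity\<close>

text \<open>Elements of L2 come with measurability on one period, whereas the modulus of continuity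
  evaluates them at shifted points outside it.\<close>

lemma periodic_borel_measurable:
  fixes f :: "real \<Rightarrow> real"
  assumes per: "periodic_fun f" and f: "f \<in> borel_measurable circ"
  shows "f \<in> borel_measurable borel"
proof -
  define g where "g = (\<lambda>x. indicator {0..2 * pi} x *\<^sub>R f x)"
  have [measurable]: "g \<in> borel_measurable borel"
    using f by (simp add: g_def borel_measurable_restrict_space_iff)
  have "f x = g (x - 2 * pi * of_int \<lfloor>x / (2 * pi)\<rfloor>)" for x
  proof -
    let ?n = "\<lfloor>x / (2 * pi)\<rfloor>"
    have "of_int ?n * (2 * pi) \<le> x / (2 * pi) * (2 * pi)" "x / (2 * pi) * (2 * pi) \<le> (of_int ?n + 1) * (2 * pi)"
      using floor_correct[of "x / (2 * pi)"] by (intro mult_right_mono; simp)+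
    then have "x - 2 * pi * of_int ?n \<in> {0..2 * pi}" by (simp add: algebra_simps)
    moreover have "f (x - 2 * pi * of_int ?n) = f x"
      using periodic_int_shift[of f x "- ?n"] per by (simp add: periodic_fun_def)
    ultimately show ?thesis by (simp add: g_def)
  qed
  then have "f = (\<lambda>x. g (x - 2 * pi * of_int \<lfloor>x / (2 * pi)\<rfloor>))" by blast
  also have "\<dots> \<in> borel_measurable borel" by measurable
  finally show ?thesis .
qed

context C1_graph
begin

lemma DtN_contour_identity:
  assumes H1: "H1_torus \<zeta> \<zeta>'" and G: "dirichlet_to_neumann h \<zeta> g"
  shows "(LINT x|circ. (of_real (\<zeta>' x) - \<i> * of_real (g x))\<^sup>2 / z' x) = 0"
proof -
  define F where "F = (\<lambda>x. of_real (\<zeta>' x) - \<i> * of_real (g x))"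
  \<comment> \<open>Then f z' = F, which the kernels annihilate, and f^2 z' = F^2 / z', the
    integrand wanted. The division keeps square integrability since |z'| \<ge> Re z' = 1.\<close>
  define f where "f = (\<lambda>x. F x / z' x)"
  have L2: "L2_torus \<zeta>'" "L2_torus g"
    using H1 G by (auto simp: H1_torus_def dirichlet_to_neumann_def)
  then have per: "periodic_fun \<zeta>'" "periodic_fun g" by (auto simp: L2_torus_def)
  have [measurable]: "\<zeta>' \<in> borel_measurable borel" "g \<in> borel_measurable borel"
    using periodic_borel_measurable per L2_torus_circ(1) L2 by auto
  have [measurable]: "F \<in> borel_measurable borel" unfolding F_def by measurable
  have z'1: "1 \<le> norm (z' x)" for x
    using abs_Re_le_cmod[of "z' x"] by (simp add: z'_def)
  then have z'0: "z' x \<noteq> 0" for x by (metis norm_zero not_one_le_zero)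
  have F2: "(norm (F x))\<^sup>2 = (\<zeta>' x)\<^sup>2 + (g x)\<^sup>2" for x
    by (simp add: F_def cmod_power2)
  interpret graph_L2 h h' f
  proof
    show "f \<in> borel_measurable borel" unfolding f_def by measurable
    show "f (x + 2 * pi) = f x" for x
      using per by (simp add: f_def F_def z'_def h'_periodic periodic_fun_def)
    have "(\<integral>\<^sup>+x\<in>{0..2 * pi}. ennreal ((norm (f x))\<^sup>2) \<partial>lborel) \<le> (\<integral>\<^sup>+x\<in>{0..2 * pi}. ennreal ((\<zeta>' x)\<^sup>2 + (g x)\<^sup>2) \<partial>lborel)"
    proof (intro nn_integral_mono mult_right_mono ennreal_leI)
      fix x
      have "norm (f x) \<le> norm (F x) / 1"
        unfolding f_def norm_divide using z'1[of x] by (intro divide_left_mono) auto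
      then have "(norm (f x))\<^sup>2 \<le> (norm (F x))\<^sup>2" by (intro power_mono) auto
      then show "(norm (f x))\<^sup>2 \<le> (\<zeta>' x)\<^sup>2 + (g x)\<^sup>2" by (simp add: F2)
    qed auto
    also have "\<dots> = (\<integral>\<^sup>+x. ennreal (norm ((\<zeta>' x)\<^sup>2 + (g x)\<^sup>2)) \<partial>circ)"
      by (simp add: nn_integral_restrict_space)
    also have "\<dots> < \<infinity>"
      using Bochner_Integration.integrable_add[OF L2_torus_circ(2)[OF L2(1)] L2_torus_circ(2)[OF L2(2)]]
      by (simp only: integrable_iff_bounded)
    finally show "(\<integral>\<^sup>+x\<in>{0..2 * pi}. ennreal ((norm (f x))\<^sup>2) \<partial>lborel) < \<infinity>" .
  qed
  have F_int: "integrable circ F"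
    unfolding F_def using L2_torus_circ(3) L2 by auto
  have "(LINT x|circ. (f x)\<^sup>2 * z' x) = 0"
  proof (rule integral_square_eq_0)
    fix r s :: real assume "r > 1"
    then have "(LINT x|circ. F x * K r x s) = 0"
      using DtN_moments[OF H1 G] by (intro integral_K_eq_0[OF F_int]) (simp_all add: F_def)
    then show "(LINT x|circ. f x * z' x * K r x s) = 0" using z'0 by (simp add: f_def)
  qed
  then show ?thesis using z'0 by (simp add: f_def F_def power2_eq_square)
qed

lemma DtN_Rellich_identity:
  assumes H1: "H1_torus \<zeta> \<zeta>'" and G: "dirichlet_to_neumann h \<zeta> g"
  shows "integrable circ (\<lambda>x. ((\<zeta>' x)\<^sup>2 - (g x)\<^sup>2 - 2 * \<zeta>' x * g x * h' x) / (1 + (h' x)\<^sup>2))"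
    and "(LINT x|circ. ((\<zeta>' x)\<^sup>2 - (g x)\<^sup>2 - 2 * \<zeta>' x * g x * h' x) / (1 + (h' x)\<^sup>2)) = 0"
proof -
  let ?f = "\<lambda>x. (of_real (\<zeta>' x) - \<i> * of_real (g x))\<^sup>2 / z' x"
  have L2: "L2_torus \<zeta>'" "L2_torus g"
    using H1 G by (auto simp: H1_torus_def dirichlet_to_neumann_def)
  have z'1: "1 \<le> norm (z' x)" for x
    using abs_Re_le_cmod[of "z' x"] by (simp add: z'_def)
  have [measurable]: "\<zeta>' \<in> borel_measurable circ" "g \<in> borel_measurable circ"
    using L2_torus_circ(1) L2 by auto
  have int: "integrable circ ?f"
  proof (rule Bochner_Integration.integrable_bound)
    show "integrable circ (\<lambda>x. (\<zeta>' x)\<^sup>2 + (g x)\<^sup>2)"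
      using L2_torus_circ(2) L2 by auto
    show "AE x in circ. norm (?f x) \<le> norm ((\<zeta>' x)\<^sup>2 + (g x)\<^sup>2)"
    proof (rule AE_I2)
      fix x
      have "norm (?f x) \<le> (norm (of_real (\<zeta>' x) - \<i> * of_real (g x)))\<^sup>2 / 1"
        unfolding norm_divide norm_power using z'1[of x] by (intro divide_left_mono) auto
      then show "norm (?f x) \<le> norm ((\<zeta>' x)\<^sup>2 + (g x)\<^sup>2)" by (simp add: cmod_power2)
    qed
  qed measurable
  have Re: "Re (?f x) = ((\<zeta>' x)\<^sup>2 - (g x)\<^sup>2 - 2 * \<zeta>' x * g x * h' x) / (1 + (h' x)\<^sup>2)" for x
    by (simp add: z'_def Re_divide power2_eq_square algebra_simps)
  show "integrable circ (\<lambda>x. ((\<zeta>' x)\<^sup>2 - (g x)\<^sup>2 - 2 * \<zeta>' x * g x * h' x) / (1 + (h' x)\<^sup>2))"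
    using integrable_Re[OF int] by (simp only: Re)
  show "(LINT x|circ. ((\<zeta>' x)\<^sup>2 - (g x)\<^sup>2 - 2 * \<zeta>' x * g x * h' x) / (1 + (h' x)\<^sup>2)) = 0"
    using integral_Re[OF int] by (simp only: Re DtN_contour_identity[OF H1 G]) simp
qed

end

section \<open>The two inequalities\<close>

theorem theorem1p5:
  fixes h \<zeta> \<zeta>\<^sub>x G\<zeta> :: "real \<Rightarrow> real"
  assumes "C1_torus h"
    and "H1_torus \<zeta> \<zeta>\<^sub>x"
    and "dirichlet_to_neumann h \<zeta> G\<zeta>"
  shows "(LINT x:{0..2 * pi}|lborel. (G\<zeta> x)\<^sup>2 / (1 + (deriv h x)\<^sup>2))
           \<le> 4 * (LINT x:{0..2 * pi}|lborel. (\<zeta>\<^sub>x x)\<^sup>2)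
         \<and> (LINT x:{0..2 * pi}|lborel. (\<zeta>\<^sub>x x)\<^sup>2 / (1 + (deriv h x)\<^sup>2))
           \<le> 4 * (LINT x:{0..2 * pi}|lborel. (G\<zeta> x)\<^sup>2)"
proof -
  obtain h' where h': "\<And>x. (h has_real_derivative h' x) (at x)" "continuous_on UNIV h'"
    using assms(1) unfolding C1_torus_def C1_differentiable_on_def
    by (auto simp: has_real_derivative_iff_has_vector_derivative)
  interpret C1_graph h h'
    using assms(1) h' by unfold_locales (auto simp: C1_torus_def periodic_fun_def)
  have deriv_eq: "deriv h x = h' x" for x by (rule DERIV_imp_deriv[OF h'(1)])
  have L2: "L2_torus \<zeta>\<^sub>x" "L2_torus G\<zeta>"
    using assms(2,3) by (auto simp: H1_torus_def dirichlet_to_neumann_def)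
  define D where "D = (\<lambda>x. ((\<zeta>\<^sub>x x)\<^sup>2 - (G\<zeta> x)\<^sup>2 - 2 * \<zeta>\<^sub>x x * G\<zeta> x * h' x) / (1 + (h' x)\<^sup>2))"
  note D = DtN_Rellich_identity[OF assms(2,3), folded D_def]
  \<comment> \<open>Adding a multiple of D, whose integral is 0, reduces each integral inequality to
    a pointwise one.\<close>
  have bound: "(LINT x|circ. (a x)\<^sup>2 / (1 + (h' x)\<^sup>2)) \<le> 4 * (LINT x|circ. (b x)\<^sup>2)"
    if "integrable circ (\<lambda>x. (b x)\<^sup>2)" and le: "\<And>x. (a x)\<^sup>2 / (1 + (h' x)\<^sup>2) \<le> 4 * (b x)\<^sup>2 + c * D x"
    for a b :: "real \<Rightarrow> real" and c
  proof -
    have "(LINT x|circ. (a x)\<^sup>2 / (1 + (h' x)\<^sup>2)) \<le> (LINT x|circ. 4 * (b x)\<^sup>2 + c * D x)"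
    proof (rule integral_mono_AE')
      show "integrable circ (\<lambda>x. 4 * (b x)\<^sup>2 + c * D x)" using that(1) D(1) by simp
      have "0 \<le> (a x)\<^sup>2 / (1 + (h' x)\<^sup>2)" for x by simp
      then show "AE x in circ. 0 \<le> 4 * (b x)\<^sup>2 + c * D x" using le order.trans by blast
    qed (use le in simp)
    also have "\<dots> = 4 * (LINT x|circ. (b x)\<^sup>2)"
      using that(1) D by simp
    finally show ?thesis .
  qed
  have pos: "1 + (h' x)\<^sup>2 > 0" for x by (simp add: add_pos_nonneg)
  have "(G\<zeta> x)\<^sup>2 / (1 + (h' x)\<^sup>2) \<le> 4 * (\<zeta>\<^sub>x x)\<^sup>2 + (- 2) * D x" for x
  proof -
    let ?n = "(\<zeta>\<^sub>x x)\<^sup>2 - (G\<zeta> x)\<^sup>2 - 2 * \<zeta>\<^sub>x x * G\<zeta> x * h' x"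
    \<comment> \<open>Origin of the constant: with multiplier m > 1 in place of 2 and K in place of
      4, the terms with h' or without \<zeta>_x form a quadratic form in \<zeta>_x h' and G\<zeta>
      that is nonnegative exactly when K (m - 1) \<ge> m^2. The least such K is 4, at m = 2, where
      the form is a perfect square.\<close>
    have "4 * (\<zeta>\<^sub>x x)\<^sup>2 * (1 + (h' x)\<^sup>2) - ((G\<zeta> x)\<^sup>2 + 2 * ?n)
        = 2 * (\<zeta>\<^sub>x x)\<^sup>2 + (2 * \<zeta>\<^sub>x x * h' x + G\<zeta> x)\<^sup>2"
      by (simp add: power2_eq_square algebra_simps)
    also have "\<dots> \<ge> 0" by simp
    finally have "((G\<zeta> x)\<^sup>2 + 2 * ?n) / (1 + (h' x)\<^sup>2) \<le> 4 * (\<zeta>\<^sub>x x)\<^sup>2"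
      using pos[of x] by (simp add: pos_divide_le_eq)
    moreover have "((G\<zeta> x)\<^sup>2 + 2 * ?n) / (1 + (h' x)\<^sup>2) = (G\<zeta> x)\<^sup>2 / (1 + (h' x)\<^sup>2) + 2 * D x"
      by (simp only: D_def add_divide_distrib times_divide_eq_right)
    ultimately show ?thesis by linarith
  qed
  moreover have "(\<zeta>\<^sub>x x)\<^sup>2 / (1 + (h' x)\<^sup>2) \<le> 4 * (G\<zeta> x)\<^sup>2 + 2 * D x" for x
  proof -
    let ?n = "(\<zeta>\<^sub>x x)\<^sup>2 - (G\<zeta> x)\<^sup>2 - 2 * \<zeta>\<^sub>x x * G\<zeta> x * h' x"
    \<comment> \<open>The same form with the roles of \<zeta>_x and G\<zeta> exchanged and the sign
      of h' reversed. This changes the sign of the Rellich numerator, so D enters with + 2.\<close>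
    have "4 * (G\<zeta> x)\<^sup>2 * (1 + (h' x)\<^sup>2) - ((\<zeta>\<^sub>x x)\<^sup>2 - 2 * ?n)
        = 2 * (G\<zeta> x)\<^sup>2 + (\<zeta>\<^sub>x x - 2 * G\<zeta> x * h' x)\<^sup>2"
      by (simp add: power2_eq_square algebra_simps)
    also have "\<dots> \<ge> 0" by simp
    finally have "((\<zeta>\<^sub>x x)\<^sup>2 - 2 * ?n) / (1 + (h' x)\<^sup>2) \<le> 4 * (G\<zeta> x)\<^sup>2"
      using pos[of x] by (simp add: pos_divide_le_eq)
    moreover have "((\<zeta>\<^sub>x x)\<^sup>2 - 2 * ?n) / (1 + (h' x)\<^sup>2) = (\<zeta>\<^sub>x x)\<^sup>2 / (1 + (h' x)\<^sup>2) - 2 * D x"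
    proof -
      have "(p - 2 * n) / m = p / m - 2 * (n / m)" for p n m :: real
        by (simp add: diff_divide_distrib)
      then show ?thesis unfolding D_def .
    qed
    ultimately show ?thesis by linarith
  qed
  ultimately show ?thesis
    unfolding set_lebesgue_integral_circ deriv_eq using bound L2_torus_circ(2) L2 by blast
qed

end
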